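(* Let $\alpha=0$ and $\kappa>0$. Let $z^0=(u^0,\rho^0)\in H^s(\mathbb S)\times H^{s-1}(\mathbb S)$, $s\ge 3$, be such that either $\rho^0(x)>0$ for all $x\in\mathbb S$, or $\rho^0(x)<0$ for all $x\in\mathbb S$. Let $T\in(0,\infty)$ be the existence time of the solution $z=(u,\rho)$ of the generalized two-component Hunter–Saxton system with initial datum $z^0$. Then $\|z(t,\cdot)\|_{H^s\times H^{s-1}}$ is bounded on $[0,T)$.
   Context: $\mathbb S=\mathbb R/\mathbb Z$; $H^r(\mathbb S)$ are the $L^2$-based Sobolev spaces. For $(\alpha,\kappa)\in\mathbb R\times\mathbb R$, the generalized two-component Hunter–Saxton system is $$u_{txx}+(1-\alpha)u_xu_{xx}+uu_{xxx}-\kappa\rho\rho_x=0,\qquad \rho_t+u\rho_x=\alpha u_x\rho,\qquad t>0,\ x\in\mathbb R,$$ with $u(t,x+1)=u(t,x)$, $\rho(t,x+1)=\rho(t,x)$, $u(0,x)=u^0(x)$, $\rho(0,x)=\rho^0(x)$. Integrating the first equation twice in space gives $$u_t+uu_x=\partial_x^{-1}\Big(\tfrac{\kappa}{2}\rho^2+\tfrac{\alpha+2}{2}u_x^2+a(t)\Big)+h(t),\qquad \partial_x^{-1}f(x)=\int_0^x f(y)\,dy,$$ with $a(t)=-\frac{\kappa}{2}\int_{\mathbb S}\rho^2dx-\frac{\alpha+2}{2}\int_{\mathbb S}u_x^2dx$ and $h:[0,\infty)\to\mathbb R$ an arbitrary continuous function, which is fixed once and for all (e.g. $h\equiv0$);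 "the solution" means the solution of this integrated equation together with the $\rho$-equation. For $z^0\in H^s\times H^{s-1}$, $s\ge2$, the solution is of class $C([0,T);H^s\times H^{s-1})\cap C^1([0,T);H^{s-1}\times H^{s-2})$. $T$ denotes any finite existence time: the solution is defined in this class on $[0,T)$. *)

theory Defs
  imports "HOL-Analysis.Analysis"
begin

text \<open>
  A function on the circle \<open>\<real>/\<int>\<close> is represented by a 1-periodic function on \<open>\<real>\<close>, and
  integration over the circle by integration over \<open>{0..1}\<close>.
\<close>

definition circle_integral :: "(real \<Rightarrow> real) \<Rightarrow> real" where
  "circle_integral f = (LINT x:{0..1}|lborel. f x)"

definition fourier_coeff :: "(real \<Rightarrow> real) \<Rightarrow> int \<Rightarrow> complex" where
  "fourier_coeff f k =
     (LINT x:{0..1}|lborel. complex_of_real (f x) * cis (- (2 * pi * of_int k * x)))"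

definition sobolev_term :: "real \<Rightarrow> (real \<Rightarrow> real) \<Rightarrow> int \<Rightarrow> real" where
  "sobolev_term r f k = (1 + (2 * pi * of_int k)\<^sup>2) powr r * (cmod (fourier_coeff f k))\<^sup>2"

text \<open>
  \<open>sobolev r\<close> is \<open>H\<^sup>r\<close> of the circle as a set of functions (not classes modulo null sets), meant for
  \<open>r \<ge> 0\<close>. For \<open>r > 1/2\<close> every class contains exactly one continuous function; where
  pointwise values matter, continuity is required separately below.
\<close>

definition sobolev :: "real \<Rightarrow> (real \<Rightarrow> real) set" where
  "sobolev r = {f. (\<forall>x. f (x + 1) = f x) \<and> f \<in> borel_measurable borel \<and>
     set_integrable lborel {0..1} (\<lambda>x. (f x)\<^sup>2) \<and> sobolev_term r f summable_on UNIV}"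

text \<open>This is the norm of \<open>(1 - \<partial>\<^sub>x\<^sup>2)\<^bsup>r/2\<^esup> f\<close> in \<open>L\<^sup>2\<close>; it is meaningful only for \<open>f \<in> sobolev r\<close>,
  since \<^const>\<open>infsum\<close> of a non-summable family is 0.\<close>

definition sobolev_norm :: "real \<Rightarrow> (real \<Rightarrow> real) \<Rightarrow> real" where
  "sobolev_norm r f = sqrt (\<Sum>\<^sub>\<infinity>k\<in>UNIV. sobolev_term r f k)"

definition sobolev_pair_norm ::
  "real \<Rightarrow> real \<Rightarrow> (real \<Rightarrow> real) \<times> (real \<Rightarrow> real) \<Rightarrow> real" where
  "sobolev_pair_norm r r' z = sqrt ((sobolev_norm r (fst z))\<^sup>2 + (sobolev_norm r' (snd z))\<^sup>2)"

text \<open>\<open>C([0,T); H\<^sup>r)\<close>, with values given by continuous representatives.\<close>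

definition sobolev_C0 :: "real \<Rightarrow> real \<Rightarrow> (real \<Rightarrow> real \<Rightarrow> real) \<Rightarrow> bool" where
  "sobolev_C0 r T w \<longleftrightarrow>
     (\<forall>t\<in>{0..<T}. w t \<in> sobolev r \<and> continuous_on UNIV (w t)) \<and>
     (\<forall>t\<in>{0..<T}. ((\<lambda>\<tau>. sobolev_norm r (\<lambda>x. w \<tau> x - w t x)) \<longlongrightarrow> 0) (at t within {0..<T}))"

text \<open>\<open>w \<in> C\<^sup>1([0,T); H\<^sup>r)\<close> with time derivative \<open>w'\<close> (one-sided at \<open>t = 0\<close>).\<close>

definition sobolev_C1 ::
  "real \<Rightarrow> real \<Rightarrow> (real \<Rightarrow> real \<Rightarrow> real) \<Rightarrow> (real \<Rightarrow> real \<Rightarrow> real) \<Rightarrow> bool" where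
  "sobolev_C1 r T w w' \<longleftrightarrow> sobolev_C0 r T w \<and> sobolev_C0 r T w' \<and>
     (\<forall>t\<in>{0..<T}. ((\<lambda>\<tau>. sobolev_norm r (\<lambda>x. (w \<tau> x - w t x) / (\<tau> - t) - w' t x)) \<longlongrightarrow> 0)
        (at t within {0..<T}))"

text \<open>The oriented integral of \<open>f\<close> from 0 to \<open>x\<close> (\<open>x\<close> may be negative).\<close>

definition x_antideriv :: "(real \<Rightarrow> real) \<Rightarrow> real \<Rightarrow> real" where
  "x_antideriv f x = (LBINT y=ereal 0..ereal x. f y)"

definition HS_a :: "real \<Rightarrow> real \<Rightarrow> (real \<Rightarrow> real) \<Rightarrow> (real \<Rightarrow> real) \<Rightarrow> real" where
  "HS_a \<alpha> \<kappa> v \<sigma> =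
     - (\<kappa> / 2) * circle_integral (\<lambda>x. (\<sigma> x)\<^sup>2)
     - ((\<alpha> + 2) / 2) * circle_integral (\<lambda>x. (deriv v x)\<^sup>2)"

text \<open>
  Solutions on \<open>[0,T)\<close> of the integrated generalized two-component Hunter--Saxton system.
  The space derivatives are classical, so the definition is meant for \<open>s > 5/2\<close>, when
  \<open>H\<^bsup>s-1\<^esup>\<close> embeds into \<open>C\<^sup>1\<close>.
\<close>

definition HS_solution ::
  "real \<Rightarrow> real \<Rightarrow> (real \<Rightarrow> real) \<Rightarrow> real \<Rightarrow> real \<Rightarrow> (real \<Rightarrow> real) \<Rightarrow> (real \<Rightarrow> real) \<Rightarrow>
   (real \<Rightarrow> real \<Rightarrow> real) \<Rightarrow> (real \<Rightarrow> real \<Rightarrow> real) \<Rightarrow> bool" where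
  "HS_solution \<alpha> \<kappa> h s T u0 \<rho>0 u \<rho> \<longleftrightarrow>
     sobolev_C0 s T u \<and> sobolev_C0 (s - 1) T \<rho> \<and>
     u 0 = u0 \<and> \<rho> 0 = \<rho>0 \<and>
     (\<exists>ut \<rho>t. sobolev_C1 (s - 1) T u ut \<and> sobolev_C1 (s - 2) T \<rho> \<rho>t \<and>
       (\<forall>t\<in>{0<..<T}. \<forall>x.
          ut t x + u t x * deriv (u t) x =
            x_antideriv (\<lambda>y. \<kappa> / 2 * (\<rho> t y)\<^sup>2 + (\<alpha> + 2) / 2 * (deriv (u t) y)\<^sup>2
                              + HS_a \<alpha> \<kappa> (u t) (\<rho> t)) x + h t \<and>
          \<rho>t t x + u t x * deriv (\<rho> t) x = \<alpha> * deriv (u t) x * \<rho> t x))"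

end

theory Submission imports Defs begin

text \<open>
  Write \<open>D\<^sub>t = \<partial>\<^sub>t + u \<partial>\<^sub>x\<close> for the derivative along the flow of \<open>u\<close>. For \<open>\<alpha> = 0\<close> the second equation
  reads \<open>D\<^sub>t \<rho> = 0\<close>, and the \<open>x\<close>-derivative of the first one is \<open>D\<^sub>t u\<^sub>x = \<kappa>/2 \<rho>\<^sup>2 + a(t)\<close>, because the
  two terms \<open>u\<^sub>x\<^sup>2\<close> cancel. Both can be integrated explicitly along the flow \<open>\<phi>\<close>:
  \<open>\<rho>(t, \<phi>) = \<rho>\<^sub>0\<close>, \<open>u\<^sub>x(t, \<phi>) = u\<^sub>0' + \<kappa>/2 t \<rho>\<^sub>0\<^sup>2 + A(t)\<close> and
  \<open>\<phi>\<^sub>x = exp (t u\<^sub>0' + \<kappa>/4 t\<^sup>2 \<rho>\<^sub>0\<^sup>2 + B(t))\<close> (\<open>flow_structure\<close>). The two numbers \<open>A\<close> and \<open>B\<close> stay bounded on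
  \<open>[0,T)\<close>: \<open>B\<close> because \<open>\<phi>\<^sub>x\<close> has mean one, \<open>A\<close> because \<open>u\<^sub>x\<close> has mean zero. Hence, in Lagrangian
  coordinates, \<open>u\<^sub>x\<close>, \<open>\<rho>\<close> and \<open>ln \<phi>\<^sub>x\<close> are bounded in \<open>H\<^sup>r\<close>, \<open>r = s - 1\<close>, uniformly in time. All blow-up
  is thereby excluded once the passage back to Eulerian coordinates is bounded on \<open>H\<^sup>r\<close>; the mean of
  \<open>u\<close>, which \<open>u\<^sub>x\<close> does not see, is controlled by the equation at \<open>x = 0\<close> and a Gronwall argument
  (\<open>origin_bound\<close>).

  The analytic core is therefore a statement about a fixed time (\<open>csobolev_compose_bound\<close>): if
  \<open>f \<circ> \<phi> = g\<close> and \<open>\<phi>' = exp p\<close>, then \<open>f\<close> is bounded in \<open>H\<^sup>r\<close> in terms of bounds for \<open>p\<close> and \<open>g\<close> in \<open>H\<^sup>r\<close>, for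
  every real \<open>r \<ge> 1\<close>. The inverse of \<open>\<phi>\<close> never appears, since the Fourier coefficients of \<open>f\<close> are
  \<open>\<integral> g exp (- 2 \<pi> i k \<phi>) \<phi>'\<close> (\<open>pull_coeff\<close>). In this form, integration by parts trades a factor \<open>k\<close> for the
  operator \<open>G \<mapsto> exp (- p) G'\<close>, and Bessel's inequality holds for the orthonormal system
  \<open>exp (2 \<pi> i k \<phi>)\<close> with weight \<open>\<phi>'\<close>. With \<open>m = \<lfloor>r\<rfloor>\<close>, a bound for \<open>p\<close> in \<open>H\<^sup>m\<close> suffices for \<open>m + 1\<close> such integrations
  by parts, so \<open>g \<mapsto> f\<close> is bounded at the orders \<open>0\<close> and \<open>m + 1\<close> (\<open>pull_coeff_endpoint_bounds\<close>).
  Splitting \<open>g\<close> at dyadic frequencies interpolates between the two (\<open>dyadic_interpolation\<close>). These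
  estimates are carried out for trigonometric polynomials and passed to the limit in each coefficient.

  The remaining ingredients are classical: Fourier inversion for continuous functions in \<open>H\<^sup>r\<close>, \<open>r \<ge> 1\<close>,
  with the resulting embedding into \<open>C\<^sup>j\<close> for \<open>r \<ge> j + 1\<close>; stability of \<open>H\<^sup>r\<close> under squaring, needed for
  \<open>\<rho>\<^sub>0\<^sup>2\<close>; and the theorem of Picard and Lindelof, which provides the flow.
\<close>

section \<open>Circle maps and transported Fourier coefficients\<close>

text \<open>
  \<open>\<phi>\<close> is the lift to \<open>\<real>\<close> of a monotone degree-one map of the circle with derivative \<open>J\<close>. The derivative
  is carried as a second argument because all integrals below have it as their weight.
\<close>

definition circle_map :: "(real \<Rightarrow> real) \<Rightarrow> (real \<Rightarrow> real) \<Rightarrow> bool" where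
  "circle_map \<phi> J \<longleftrightarrow> (\<forall>x. \<phi> (x + 1) = \<phi> x + 1) \<and>
     (\<forall>x. (\<phi> has_real_derivative J x) (at x)) \<and> continuous_on UNIV J \<and> (\<forall>x. J x \<ge> 0)"

abbreviation freq :: "int \<Rightarrow> real" where
  "freq k \<equiv> 2 * pi * of_int k"

text \<open>
  If \<open>G = f \<circ> \<phi>\<close>, this is the Fourier coefficient of \<open>f\<close>, written by substitution as an integral in the
  variable of \<open>G\<close> (\<open>pull_coeff_compose\<close>). It makes sense for every \<open>G\<close> and avoids inverting \<open>\<phi>\<close>.
\<close>

definition pull_coeff :: "(real \<Rightarrow> real) \<Rightarrow> (real \<Rightarrow> real) \<Rightarrow> (real \<Rightarrow> real) \<Rightarrow> int \<Rightarrow> complex" where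
  "pull_coeff \<phi> J G k =
     integral {0..1} (\<lambda>x. complex_of_real (G x * J x) * cis (- (freq k * \<phi> x)))"

lemma fundamental_theorem_real:
  fixes F :: "real \<Rightarrow> real"
  assumes "a \<le> b" "\<And>x. (F has_real_derivative f x) (at x)"
  shows "(f has_integral (F b - F a)) {a..b}"
  using assms
  by (intro fundamental_theorem_of_calculus)
     (auto simp: has_real_derivative_iff_has_vector_derivative[symmetric] intro: has_field_derivative_at_within)

lemma norm_add_power2_le:
  fixes a b :: "'a :: real_normed_vector"
  shows "(norm (a + b))\<^sup>2 \<le> 2 * (norm a)\<^sup>2 + 2 * (norm b)\<^sup>2"
proof -
  have "(norm (a + b))\<^sup>2 \<le> (norm a + norm b)\<^sup>2" by (intro power_mono norm_triangle_ineq) auto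
  thus ?thesis using sum_squares_bound[of "norm a" "norm b"] by (simp add: power2_sum)
qed

lemma circle_map_id: "circle_map (\<lambda>x. x) (\<lambda>x. 1)"
  by (simp add: circle_map_def)

lemma circle_map_one: "circle_map \<phi> J \<Longrightarrow> \<phi> 1 = \<phi> 0 + 1"
  unfolding circle_map_def by (metis add_0)

lemma circle_map_continuous: "circle_map \<phi> J \<Longrightarrow> continuous_on A \<phi>"
  unfolding circle_map_def
  by (metis DERIV_isCont continuous_at_imp_continuous_on)

lemma circle_map_continuous_deriv: "circle_map \<phi> J \<Longrightarrow> continuous_on A J"
  unfolding circle_map_def by (metis continuous_on_subset subset_UNIV)

lemma cis_2pi_periodic: "cis (freq k * (y + 1)) = cis (freq k * y)"
  by (simp add: distrib_left cis_mult[symmetric] cis_multiple_2pi)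

lemma circle_map_cis_derivative:
  assumes "circle_map \<phi> J"
  shows "((\<lambda>x. cis (freq k * \<phi> x)) has_vector_derivative
     complex_of_real (freq k * J x) * \<i> * cis (freq k * \<phi> x)) (at x within A)"
proof -
  have "(\<phi> has_real_derivative J x) (at x within A)"
    using assms unfolding circle_map_def by (blast intro: has_field_derivative_at_within)
  hence *: "((\<lambda>x. freq k * \<phi> x) has_real_derivative freq k * J x) (at x within A)"
    by (rule DERIV_cmult)
  show ?thesis
    unfolding has_vector_derivative_def
    by (rule has_derivative_eq_rhs[OF has_derivative_cis[OF *[unfolded has_field_derivative_def]]])
       (auto simp: fun_eq_iff scaleR_conv_of_real algebra_simps)
qed

lemma circle_map_orthogonality:
  assumes "circle_map \<phi> J"
  shows "integral {0..1} (\<lambda>x. complex_of_real (J x) * cis (freq k * \<phi> x)) = (if k = 0 then 1 else 0)"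
proof (cases "k = 0")
  case True
  have "(J has_integral (\<phi> 1 - \<phi> 0)) {0..1}"
    by (rule fundamental_theorem_real) (use assms in \<open>auto simp: circle_map_def\<close>)
  hence "((\<lambda>x. complex_of_real (J x)) has_integral of_real 1) {0..1}"
    by (intro has_integral_of_real) (simp add: circle_map_one[OF assms])
  thus ?thesis using True by (simp add: integral_unique)
next
  case False
  define c where "c = complex_of_real (freq k) * \<i>"
  have c: "c \<noteq> 0" using False by (simp add: c_def)
  note \<phi>1 = circle_map_one[OF assms]
  have "((\<lambda>x. c * (complex_of_real (J x) * cis (freq k * \<phi> x))) has_integral
      (cis (freq k * \<phi> 1) - cis (freq k * \<phi> 0))) {0..1}"
    by (rule fundamental_theorem_of_calculus)
       (auto intro!: has_vector_derivative_eq_rhs[OF circle_map_cis_derivative[OF assms]] simp: c_def)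
  hence "((\<lambda>x. c * (complex_of_real (J x) * cis (freq k * \<phi> x))) has_integral 0) {0..1}"
    unfolding \<phi>1 cis_2pi_periodic by simp
  hence "((\<lambda>x. inverse c * (c * (complex_of_real (J x) * cis (freq k * \<phi> x)))) has_integral inverse c * 0) {0..1}"
    by (rule has_integral_mult_right)
  hence "((\<lambda>x. complex_of_real (J x) * cis (freq k * \<phi> x)) has_integral 0) {0..1}"
    using c by (simp add: mult.assoc[symmetric])
  thus ?thesis using False by (simp add: integral_unique)
qed

lemma pull_coeff_integrable:
  assumes "circle_map \<phi> J" "continuous_on UNIV G"
  shows "(\<lambda>x. complex_of_real (G x * J x) * cis (- (freq k * \<phi> x))) integrable_on {0..1}"
  by (intro integrable_continuous_real continuous_intros circle_map_continuous[OF assms(1)]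
      circle_map_continuous_deriv[OF assms(1)] continuous_on_subset[OF assms(2)]) auto

lemma pull_coeff_add:
  assumes "circle_map \<phi> J" "continuous_on UNIV G" "continuous_on UNIV H"
  shows "pull_coeff \<phi> J (\<lambda>x. G x + H x) k = pull_coeff \<phi> J G k + pull_coeff \<phi> J H k"
  unfolding pull_coeff_def
  by (subst integral_add[symmetric])
     (use pull_coeff_integrable[OF assms(1,2)] pull_coeff_integrable[OF assms(1,3)]
       in \<open>auto simp: algebra_simps\<close>)

text \<open>
  In terms of \<open>f\<close> with \<open>f \<circ> \<phi> = G\<close>, this is the rule for the Fourier coefficients of a derivative:
  \<open>f' \<circ> \<phi> = G' / J = H\<close>. The boundary terms of the integration by parts cancel by periodicity.
\<close>

lemma pull_coeff_derivative:
  assumes \<phi>: "circle_map \<phi> J" and G: "\<And>x. (G has_real_derivative G' x) (at x)"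
    and cont: "continuous_on UNIV G'" and per: "\<And>x. G (x + 1) = G x"
    and H: "\<And>x. G' x = H x * J x"
  shows "pull_coeff \<phi> J H k = complex_of_real (freq k) * \<i> * pull_coeff \<phi> J G k"
proof -
  let ?e = "\<lambda>x. cis (- (freq k * \<phi> x))"
  have contG: "continuous_on UNIV G"
    using G by (metis DERIV_isCont continuous_at_imp_continuous_on)
  have e: "(?e has_vector_derivative - complex_of_real (freq k * J x) * \<i> * ?e x) (at x within A)"
    for x A using circle_map_cis_derivative[OF \<phi>, of "-k" x A] by simp
  have G'': "(G has_real_derivative G' x) (at x within A)" for x A
    using G by (rule has_field_derivative_at_within)
  note \<phi>1 = circle_map_one[OF \<phi>]
  have G1: "G 1 = G 0" using per[of 0] by simp
  have e1: "?e 1 = ?e 0"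
    using cis_2pi_periodic[of "-k" "\<phi> 0"] by (simp add: \<phi>1)
  have "((\<lambda>x. complex_of_real (G x) * (- complex_of_real (freq k * J x) * \<i> * ?e x) + complex_of_real (G' x) * ?e x)
     has_integral (complex_of_real (G 1) * ?e 1 - complex_of_real (G 0) * ?e 0)) {0..1}"
    by (rule fundamental_theorem_of_calculus, simp)
       (rule has_vector_derivative_mult has_vector_derivative_of_real e G'')+
  hence 1: "integral {0..1} (\<lambda>x. complex_of_real (G x) * (- complex_of_real (freq k * J x) * \<i> * ?e x) + complex_of_real (G' x) * ?e x) = 0"
    by (simp add: G1 e1 integral_unique)
  let ?c = "complex_of_real (freq k) * \<i>"
  have I2: "(\<lambda>x. ?c * (complex_of_real (G x * J x) * ?e x)) integrable_on {0..1}"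
    by (intro integrable_continuous_real continuous_intros circle_map_continuous[OF \<phi>]
        circle_map_continuous_deriv[OF \<phi>] continuous_on_subset[OF contG]) auto
  have I1: "(\<lambda>x. complex_of_real (G' x) * ?e x) integrable_on {0..1}"
    by (intro integrable_continuous_real continuous_intros circle_map_continuous[OF \<phi>]
        continuous_on_subset[OF cont]) auto
  have "integral {0..1} (\<lambda>x. complex_of_real (G' x) * ?e x) - integral {0..1} (\<lambda>x. ?c * (complex_of_real (G x * J x) * ?e x)) = 0"
    unfolding integral_diff[OF I1 I2, symmetric] 1[symmetric]
    by (rule arg_cong[where f = "integral _"]) (auto simp: fun_eq_iff algebra_simps)
  moreover have "integral {0..1} (\<lambda>x. ?c * (complex_of_real (G x * J x) * ?e x)) = ?c * pull_coeff \<phi> J G k"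
    by (simp add: pull_coeff_def)
  ultimately show ?thesis
    unfolding pull_coeff_def H[symmetric] by simp
qed

lemma circle_map_parseval:
  assumes \<phi>: "circle_map \<phi> J" and K: "finite K"
  shows "integral {0..1} (\<lambda>x. J x * (cmod (\<Sum>k\<in>K. c k * cis (freq k * \<phi> x)))\<^sup>2)
    = (\<Sum>k\<in>K. (cmod (c k))\<^sup>2)"
proof -
  let ?e = "\<lambda>k x. cis (freq k * \<phi> x)"
  define S where "S = (\<lambda>x. \<Sum>k\<in>K. c k * ?e k x)"
  note cont = continuous_intros circle_map_continuous[OF \<phi>] circle_map_continuous_deriv[OF \<phi>]
  have contS: "continuous_on A S" for A unfolding S_def by (intro cont)
  have i2: "integral {0..1} (\<lambda>x. of_real (J x) * (S x * cnj (S x))) = (\<Sum>k\<in>K. of_real ((cmod (c k))\<^sup>2))"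
  proof -
    have "integral {0..1} (\<lambda>x. of_real (J x) * (S x * cnj (S x))) =
       integral {0..1} (\<lambda>x. \<Sum>k\<in>K. \<Sum>l\<in>K. (c k * cnj (c l)) * (of_real (J x) * cis (freq (k-l) * \<phi> x)))"
    proof (rule arg_cong[where f = "integral _"], rule ext)
      fix x
      have e: "cis (freq (k-l) * \<phi> x) = ?e k x * cnj (?e l x)" for k l
        by (simp add: cis_cnj cis_mult algebra_simps)
      show "of_real (J x) * (S x * cnj (S x)) =
        (\<Sum>k\<in>K. \<Sum>l\<in>K. (c k * cnj (c l)) * (of_real (J x) * cis (freq (k-l) * \<phi> x)))"
        unfolding S_def e cnj_sum complex_cnj_mult
        by (simp only: sum_product) (simp add: sum_distrib_left mult_ac)
    qed
    also have "\<dots> = (\<Sum>k\<in>K. \<Sum>l\<in>K. integral {0..1} (\<lambda>x. (c k * cnj (c l)) * (of_real (J x) * cis (freq (k-l) * \<phi> x))))"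
      by (subst integral_sum[OF K], intro integrable_continuous_real cont,
          intro sum.cong refl integral_sum[OF K] integrable_continuous_real cont)
    also have "\<dots> = (\<Sum>k\<in>K. \<Sum>l\<in>K. (c k * cnj (c l)) * (if k - l = 0 then 1 else 0))"
      by (simp only: integral_mult_right circle_map_orthogonality[OF \<phi>])
    also have "\<dots> = (\<Sum>k\<in>K. c k * cnj (c k))"
      using K by (intro sum.cong refl) (simp add: if_distrib cong: if_cong)
    also have "\<dots> = (\<Sum>k\<in>K. of_real ((cmod (c k))\<^sup>2))"
      by (intro sum.cong refl) (metis complex_norm_square)
    finally show ?thesis .
  qed
  have r2: "integral {0..1} (\<lambda>x. J x * (cmod (S x))\<^sup>2) = (\<Sum>k\<in>K. (cmod (c k))\<^sup>2)"
  proof -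
    have "integral {0..1} (\<lambda>x. Re (of_real (J x) * (S x * cnj (S x)))) = Re (integral {0..1} (\<lambda>x. of_real (J x) * (S x * cnj (S x))))"
      by (rule integral_linear[unfolded o_def, OF _ bounded_linear_Re])
         (intro integrable_continuous_real cont contS)

    thus ?thesis unfolding i2 by (simp add: complex_norm_square[symmetric] cmod_power2 flip: of_real_mult power2_eq_square)
  qed
  thus ?thesis by (simp add: S_def)
qed

text \<open>
  Bessel's inequality for the functions \<open>exp (2 \<pi> i k \<phi>)\<close>, which are orthonormal in \<open>L\<^sup>2\<close> with weight \<open>J\<close>.
  For the identity map it is the usual inequality on the circle.
\<close>

lemma bessel_pull:
  assumes \<phi>: "circle_map \<phi> J" and G: "continuous_on UNIV G" and K: "finite K"
  shows "(\<Sum>k\<in>K. (cmod (pull_coeff \<phi> J G k))\<^sup>2) \<le> integral {0..1} (\<lambda>x. (G x)\<^sup>2 * J x)"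
proof -
  let ?c = "pull_coeff \<phi> J G"
  let ?e = "\<lambda>k x. cis (freq k * \<phi> x)"
  define S where "S = (\<lambda>x. \<Sum>k\<in>K. ?c k * ?e k x)"
  note cont = continuous_intros circle_map_continuous[OF \<phi>] circle_map_continuous_deriv[OF \<phi>]
    continuous_on_subset[OF G subset_UNIV]
  have contS: "continuous_on A S" for A unfolding S_def by (intro cont)
  have i1: "integral {0..1} (\<lambda>x. of_real (G x * J x) * cnj (S x)) = (\<Sum>k\<in>K. of_real ((cmod (?c k))\<^sup>2))"
  proof -
    have "integral {0..1} (\<lambda>x. of_real (G x * J x) * cnj (S x)) =
       integral {0..1} (\<lambda>x. \<Sum>k\<in>K. cnj (?c k) * (of_real (G x * J x) * cis (- (freq k * \<phi> x))))"
      by (rule arg_cong[where f = "integral _"])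
         (auto simp: fun_eq_iff S_def sum_distrib_left cis_cnj algebra_simps)
    also have "\<dots> = (\<Sum>k\<in>K. integral {0..1} (\<lambda>x. cnj (?c k) * (of_real (G x * J x) * cis (- (freq k * \<phi> x)))))"
      using K by (intro integral_sum integrable_continuous_real cont) auto
    also have "\<dots> = (\<Sum>k\<in>K. cnj (?c k) * ?c k)"
      by (simp add: pull_coeff_def)
    also have "\<dots> = (\<Sum>k\<in>K. of_real ((cmod (?c k))\<^sup>2))"
      by (intro sum.cong refl) (metis complex_norm_square mult.commute)
    finally show ?thesis .
  qed
  let ?\<Sigma> = "\<Sum>k\<in>K. (cmod (?c k))\<^sup>2"
  have r1: "integral {0..1} (\<lambda>x. G x * J x * Re (S x)) = ?\<Sigma>"
  proof -
    have "integral {0..1} (\<lambda>x. Re (of_real (G x * J x) * cnj (S x))) = Re (integral {0..1} (\<lambda>x. of_real (G x * J x) * cnj (S x)))"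
      by (rule integral_linear[unfolded o_def, OF _ bounded_linear_Re])
         (intro integrable_continuous_real cont contS)

    thus ?thesis unfolding i1 by simp
  qed
  have r2: "integral {0..1} (\<lambda>x. J x * (cmod (S x))\<^sup>2) = ?\<Sigma>"
    unfolding S_def by (rule circle_map_parseval[OF \<phi> K])
  have "0 \<le> integral {0..1} (\<lambda>x. J x * (cmod (of_real (G x) - S x))\<^sup>2)"
    using \<phi> by (intro integral_nonneg integrable_continuous_real cont contS) (auto simp: circle_map_def)
  also have "(\<lambda>x. J x * (cmod (of_real (G x) - S x))\<^sup>2) =
       (\<lambda>x. (G x)\<^sup>2 * J x - 2 * (G x * J x * Re (S x)) + J x * (cmod (S x))\<^sup>2)"
    by (rule ext, simp only: cmod_power2) (simp add: power2_eq_square algebra_simps)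
  also have "integral {0..1} \<dots> = integral {0..1} (\<lambda>x. (G x)\<^sup>2 * J x - 2 * (G x * J x * Re (S x)))
      + integral {0..1} (\<lambda>x. J x * (cmod (S x))\<^sup>2)"
    by (intro integral_add integrable_continuous_real cont contS)
  also have "integral {0..1} (\<lambda>x. (G x)\<^sup>2 * J x - 2 * (G x * J x * Re (S x)))
      = integral {0..1} (\<lambda>x. (G x)\<^sup>2 * J x) - integral {0..1} (\<lambda>x. 2 * (G x * J x * Re (S x)))"
    by (intro integral_diff integrable_continuous_real cont contS)
  also have "integral {0..1} (\<lambda>x. 2 * (G x * J x * Re (S x))) = 2 * integral {0..1} (\<lambda>x. (G x * J x * Re (S x)))"
    by simp
  finally show ?thesis unfolding r1 r2 by simp
qed

section \<open>Uniqueness of Fourier coefficients\<close>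

lemma periodic_shift_int:
  fixes f :: "real \<Rightarrow> 'a"
  assumes "\<And>x. f (x + 1) = f x"
  shows "f (x + of_int n) = f x"
proof (induction n rule: int_induct[where k = 0])
  case (step1 i)
  thus ?case using assms[of "x + of_int i"] by (simp add: add.assoc)
next
  case (step2 i)
  thus ?case using assms[of "x + of_int i - 1"] by (simp add: algebra_simps)
qed auto

lemma periodic_frac:
  fixes f :: "real \<Rightarrow> 'a"
  assumes "\<And>x. f (x + 1) = f x"
  shows "f (frac x) = f x"
  using periodic_shift_int[of f, OF assms, of x "- \<lfloor>x\<rfloor>"] by (simp add: frac_def)

lemma frac_in_unit: "frac (x::real) \<in> {0..1}"
  using frac_ge_0[of x] frac_lt_1[of x] by simp

lemma fourier_coeff_eq_pull:
  assumes "continuous_on UNIV f"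
  shows "fourier_coeff f k = pull_coeff (\<lambda>x. x) (\<lambda>_. 1) f k"
proof -
  have "set_integrable lborel {0..1} (\<lambda>x. complex_of_real (f x) * cis (- (freq k * x)))"
    by (intro borel_integrable_atLeastAtMost' continuous_intros continuous_on_subset[OF assms]) auto
  thus ?thesis
    unfolding fourier_coeff_def pull_coeff_def by (simp add: set_borel_integral_eq_integral(2))
qed

lemma pull_coeff_cmult: "pull_coeff \<phi> J (\<lambda>x. c * G x) k = of_real c * pull_coeff \<phi> J G k"
  unfolding pull_coeff_def by (simp add: mult.assoc)

lemma fourier_coeff_add:
  assumes "continuous_on UNIV f" "continuous_on UNIV g"
  shows "fourier_coeff (\<lambda>x. f x + g x) k = fourier_coeff f k + fourier_coeff g k"
  using assms pull_coeff_add[OF circle_map_id assms]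
  by (simp add: fourier_coeff_eq_pull continuous_on_add)

lemma fourier_coeff_cmult:
  assumes "continuous_on UNIV f"
  shows "fourier_coeff (\<lambda>x. c * f x) k = of_real c * fourier_coeff f k"
  using assms by (simp add: fourier_coeff_eq_pull pull_coeff_cmult continuous_on_mult_left)

lemma fourier_coeff_Re_cis_mult:
  assumes f: "continuous_on UNIV f"
  shows "fourier_coeff (\<lambda>x. Re (c * cis (freq l * x)) * f x) k
    = (c * fourier_coeff f (k - l) + cnj c * fourier_coeff f (k + l)) / 2"
proof -
  note cf = continuous_on_subset[OF f subset_UNIV]
  have cont: "continuous_on UNIV (\<lambda>x. Re (c * cis (freq l * x)) * f x)"
    by (intro continuous_intros f)
  have e: "complex_of_real (Re (c * cis (freq l * x)) * f x * 1) * cis (- (freq k * x))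
     = (c * (complex_of_real (f x * 1) * cis (- (freq (k - l) * x)))
        + cnj c * (complex_of_real (f x * 1) * cis (- (freq (k + l) * x)))) / 2" for x
  proof -
    have a: "complex_of_real (Re (c * cis (freq l * x))) =
        (c * cis (freq l * x) + cnj c * cis (- (freq l * x))) / 2"
      by (simp add: complex_eq_iff)
    have b: "cis (- (freq (k - l) * x)) = cis (freq l * x) * cis (- (freq k * x))"
      "cis (- (freq (k + l) * x)) = cis (- (freq l * x)) * cis (- (freq k * x))"
      unfolding cis_mult by (rule arg_cong[where f = cis], simp add: algebra_simps)+
    show ?thesis
      unfolding mult_1_right of_real_mult a b
      by (simp only: ring_distribs times_divide_eq_left) (simp only: mult_ac)
  qed
  have I: "(\<lambda>x. a * (complex_of_real (f x * 1) * cis (- (freq j * x)))) integrable_on {0..1}" for a j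
    by (intro integrable_continuous_real continuous_intros cf)
  show ?thesis
    unfolding fourier_coeff_eq_pull[OF cont] fourier_coeff_eq_pull[OF f] pull_coeff_def e integral_divide integral_add[OF I I]
    by (simp only: integral_mult_right[where f = "\<lambda>x. complex_of_real (f x * 1) * cis (- (2 * pi * of_int _ * x))"])
qed

lemma periodic_cis_cong:
  fixes f :: "real \<Rightarrow> real"
  assumes per: "\<And>x. f (x + 1) = f x" and "cis a = cis b"
  shows "f (a / (2 * pi)) = f (b / (2 * pi))"
proof -
  have "sin a = sin b \<and> cos a = cos b"
    using assms(2) by (simp add: complex_eq_iff)
  then obtain n :: int where "a = b + 2 * pi * n"
    using sin_cos_eq_iff by auto
  hence "a / (2 * pi) = b / (2 * pi) + of_int n"
    by (simp add: field_simps)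
  thus ?thesis using periodic_shift_int[of f, OF per] by simp
qed

text \<open>
  The class of functions all of whose Fourier coefficients vanish is closed under multiplication by
  \<open>cos (2 \<pi> x)\<close> and \<open>sin (2 \<pi> x)\<close>, hence by polynomials in them. By the Stone-Weierstrass theorem on the
  unit circle, \<open>d\<close> is a uniform limit of such polynomials, so \<open>d\<close> is orthogonal to itself.
\<close>

lemma fourier_unique:
  assumes cont: "continuous_on UNIV d" and per: "\<And>x. d (x + 1) = d x"
    and zero: "\<And>k. fourier_coeff d k = 0"
  shows "d x = 0"
proof -
  let ?z = "\<lambda>x. cis (2 * pi * x)"
  have poly: "\<forall>k. fourier_coeff (\<lambda>x. e x * p (?z x)) k = 0"
    if "real_polynomial_function p" "continuous_on UNIV e" "\<forall>k. fourier_coeff e k = 0"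
    for p :: "complex \<Rightarrow> real" and e
    using that
  proof (induction p arbitrary: e rule: real_polynomial_function.induct)
    case (linear p)
    interpret bounded_linear p by fact
    have "p (?z x) = Re (Complex (p 1) (- p \<i>) * cis (2 * pi * of_int 1 * x))" for x
    proof -
      have "?z x = cos (2 * pi * x) *\<^sub>R 1 + sin (2 * pi * x) *\<^sub>R \<i>"
        by (simp add: complex_eq_iff)
      thus ?thesis by (simp only: add scaleR) (simp add: mult_ac)
    qed
    hence "(\<lambda>x. e x * p (?z x)) = (\<lambda>x. Re (Complex (p 1) (- p \<i>) * cis (2 * pi * of_int 1 * x)) * e x)"
      by (simp only: mult.commute)
    thus ?case using linear.prems by (simp only: fourier_coeff_Re_cis_mult) simp
  next
    case (const c)
    thus ?case using fourier_coeff_cmult[of e c] by (simp add: mult.commute)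
  next
    case (add f g)
    have c: "continuous_on UNIV (\<lambda>x. e x * f (?z x))" if "real_polynomial_function f" for f :: "complex \<Rightarrow> real"
      by (intro continuous_intros add.prems
          continuous_on_compose2[OF continuous_on_polymonial_function[of f UNIV]])
         (use that in \<open>auto simp: real_polynomial_function_eq\<close>)
    have eq: "(\<lambda>x. e x * (f (?z x) + g (?z x))) = (\<lambda>x. e x * f (?z x) + e x * g (?z x))"
      by (auto simp: algebra_simps)
    show ?case unfolding eq fourier_coeff_add[OF c[OF add.hyps(1)] c[OF add.hyps(2)]]
      using add.IH add.prems by simp
  next
    case (mult f g)
    have c: "continuous_on UNIV (\<lambda>x. e x * f (?z x))"
      by (intro continuous_intros mult.prems
          continuous_on_compose2[OF continuous_on_polymonial_function[of f UNIV]])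
         (use mult.hyps in \<open>auto simp: real_polynomial_function_eq\<close>)
    have eq: "(\<lambda>x. e x * (f (?z x) * g (?z x))) = (\<lambda>x. (e x * f (?z x)) * g (?z x))"
      by (auto simp: algebra_simps)
    show ?case unfolding eq by (rule mult.IH(2)[OF c mult.IH(1)[OF mult.prems]])
  qed
  \<comment> \<open>\<open>d\<close> as a function on the unit circle; \<open>Arg\<close> jumps on the negative axis and \<open>Arg2pi\<close> on the positive one, but both yield \<open>F\<close>\<close>
  define F where "F = (\<lambda>z. d (Arg z / (2 * pi)))"
  have F_cis: "F (?z x) = d x" for x
  proof -
    have "cis (Arg (?z x)) = cis (2 * pi * x)"
      using cis_Arg[of "?z x"] by (simp add: sgn_div_norm)
    from periodic_cis_cong[of d, OF per this] show ?thesis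
      by (simp add: F_def)
  qed
  have F2: "F z = d (Arg2pi z / (2 * pi))" if "cmod z = 1" for z
    unfolding F_def
  proof (rule periodic_cis_cong[of d, OF per])
    have "z \<noteq> 0" using that by auto
    hence "cis (Arg z) = z" using that by (simp add: cis_Arg sgn_div_norm)
    also have "z = cis (Arg2pi z)"
      using Arg2pi_eq[of z] that by (simp add: cis_conv_exp)
    finally show "cis (Arg z) = cis (Arg2pi z)" .
  qed
  have contd: "isCont d y" for y using cont by (simp add: continuous_on_eq_continuous_at)
  have contF: "continuous_on (sphere 0 1) F"
    unfolding continuous_on_eq_continuous_within
  proof
    fix z :: complex assume z: "z \<in> sphere 0 1"
    hence z0: "z \<noteq> 0" and z1: "cmod z = 1" by auto
    show "continuous (at z within sphere 0 1) F"
    proof (cases "z \<in> \<real>\<^sub>\<ge>\<^sub>0")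
      case True
      hence "z \<notin> \<real>\<^sub>\<le>\<^sub>0" using z0
        by (auto simp: complex_nonneg_Reals_iff complex_nonpos_Reals_iff complex_eq_iff)
      hence "continuous (at z) Arg" by (rule continuous_at_Arg)
      hence "continuous (at z) (\<lambda>w. d (Arg w / (2 * pi)))"
        by (intro isCont_o2[OF _ contd] continuous_intros) auto
      thus ?thesis unfolding F_def by (rule continuous_at_imp_continuous_at_within)
    next
      case False
      hence "continuous (at z) Arg2pi" by (rule continuous_at_Arg2pi)
      hence "continuous (at z) (\<lambda>w. d (Arg2pi w / (2 * pi)))"
        by (intro isCont_o2[OF _ contd] continuous_intros) auto
      hence "continuous (at z within sphere 0 1) (\<lambda>w. d (Arg2pi w / (2 * pi)))"
        by (rule continuous_at_imp_continuous_at_within)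
      thus ?thesis
        by (rule continuous_transform_within[OF _ zero_less_one z]) (simp add: F2)
    qed
  qed
  have contd': "continuous_on A d" for A using cont continuous_on_subset by blast
  obtain M where M: "M > 0" "\<And>x. x \<in> {0..1} \<Longrightarrow> \<bar>d x\<bar> \<le> M"
  proof -
    have "bounded (d ` {0..1})"
      by (intro compact_imp_bounded compact_continuous_image contd') auto
    then obtain M where "M > 0" "\<forall>y\<in>d ` {0..1}. norm y \<le> M"
      using bounded_pos by blast
    thus ?thesis using that by auto
  qed
  have small: "integral {0..1} (\<lambda>x. (d x)\<^sup>2) \<le> M * \<epsilon>" if eps: "\<epsilon> > 0" for \<epsilon>
  proof -
    obtain g where g: "real_polynomial_function g" "\<And>z. z \<in> sphere 0 1 \<Longrightarrow> \<bar>F z - g z\<bar> < \<epsilon>"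
      using Stone_Weierstrass_real_polynomial_function[OF compact_sphere contF eps] by metis
    have contg: "continuous_on A (\<lambda>x. g (?z x))" for A
      by (intro continuous_on_compose2[OF continuous_on_polymonial_function[of g UNIV]] continuous_intros)
         (use g(1) in \<open>auto simp: real_polynomial_function_eq\<close>)
    have "fourier_coeff (\<lambda>x. d x * g (?z x)) 0 = 0"
      using poly[OF g(1) cont] zero by simp
    moreover have "continuous_on UNIV (\<lambda>x. d x * g (?z x))" by (intro continuous_intros contd' contg)
    ultimately have "integral {0..1} (\<lambda>x. complex_of_real (d x * g (?z x))) = 0"
      by (simp add: fourier_coeff_eq_pull pull_coeff_def)
    hence "complex_of_real (integral {0..1} (\<lambda>x. d x * g (?z x))) = 0"
      by (subst integral_linear[unfolded o_def, OF _ bounded_linear_of_real, symmetric])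
         (auto intro!: integrable_continuous_real continuous_intros contd' contg)
    hence "integral {0..1} (\<lambda>x. (d x)\<^sup>2) = integral {0..1} (\<lambda>x. (d x)\<^sup>2) - integral {0..1} (\<lambda>x. d x * g (?z x))"
      by simp
    also have "\<dots> = integral {0..1} (\<lambda>x. (d x)\<^sup>2 - d x * g (?z x))"
      by (rule integral_diff[symmetric]) (intro integrable_continuous_real continuous_intros contd' contg)+
    also have "\<dots> \<le> integral {0..1::real} (\<lambda>x. M * \<epsilon>)"
    proof (rule integral_le)
      fix x :: real assume x: "x \<in> {0..1}"
      have "(d x)\<^sup>2 - d x * g (?z x) = d x * (F (?z x) - g (?z x))"
        by (simp only: F_cis) (simp add: power2_eq_square algebra_simps)
      also have "\<dots> \<le> \<bar>d x\<bar> * \<bar>F (?z x) - g (?z x)\<bar>" by (simp add: abs_mult[symmetric])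
      also have "\<dots> \<le> M * \<epsilon>"
        by (rule mult_mono) (use M x g(2)[of "?z x"] in \<open>auto simp del: F_cis\<close>)
      finally show "(d x)\<^sup>2 - d x * g (?z x) \<le> M * \<epsilon>" .
    qed (intro integrable_continuous_real continuous_intros contd' contg)+
    finally show ?thesis by simp
  qed
  have "integral {0..1} (\<lambda>x. (d x)\<^sup>2) \<le> 0"
  proof (rule field_le_epsilon)
    fix e :: real assume "e > 0"
    thus "integral {0..1} (\<lambda>x. (d x)\<^sup>2) \<le> 0 + e" using small[of "e / M"] M by simp
  qed
  moreover have "integral {0..1} (\<lambda>x. (d x)\<^sup>2) \<ge> 0"
    by (intro integral_nonneg integrable_continuous_real continuous_intros contd') auto
  ultimately have "integral {0..1} (\<lambda>x. (d x)\<^sup>2) = 0" by simp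
  hence "\<forall>x\<in>{0..1}. (d x)\<^sup>2 = 0"
    by (subst (asm) integral_eq_0_iff) (auto intro!: continuous_intros contd')
  thus ?thesis
    using frac_in_unit[of x] periodic_frac[of d, OF per, of x] by auto
qed

section \<open>Continuous Sobolev functions and their Fourier series\<close>

lemma norm_cis_diff_le: "cmod (cis a - cis b) \<le> \<bar>a - b\<bar>"
proof -
  have "cis a - cis b = cis b * (cis (a - b) - 1)"
    by (simp add: algebra_simps cis_mult)
  hence "cmod (cis a - cis b) = cmod (exp (\<i> * of_real (a - b)) - 1)"
    by (simp add: norm_mult cis_conv_exp)
  also have "\<dots> = 2 * \<bar>sin ((a - b) / 2)\<bar>" by (rule dist_exp_i_1)
  also have "\<dots> \<le> 2 * \<bar>(a - b) / 2\<bar>"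
    by (intro mult_left_mono abs_sin_x_le_abs_x) auto
  finally show ?thesis by simp
qed

lemma uniform_limit_cis:
  assumes "uniform_limit A f l F"
  shows "uniform_limit A (\<lambda>n x. cis (f n x)) (\<lambda>x. cis (l x)) F"
proof (rule uniform_limitI)
  fix e :: real assume "e > 0"
  from uniform_limitD[OF assms this]
  show "\<forall>\<^sub>F n in F. \<forall>x\<in>A. dist (cis (f n x)) (cis (l x)) < e"
    by eventually_elim (auto simp: dist_norm intro: le_less_trans[OF norm_cis_diff_le])
qed

text \<open>
  The coefficients pass to the limit along uniformly convergent data. All estimates are proved for
  trigonometric polynomials and transferred by this lemma, one coefficient at a time.
\<close>

lemma pull_coeff_limit:
  fixes Gn :: "nat \<Rightarrow> real \<Rightarrow> real"
  assumes "uniform_limit {0..1} Gn G sequentially" "uniform_limit {0..1} Jn J sequentially"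
    and "uniform_limit {0..1} \<phi>n \<phi> sequentially"
    and "\<And>n. continuous_on {0..1} (Gn n)" "\<And>n. continuous_on {0..1} (Jn n)" "\<And>n. continuous_on {0..1} (\<phi>n n)"
  shows "(\<lambda>n. pull_coeff (\<phi>n n) (Jn n) (Gn n) k) \<longlonglongrightarrow> pull_coeff \<phi> J G k"
proof -
  have c: "continuous_on {0..1} G" "continuous_on {0..1} J" "continuous_on {0..1} \<phi>"
    by (rule uniform_limit_theorem[OF always_eventually assms(1)], use assms in auto)
       (rule uniform_limit_theorem[OF always_eventually assms(2)], use assms in auto,
        rule uniform_limit_theorem[OF always_eventually assms(3)], use assms in auto)
  have b: "bounded (f ` {0..1})" if "continuous_on {0..1} f" for f :: "real \<Rightarrow> 'b::real_normed_vector"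
    by (intro compact_imp_bounded compact_continuous_image that) auto
  have u1: "uniform_limit {0..1} (\<lambda>n x. Gn n x * Jn n x) (\<lambda>x. G x * J x) sequentially"
    by (intro uniform_lim_mult assms b c)
  have u2: "uniform_limit {0..1} (\<lambda>n x. complex_of_real (Gn n x * Jn n x)) (\<lambda>x. complex_of_real (G x * J x)) sequentially"
    by (rule bounded_linear_uniform_limit_intros(9)[OF u1] | rule bounded_linear.uniform_limit[OF bounded_linear_of_real u1])
  have u30: "uniform_limit {0..1} (\<lambda>n x. (- (freq k)) * \<phi>n n x) (\<lambda>x. (- (freq k)) * \<phi> x) sequentially"
    by (rule bounded_linear.uniform_limit[OF bounded_linear_mult_right assms(3)])
  have u3: "uniform_limit {0..1} (\<lambda>n x. cis (- (freq k * \<phi>n n x))) (\<lambda>x. cis (- (freq k * \<phi> x))) sequentially"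
    using uniform_limit_cis[OF u30] by simp
  have u4: "uniform_limit {0..1} (\<lambda>n x. complex_of_real (Gn n x * Jn n x) * cis (- (freq k * \<phi>n n x)))
      (\<lambda>x. complex_of_real (G x * J x) * cis (- (freq k * \<phi> x))) sequentially"
    by (intro uniform_lim_mult u2 u3 b continuous_intros c)
  obtain I L where "\<And>n. ((\<lambda>x. complex_of_real (Gn n x * Jn n x) * cis (- (freq k * \<phi>n n x))) has_integral I n) {0..1}"
     "((\<lambda>x. complex_of_real (G x * J x) * cis (- (freq k * \<phi> x))) has_integral L) {0..1}" "I \<longlonglongrightarrow> L"
    by (rule uniform_limit_integral[OF u4]) (intro continuous_intros assms, auto)
  thus ?thesis unfolding pull_coeff_def by (metis (mono_tags, lifting) integral_unique tendsto_cong always_eventually)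
qed

definition freq_weight :: "int \<Rightarrow> real" where
  "freq_weight k = 1 + (freq k)\<^sup>2"

lemma freq_weight_ge_1: "freq_weight k \<ge> 1"
  by (simp add: freq_weight_def)

lemma freq_weight_pos: "freq_weight k > 0"
  using freq_weight_ge_1[of k] by linarith

lemma summable_inverse_freq_weight: "(\<lambda>k. inverse (freq_weight k)) summable_on UNIV"
proof -
  have "summable (\<lambda>n. inverse (freq_weight (int n)))"
  proof (rule summable_comparison_test')
    show "summable (\<lambda>n. inverse ((real n)\<^sup>2))" using inverse_power_summable[of 2] by simp
    fix n :: nat assume "n \<ge> 1"
    have "(1 * real n)\<^sup>2 \<le> (2 * pi * real n)\<^sup>2"
      using pi_gt3 by (intro power_mono mult_right_mono) auto
    hence "(real n)\<^sup>2 \<le> freq_weight (int n)"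
      by (simp add: freq_weight_def add_increasing)
    thus "norm (inverse (freq_weight (int n))) \<le> inverse ((real n)\<^sup>2)"
      using \<open>n \<ge> 1\<close> freq_weight_pos[of "int n"] by (auto intro!: le_imp_inverse_le)
  qed
  hence "(\<lambda>n. inverse (freq_weight (int n))) summable_on UNIV"
    by (subst summable_on_UNIV_nonneg_real_iff) (auto simp: less_imp_le[OF freq_weight_pos])
  hence 1: "(\<lambda>k. inverse (freq_weight k)) summable_on range int"
    by (subst summable_on_reindex) (auto simp: o_def)
  have "(\<lambda>k. inverse (freq_weight k)) summable_on range (\<lambda>n. - int n)"
    using \<open>(\<lambda>n. inverse (freq_weight (int n))) summable_on UNIV\<close>
    by (subst summable_on_reindex) (auto simp: o_def inj_on_def freq_weight_def)
  from summable_on_union[OF 1 this] have "(\<lambda>k. inverse (freq_weight k)) summable_on (range int \<union> range (\<lambda>n. - int n))" .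
  also have "range int \<union> range (\<lambda>n. - int n) = UNIV"
  proof (intro equalityI subset_UNIV subsetI)
    fix k :: int
    show "k \<in> range int \<union> range (\<lambda>n. - int n)" by (cases k rule: int_cases2) auto
  qed
  finally show ?thesis .
qed

text \<open>
  The constant of the embedding of \<open>H\<^sup>1\<close> into the bounded functions that Cauchy-Schwarz yields.
\<close>

definition sobolev_const :: real where
  "sobolev_const = sqrt (\<Sum>\<^sub>\<infinity>k. inverse (freq_weight k))"

lemma sobolev_const_nonneg: "sobolev_const \<ge> 0"
  unfolding sobolev_const_def
  by (intro real_sqrt_ge_zero infsum_nonneg) (simp add: less_imp_le[OF freq_weight_pos])

text \<open>
  Elements of \<open>sobolev r\<close> are functions defined pointwise, and a null set can be changed freely;
  pointwise statements hold for the continuous representatives collected here.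
\<close>

definition csobolev :: "real \<Rightarrow> (real \<Rightarrow> real) set" where
  "csobolev r = {f \<in> sobolev r. continuous_on UNIV f}"

lemma sobolev_term_eq: "sobolev_term r f k = freq_weight k powr r * (cmod (fourier_coeff f k))\<^sup>2"
  by (simp add: sobolev_term_def freq_weight_def)

lemma sobolev_term_nonneg: "sobolev_term r f k \<ge> 0"
  by (simp add: sobolev_term_def)

lemma csobolev_iff:
  "f \<in> csobolev r \<longleftrightarrow> continuous_on UNIV f \<and> (\<forall>x. f (x + 1) = f x) \<and> sobolev_term r f summable_on UNIV"
proof -
  have "set_integrable lborel {0..1} (\<lambda>x. (f x)\<^sup>2)" if "continuous_on UNIV f"
    by (intro borel_integrable_atLeastAtMost' continuous_intros continuous_on_subset[OF that]) auto
  thus ?thesis unfolding csobolev_def sobolev_def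
    by (auto intro: borel_measurable_continuous_onI)
qed

lemma csobolev_continuous: "f \<in> csobolev r \<Longrightarrow> continuous_on A f"
  unfolding csobolev_iff by (metis continuous_on_subset subset_UNIV)

lemma csobolev_periodic: "f \<in> csobolev r \<Longrightarrow> f (x + 1) = f x"
  unfolding csobolev_iff by metis

lemma summable_on_of_bounded_sums:
  fixes g :: "'a \<Rightarrow> real"
  assumes "\<And>k. g k \<ge> 0" "\<And>K. finite K \<Longrightarrow> sum g K \<le> B"
  shows "g summable_on UNIV" "infsum g UNIV \<le> B"
proof -
  show "g summable_on UNIV"
    by (rule nonneg_bounded_partial_sums_imp_summable_on[where C = B])
       (use assms in \<open>auto simp: eventually_finite_subsets_at_top intro!: exI[of _ "{}"]\<close>)
  thus "infsum g UNIV \<le> B" by (rule infsum_le_finite_sums) (use assms in auto)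
qed

lemma sobolev_norm_nonneg: "sobolev_norm r f \<ge> 0"
  unfolding sobolev_norm_def by (intro real_sqrt_ge_zero infsum_nonneg sobolev_term_nonneg)

lemma sobolev_norm_sq: "(sobolev_norm r f)\<^sup>2 = (\<Sum>\<^sub>\<infinity>k. sobolev_term r f k)"
  unfolding sobolev_norm_def by (simp add: infsum_nonneg sobolev_term_nonneg)

lemma sobolev_sum_le_norm:
  assumes "f \<in> csobolev r" "finite K"
  shows "(\<Sum>k\<in>K. sobolev_term r f k) \<le> (sobolev_norm r f)\<^sup>2"
  unfolding sobolev_norm_sq
  using assms by (intro finite_sum_le_infsum) (auto simp: csobolev_iff sobolev_term_nonneg)

lemma csobolevI:
  assumes "continuous_on UNIV f" "\<And>x. f (x + 1) = f x"
    "\<And>K. finite K \<Longrightarrow> (\<Sum>k\<in>K. sobolev_term r f k) \<le> B"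
  shows "f \<in> csobolev r" "(sobolev_norm r f)\<^sup>2 \<le> B"
  using summable_on_of_bounded_sums[of "sobolev_term r f" B] assms
  by (auto simp: csobolev_iff sobolev_norm_sq sobolev_term_nonneg)

lemma csobolev_mono:
  assumes "f \<in> csobolev r" "r' \<le> r"
  shows "f \<in> csobolev r'" "sobolev_norm r' f \<le> sobolev_norm r f"
proof -
  have "(\<Sum>k\<in>K. sobolev_term r' f k) \<le> (sobolev_norm r f)\<^sup>2" if "finite K" for K
    by (rule order.trans[OF sum_mono sobolev_sum_le_norm[OF assms(1) that]])
       (use assms(2) in \<open>auto simp: sobolev_term_eq freq_weight_ge_1 intro!: mult_right_mono powr_mono\<close>)
  note * = csobolevI[OF _ _ this, simplified]
  show "f \<in> csobolev r'" using *(1) assms(1) by (auto simp: csobolev_iff)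
  show "sobolev_norm r' f \<le> sobolev_norm r f"
    using *(2) assms(1) by (auto simp: csobolev_iff sobolev_norm_nonneg abs_le_square_iff[symmetric])
qed

text \<open>
  Cauchy-Schwarz against the summable weight \<open>1 / (1 + (2 \<pi> k)\<^sup>2)\<close>. One order of smoothness in \<open>L\<^sup>2\<close> thus makes
  Fourier series converge absolutely; this is the source of all pointwise bounds.
\<close>

lemma sum_cmod_le_weighted:
  assumes K: "finite K" and B: "B \<ge> 0"
    and le: "(\<Sum>k\<in>K. freq_weight k * (cmod (c k))\<^sup>2) \<le> B\<^sup>2"
  shows "(\<Sum>k\<in>K. cmod (c k)) \<le> sobolev_const * B"
proof -
  have s: "(sqrt (freq_weight k))\<^sup>2 = freq_weight k" "sqrt (freq_weight k) \<noteq> 0" for k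
    using freq_weight_pos[of k] by (simp_all add: less_imp_le)
  have "(\<Sum>k\<in>K. cmod (c k))\<^sup>2 =
     (\<Sum>k\<in>K. inverse (sqrt (freq_weight k)) * (sqrt (freq_weight k) * cmod (c k)))\<^sup>2"
    using s(2) by (simp add: mult.assoc[symmetric])
  also have "\<dots> \<le> (\<Sum>k\<in>K. (inverse (sqrt (freq_weight k)))\<^sup>2) * (\<Sum>k\<in>K. (sqrt (freq_weight k) * cmod (c k))\<^sup>2)"
    by (rule Cauchy_Schwarz_ineq_sum)
  also have "\<dots> = (\<Sum>k\<in>K. inverse (freq_weight k)) * (\<Sum>k\<in>K. freq_weight k * (cmod (c k))\<^sup>2)"
    by (simp only: power_mult_distrib power_inverse s)
  also have "\<dots> \<le> sobolev_const\<^sup>2 * B\<^sup>2"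
  proof (intro mult_mono le)
    show "(\<Sum>k\<in>K. inverse (freq_weight k)) \<le> sobolev_const\<^sup>2"
      unfolding sobolev_const_def
      by (subst real_sqrt_pow2)
         (auto intro!: infsum_nonneg finite_sum_le_infsum summable_inverse_freq_weight K
            simp: less_imp_le[OF freq_weight_pos])
  qed (auto intro!: sum_nonneg simp: less_imp_le[OF freq_weight_pos])
  also have "\<dots> = (sobolev_const * B)\<^sup>2" by (simp add: power_mult_distrib)
  finally show ?thesis
    by (rule power2_le_imp_le) (simp add: sobolev_const_nonneg B)
qed

lemma sum_fourier_coeff_le:
  assumes f: "f \<in> csobolev r" "r \<ge> 1" and K: "finite K"
  shows "(\<Sum>k\<in>K. cmod (fourier_coeff f k)) \<le> sobolev_const * sobolev_norm r f"
proof (rule sum_cmod_le_weighted[OF K sobolev_norm_nonneg])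
  have "freq_weight k * (cmod (fourier_coeff f k))\<^sup>2 = sobolev_term 1 f k" for k
    using freq_weight_pos[of k] by (simp add: sobolev_term_eq)
  hence "(\<Sum>k\<in>K. freq_weight k * (cmod (fourier_coeff f k))\<^sup>2) \<le> (sobolev_norm 1 f)\<^sup>2"
    using sobolev_sum_le_norm[OF csobolev_mono(1)[OF f] K] by simp
  also have "\<dots> \<le> (sobolev_norm r f)\<^sup>2"
    by (intro power_mono csobolev_mono(2)[OF f] sobolev_norm_nonneg)
  finally show "(\<Sum>k\<in>K. freq_weight k * (cmod (fourier_coeff f k))\<^sup>2) \<le> (sobolev_norm r f)\<^sup>2" .
qed

text \<open>
  Real parts are taken term by term, so that a partial sum is real for arbitrary coefficients.
\<close>

definition trig_sum :: "int set \<Rightarrow> (int \<Rightarrow> complex) \<Rightarrow> real \<Rightarrow> real" where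
  "trig_sum K c x = (\<Sum>k\<in>K. Re (c k * cis (freq k * x)))"

definition trig_series :: "(int \<Rightarrow> complex) \<Rightarrow> real \<Rightarrow> real" where
  "trig_series c x = (\<Sum>\<^sub>\<infinity>k. Re (c k * cis (freq k * x)))"

lemma trig_sum_continuous: "continuous_on A (trig_sum K c)"
  unfolding trig_sum_def by (intro continuous_intros)

lemma trig_sum_periodic: "trig_sum K c (x + 1) = trig_sum K c x"
  unfolding trig_sum_def cis_2pi_periodic ..

lemma trig_sum_derivative:
  "(trig_sum K c has_real_derivative trig_sum K (\<lambda>k. complex_of_real (freq k) * \<i> * c k) x) (at x within A)"
proof -
  have *: "((\<lambda>x. Re (c k * cis (freq k * x))) has_real_derivative
     Re (complex_of_real (freq k) * \<i> * c k * cis (freq k * x))) (at x within A)" for k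
  proof -
    have "((\<lambda>x. c k * cis (freq k * x)) has_vector_derivative
       c k * (complex_of_real (freq k) * \<i> * cis (freq k * x))) (at x within A)"
      using circle_map_cis_derivative[OF circle_map_id, of k x A]
      by (intro has_vector_derivative_mult_right) simp
    from bounded_linear.has_vector_derivative[OF bounded_linear_Re this] show ?thesis
      by (simp add: has_real_derivative_iff_has_vector_derivative mult_ac)
  qed
  show ?thesis unfolding trig_sum_def by (intro DERIV_sum *)
qed

lemma trig_series_uniform_limit:
  assumes "(\<lambda>k. cmod (c k)) summable_on UNIV"
  shows "uniform_limit A (\<lambda>N. trig_sum {- int N..int N} c) (trig_series c) sequentially"
proof -
  have "uniform_limit A (\<lambda>K x. \<Sum>k\<in>K. Re (c k * cis (freq k * x)))
     (\<lambda>x. \<Sum>\<^sub>\<infinity>k\<in>UNIV. Re (c k * cis (freq k * x))) (finite_subsets_at_top UNIV)"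
  proof (rule Weierstrass_m_test_general[OF _ assms])
    fix k x
    show "norm (Re (c k * cis (freq k * x))) \<le> cmod (c k)"
      using abs_Re_le_cmod[of "c k * cis (freq k * x)"] by (simp add: norm_mult)
  qed
  moreover have "filterlim (\<lambda>N. {- int N..int N}) (finite_subsets_at_top UNIV) sequentially"
    unfolding filterlim_finite_subsets_at_top
  proof safe
    fix X :: "int set" assume X: "finite X"
    show "\<forall>\<^sub>F N in sequentially. finite {- int N..int N} \<and> X \<subseteq> {- int N..int N} \<and> {- int N..int N} \<subseteq> UNIV"
      unfolding eventually_sequentially
    proof (intro exI[of _ "nat (Max (insert 0 (abs ` X)))"] allI impI conjI subsetI)
      fix N x assume N: "nat (Max (insert 0 (abs ` X))) \<le> N" and x: "x \<in> X"
      have "\<bar>x\<bar> \<le> Max (insert 0 (abs ` X))" using X x by (intro Max_ge) auto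
      thus "x \<in> {- int N..int N}" using N by auto
    qed auto
  qed
  ultimately show ?thesis
    unfolding trig_sum_def trig_series_def by (rule filterlim_compose)
qed

lemma trig_series_continuous:
  assumes "(\<lambda>k. cmod (c k)) summable_on UNIV"
  shows "continuous_on A (trig_series c)"
  by (rule uniform_limit_theorem[OF always_eventually trig_series_uniform_limit[OF assms]])
     (auto simp: trig_sum_continuous)

lemma trig_series_periodic: "trig_series c (x + 1) = trig_series c x"
  unfolding trig_series_def cis_2pi_periodic ..

lemma trig_series_derivative:
  assumes 1: "(\<lambda>k. cmod (c k)) summable_on UNIV"
    and 2: "(\<lambda>k. cmod (complex_of_real (freq k) * \<i> * c k)) summable_on UNIV"
  shows "(trig_series c has_real_derivative
           trig_series (\<lambda>k. complex_of_real (freq k) * \<i> * c k) x) (at x)"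
proof -
  let ?d = "\<lambda>k. complex_of_real (freq k) * \<i> * c k"
  let ?K = "\<lambda>N. {- int N..int N}"
  have lim: "(\<lambda>N. trig_sum (?K N) c y) \<longlonglongrightarrow> trig_series c y" for y
    using tendsto_uniform_limitI[OF trig_series_uniform_limit[OF 1, of UNIV]] by simp
  have "\<exists>g. \<forall>x\<in>UNIV. (\<lambda>N. trig_sum (?K N) c x) \<longlonglongrightarrow> g x \<and>
     (g has_derivative (\<lambda>h. trig_series ?d x * h)) (at x within UNIV)"
  proof (rule has_derivative_sequence[where f' = "\<lambda>N x h. trig_sum (?K N) ?d x * h"])
    fix e :: real assume "e > 0"
    from uniform_limitD[OF trig_series_uniform_limit[OF 2, of UNIV] this]
    show "\<forall>\<^sub>F n in sequentially. \<forall>x\<in>UNIV. \<forall>h. norm (trig_sum (?K n) ?d x * h - trig_series ?d x * h) \<le> e * norm h"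
    proof eventually_elim
      case (elim n)
      show ?case
      proof (intro ballI allI)
        fix x h :: real
        have "norm (trig_sum (?K n) ?d x * h - trig_series ?d x * h) = \<bar>trig_sum (?K n) ?d x - trig_series ?d x\<bar> * \<bar>h\<bar>"
          by (simp add: abs_mult[symmetric] algebra_simps)
        also have "\<dots> \<le> e * \<bar>h\<bar>"
          using bspec[OF elim, of x] by (intro mult_right_mono) (auto simp: dist_real_def)
        finally show "norm (trig_sum (?K n) ?d x * h - trig_series ?d x * h) \<le> e * norm h" by simp
      qed
    qed
  next
    show "(\<lambda>N. trig_sum (?K N) c 0) \<longlonglongrightarrow> trig_series c 0" by (rule lim)
  qed (use trig_sum_derivative[of _ c] in \<open>auto simp: has_field_derivative_def\<close>)
  then obtain g where g: "\<And>x. (\<lambda>N. trig_sum (?K N) c x) \<longlonglongrightarrow> g x"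
     "\<And>x. (g has_derivative (\<lambda>h. trig_series ?d x * h)) (at x)" by auto
  have "g = trig_series c" using LIMSEQ_unique[OF g(1) lim] by auto
  thus ?thesis using g(2) by (simp add: has_field_derivative_def)
qed

lemma fourier_coeff_diff:
  assumes "continuous_on UNIV f" "continuous_on UNIV g"
  shows "fourier_coeff (\<lambda>x. f x - g x) k = fourier_coeff f k - fourier_coeff g k"
  using fourier_coeff_add[OF assms(1) continuous_on_mult_left[OF assms(2), of "-1"], of k]
    fourier_coeff_cmult[OF assms(2), of "-1" k] by simp

lemma csobolev_add:
  assumes f: "f \<in> csobolev r" and g: "g \<in> csobolev r"
  shows "(\<lambda>x. f x + g x) \<in> csobolev r"
    "(sobolev_norm r (\<lambda>x. f x + g x))\<^sup>2 \<le> 2 * (sobolev_norm r f)\<^sup>2 + 2 * (sobolev_norm r g)\<^sup>2"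
proof -
  note c = csobolev_continuous[OF f] csobolev_continuous[OF g]
  have "sobolev_term r (\<lambda>x. f x + g x) k \<le> 2 * sobolev_term r f k + 2 * sobolev_term r g k" for k
  proof -
    have "freq_weight k powr r * (cmod (fourier_coeff f k + fourier_coeff g k))\<^sup>2 \<le>
       freq_weight k powr r * (2 * (cmod (fourier_coeff f k))\<^sup>2 + 2 * (cmod (fourier_coeff g k))\<^sup>2)"
      by (intro mult_left_mono norm_add_power2_le) auto
    thus ?thesis by (simp add: sobolev_term_eq fourier_coeff_add[OF c] algebra_simps)
  qed
  note * = this
  have "(\<Sum>k\<in>K. sobolev_term r (\<lambda>x. f x + g x) k) \<le> 2 * (sobolev_norm r f)\<^sup>2 + 2 * (sobolev_norm r g)\<^sup>2"
    if "finite K" for K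
  proof -
    have "(\<Sum>k\<in>K. sobolev_term r (\<lambda>x. f x + g x) k) \<le> (\<Sum>k\<in>K. 2 * sobolev_term r f k + 2 * sobolev_term r g k)"
      by (rule sum_mono) (rule *)
    also have "\<dots> = 2 * (\<Sum>k\<in>K. sobolev_term r f k) + 2 * (\<Sum>k\<in>K. sobolev_term r g k)"
      by (simp add: sum.distrib sum_distrib_left)
    also have "\<dots> \<le> 2 * (sobolev_norm r f)\<^sup>2 + 2 * (sobolev_norm r g)\<^sup>2"
      using sobolev_sum_le_norm[OF f that] sobolev_sum_le_norm[OF g that] by simp
    finally show ?thesis .
  qed
  from csobolevI[OF _ _ this]
  show "(\<lambda>x. f x + g x) \<in> csobolev r"
    "(sobolev_norm r (\<lambda>x. f x + g x))\<^sup>2 \<le> 2 * (sobolev_norm r f)\<^sup>2 + 2 * (sobolev_norm r g)\<^sup>2"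
    by (auto intro!: continuous_on_add c simp: csobolev_periodic[OF f] csobolev_periodic[OF g])
qed

lemma csobolev_cmult:
  assumes f: "f \<in> csobolev r"
  shows "(\<lambda>x. c * f x) \<in> csobolev r"
    "(sobolev_norm r (\<lambda>x. c * f x))\<^sup>2 \<le> c\<^sup>2 * (sobolev_norm r f)\<^sup>2"
proof -
  note cf = csobolev_continuous[OF f]
  have "sobolev_term r (\<lambda>x. c * f x) k = c\<^sup>2 * sobolev_term r f k" for k
    by (simp add: sobolev_term_eq fourier_coeff_cmult[OF cf] norm_mult power_mult_distrib)
  hence "(\<Sum>k\<in>K. sobolev_term r (\<lambda>x. c * f x) k) \<le> c\<^sup>2 * (sobolev_norm r f)\<^sup>2" if "finite K" for K
    using sobolev_sum_le_norm[OF f that] by (simp add: sum_distrib_left[symmetric] mult_left_mono)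
  from csobolevI[OF _ _ this]
  show "(\<lambda>x. c * f x) \<in> csobolev r" "(sobolev_norm r (\<lambda>x. c * f x))\<^sup>2 \<le> c\<^sup>2 * (sobolev_norm r f)\<^sup>2"
    by (auto intro!: continuous_on_mult_left cf simp: csobolev_periodic[OF f])
qed

lemma csobolev_diff:
  assumes f: "f \<in> csobolev r" and g: "g \<in> csobolev r"
  shows "(\<lambda>x. f x - g x) \<in> csobolev r"
  using csobolev_add(1)[OF f csobolev_cmult(1)[OF g, of "-1"]] by simp

lemma fourier_coeff_const: "fourier_coeff (\<lambda>x. c) k = (if k = 0 then of_real c else 0)"
  using circle_map_orthogonality[OF circle_map_id, of "-k"]
  by (simp add: fourier_coeff_eq_pull pull_coeff_def)

lemma csobolev_const:
  shows "(\<lambda>x. c) \<in> csobolev r" "(sobolev_norm r (\<lambda>x. c))\<^sup>2 \<le> c\<^sup>2"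
proof -
  have "(\<Sum>k\<in>K. sobolev_term r (\<lambda>x. c) k) \<le> c\<^sup>2" if "finite K" for K
  proof -
    have "(\<Sum>k\<in>K. sobolev_term r (\<lambda>x. c) k) = (\<Sum>k\<in>K. if k = 0 then c\<^sup>2 else 0)"
      by (intro sum.cong refl) (simp add: sobolev_term_def fourier_coeff_const)
    also have "\<dots> \<le> c\<^sup>2" using that by simp
    finally show ?thesis .
  qed
  from csobolevI[OF _ _ this]
  show "(\<lambda>x. c) \<in> csobolev r" "(sobolev_norm r (\<lambda>x. c))\<^sup>2 \<le> c\<^sup>2" by auto
qed

lemma fourier_coeff_cnj:
  assumes "continuous_on UNIV f"
  shows "fourier_coeff f (- k) = cnj (fourier_coeff f k)"
  unfolding fourier_coeff_eq_pull[OF assms] pull_coeff_def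
  by (subst integral_linear[unfolded o_def, OF _ bounded_linear_cnj, symmetric])
     (auto simp: cis_cnj intro!: integrable_continuous_real continuous_intros continuous_on_subset[OF assms])

lemma fourier_coeff_trig_sum_mult:
  assumes f: "continuous_on UNIV f" and L: "finite L"
  shows "fourier_coeff (\<lambda>x. trig_sum L c x * f x) k
    = (\<Sum>l\<in>L. (c l * fourier_coeff f (k - l) + cnj (c l) * fourier_coeff f (k + l)) / 2)"
  using L
proof (induction L rule: finite_induct)
  case empty
  thus ?case by (simp add: trig_sum_def fourier_coeff_def)
next
  case (insert l L)
  have e: "(\<lambda>x. trig_sum (insert l L) c x * f x) =
      (\<lambda>x. Re (c l * cis (freq l * x)) * f x + trig_sum L c x * f x)"
    using insert by (auto simp: trig_sum_def distrib_right)
  have 1: "continuous_on UNIV (\<lambda>x. Re (c l * cis (freq l * x)) * f x)" by (intro continuous_intros f)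
  have 2: "continuous_on UNIV (\<lambda>x. trig_sum L c x * f x)" by (intro continuous_intros f trig_sum_continuous)
  show ?case unfolding e fourier_coeff_add[OF 1 2] insert.IH fourier_coeff_Re_cis_mult[OF f]
    using insert.hyps by simp
qed

lemma fourier_coeff_trig_sum:
  assumes "finite K"
  shows "fourier_coeff (trig_sum K c) k = ((if k \<in> K then c k else 0) + (if - k \<in> K then cnj (c (- k)) else 0)) / 2"
proof -
  have "fourier_coeff (trig_sum K c) k
      = (\<Sum>l\<in>K. (c l * (if k - l = 0 then 1 else 0) + cnj (c l) * (if k + l = 0 then 1 else 0)) / 2)"
    using fourier_coeff_trig_sum_mult[OF continuous_on_const assms, of c 1 k] by (simp add: fourier_coeff_const cong: if_cong)
  also have "\<dots> = (\<Sum>l\<in>K. (if l = k then c l else 0) + (if l = - k then cnj (c l) else 0)) / 2"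
    unfolding sum_divide_distrib by (intro sum.cong refl) auto
  also have "\<dots> = ((if k \<in> K then c k else 0) + (if - k \<in> K then cnj (c (- k)) else 0)) / 2"
    using assms by (simp add: sum.distrib)
  finally show ?thesis .
qed

lemma fourier_coeff_trig_series:
  assumes sm: "(\<lambda>k. cmod (c k)) summable_on UNIV" and herm: "\<And>k. c (- k) = cnj (c k)"
  shows "fourier_coeff (trig_series c) k = c k"
proof -
  have u: "uniform_limit {0..1} (\<lambda>N. trig_sum {- int N..int N} c) (trig_series c) sequentially"
    by (rule trig_series_uniform_limit[OF sm])
  have "(\<lambda>N. pull_coeff (\<lambda>x. x) (\<lambda>_. 1) (trig_sum {- int N..int N} c) k) \<longlonglongrightarrow> pull_coeff (\<lambda>x. x) (\<lambda>_. 1) (trig_series c) k"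
    by (rule pull_coeff_limit[OF u]) (auto intro: trig_sum_continuous uniform_limit_const continuous_intros)
  hence "(\<lambda>N. fourier_coeff (trig_sum {- int N..int N} c) k) \<longlonglongrightarrow> fourier_coeff (trig_series c) k"
    by (simp add: fourier_coeff_eq_pull trig_sum_continuous trig_series_continuous[OF sm])
  moreover have "(\<lambda>N. fourier_coeff (trig_sum {- int N..int N} c) k) \<longlonglongrightarrow> c k"
  proof (rule tendsto_eventually, rule eventually_sequentiallyI)
    fix N assume "N \<ge> nat \<bar>k\<bar>"
    thus "fourier_coeff (trig_sum {- int N..int N} c) k = c k"
      by (subst fourier_coeff_trig_sum) (auto simp: herm)
  qed
  ultimately show ?thesis by (rule LIMSEQ_unique)
qed

lemma summable_fourier_coeff:
  assumes "f \<in> csobolev r" "r \<ge> 1"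
  shows "(\<lambda>k. cmod (fourier_coeff f k)) summable_on UNIV"
  using sum_fourier_coeff_le[OF assms] by (intro summable_on_of_bounded_sums) auto

text \<open>
  The series converges uniformly to a continuous function with the same coefficients as \<open>f\<close>, so the
  two agree by uniqueness.
\<close>

lemma fourier_inversion:
  assumes f: "f \<in> csobolev r" "r \<ge> 1"
  shows "f = trig_series (fourier_coeff f)"
proof
  fix x
  let ?c = "fourier_coeff f"
  note sm = summable_fourier_coeff[OF f]
  have "f x - trig_series ?c x = 0"
  proof (rule fourier_unique[of "\<lambda>x. f x - trig_series ?c x"])
    show "continuous_on UNIV (\<lambda>x. f x - trig_series ?c x)"
      by (intro continuous_intros trig_series_continuous sm csobolev_continuous[OF f(1)])
    show "fourier_coeff (\<lambda>x. f x - trig_series ?c x) k = 0" for k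
      by (subst fourier_coeff_diff)
         (auto simp: fourier_coeff_trig_series[OF sm] fourier_coeff_cnj csobolev_continuous[OF f(1)] trig_series_continuous[OF sm])
  qed (simp add: csobolev_periodic[OF f(1)] trig_series_periodic)
  thus "f x = trig_series ?c x" by simp
qed

lemma fourier_partial_sums_uniform_limit:
  assumes f: "f \<in> csobolev r" "r \<ge> 1"
  shows "uniform_limit A (\<lambda>N. trig_sum {- int N..int N} (fourier_coeff f)) f sequentially"
  by (subst (2) fourier_inversion[OF f]) (rule trig_series_uniform_limit[OF summable_fourier_coeff[OF f]])

lemma csobolev_sup_bound:
  assumes f: "f \<in> csobolev r" "r \<ge> 1"
  shows "\<bar>f x\<bar> \<le> sobolev_const * sobolev_norm r f"
proof -
  let ?c = "fourier_coeff f"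
  have "(\<lambda>N. \<bar>trig_sum {- int N..int N} ?c x\<bar>) \<longlonglongrightarrow> \<bar>f x\<bar>"
    by (intro tendsto_rabs tendsto_uniform_limitI[OF fourier_partial_sums_uniform_limit[OF f, of UNIV]]) simp
  moreover have "\<bar>trig_sum {- int N..int N} ?c x\<bar> \<le> sobolev_const * sobolev_norm r f" for N
  proof -
    have "\<bar>trig_sum {- int N..int N} ?c x\<bar> \<le> (\<Sum>k\<in>{- int N..int N}. \<bar>Re (?c k * cis (freq k * x))\<bar>)"
      unfolding trig_sum_def by (rule sum_abs)
    also have "\<dots> \<le> (\<Sum>k\<in>{- int N..int N}. cmod (?c k))"
      by (intro sum_mono order.trans[OF abs_Re_le_cmod]) (simp add: norm_mult)
    also have "\<dots> \<le> sobolev_const * sobolev_norm r f" by (rule sum_fourier_coeff_le[OF f]) simp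
    finally show ?thesis .
  qed
  ultimately show ?thesis by (intro LIMSEQ_le_const2) auto
qed

text \<open>
  Multiplying the coefficients by \<open>2 \<pi> i k\<close> costs one order of smoothness. The differentiated series still
  converges uniformly when \<open>r \<ge> 2\<close>, so it is the classical derivative. Applied repeatedly, the lemma gives
  the embedding of \<open>H\<^sup>r\<close> into \<open>C\<^sup>j\<close> for \<open>r \<ge> j + 1\<close>.
\<close>

lemma csobolev_deriv:
  assumes f: "f \<in> csobolev r" "r \<ge> 2"
  shows csobolev_has_deriv: "(f has_real_derivative deriv f x) (at x)"
    and fourier_coeff_deriv: "fourier_coeff (deriv f) k = complex_of_real (freq k) * \<i> * fourier_coeff f k"
    and csobolev_deriv_mem: "deriv f \<in> csobolev (r - 1)"
    and csobolev_deriv_norm: "sobolev_norm (r - 1) (deriv f) \<le> sobolev_norm r f"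
proof -
  let ?c = "fourier_coeff f"
  let ?d = "\<lambda>k. complex_of_real (freq k) * \<i> * ?c k"
  have r1: "r \<ge> 1" using f by simp
  have trm: "freq_weight k powr (r - 1) * (cmod (?d k))\<^sup>2 \<le> sobolev_term r f k" for k
  proof -
    have "freq_weight k powr (r - 1) * (cmod (?d k))\<^sup>2 = freq_weight k powr (r - 1) * ((freq k)\<^sup>2 * (cmod (?c k))\<^sup>2)"
      by (simp add: norm_mult power_mult_distrib)
    also have "\<dots> \<le> freq_weight k powr (r - 1) * (freq_weight k * (cmod (?c k))\<^sup>2)"
      by (intro mult_left_mono mult_right_mono) (auto simp: freq_weight_def)
    also have "\<dots> = freq_weight k powr ((r - 1) + 1) * (cmod (?c k))\<^sup>2"
      using freq_weight_pos[of k] by (subst powr_add) simp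
    finally show ?thesis by (simp add: sobolev_term_eq)
  qed
  have sum: "(\<Sum>k\<in>K. freq_weight k powr (r - 1) * (cmod (?d k))\<^sup>2) \<le> (sobolev_norm r f)\<^sup>2" if "finite K" for K
    by (rule order.trans[OF sum_mono sobolev_sum_le_norm[OF f(1) that]]) (rule trm)
  have smd: "(\<lambda>k. cmod (?d k)) summable_on UNIV"
  proof (rule summable_on_of_bounded_sums)
    fix K :: "int set" assume K: "finite K"
    show "(\<Sum>k\<in>K. cmod (?d k)) \<le> sobolev_const * sobolev_norm r f"
    proof (rule sum_cmod_le_weighted[OF K sobolev_norm_nonneg order.trans[OF sum_mono sum[OF K]]])
      fix k
      have "freq_weight k powr 1 \<le> freq_weight k powr (r - 1)"
        using f freq_weight_ge_1[of k] by (intro powr_mono) auto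
      thus "freq_weight k * (cmod (?d k))\<^sup>2 \<le> freq_weight k powr (r - 1) * (cmod (?d k))\<^sup>2"
        using freq_weight_pos[of k] by (intro mult_right_mono) auto
    qed
  qed simp
  note sm = summable_fourier_coeff[OF f(1) r1]
  have "(f has_real_derivative trig_series ?d x) (at x)" for x
    using trig_series_derivative[OF sm smd] fourier_inversion[OF f(1) r1] by simp
  hence df: "deriv f = trig_series ?d" by (auto intro: DERIV_imp_deriv)
  thus D: "(f has_real_derivative deriv f x) (at x)" for x
    using trig_series_derivative[OF sm smd] fourier_inversion[OF f(1) r1] by simp
  have cont: "continuous_on UNIV (deriv f)" unfolding df by (rule trig_series_continuous[OF smd])
  show fc: "fourier_coeff (deriv f) k = ?d k" for k
    unfolding df
    by (rule fourier_coeff_trig_series[OF smd])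
       (simp add: fourier_coeff_cnj[OF csobolev_continuous[OF f(1)]])
  have "(\<Sum>k\<in>K. sobolev_term (r - 1) (deriv f) k) \<le> (sobolev_norm r f)\<^sup>2" if "finite K" for K
    unfolding sobolev_term_eq fc by (rule sum[OF that])
  note * = csobolevI[OF cont _ this]
  show "deriv f \<in> csobolev (r - 1)"
    by (rule *(1)) (auto simp: df trig_series_periodic)
  have "(sobolev_norm (r - 1) (deriv f))\<^sup>2 \<le> (sobolev_norm r f)\<^sup>2"
    by (rule *(2)) (auto simp: df trig_series_periodic)
  thus "sobolev_norm (r - 1) (deriv f) \<le> sobolev_norm r f"
    by (rule power2_le_imp_le) (rule sobolev_norm_nonneg)
qed

section \<open>Integer-order estimates for reparametrised functions\<close>

text \<open>
  Periodic functions of class \<open>C\<^sup>n\<close> whose derivatives up to order \<open>n\<close> have \<open>L\<^sup>2\<close> norm at most \<open>A\<close>. For integer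
  order this form, unlike the Fourier one, is adapted to products and compositions; the recursion turns
  the product rule and the chain rule into inductions.
\<close>

primrec sob_ball :: "nat \<Rightarrow> real \<Rightarrow> (real \<Rightarrow> real) \<Rightarrow> bool" where
  "sob_ball 0 A f \<longleftrightarrow> continuous_on UNIV f \<and> (\<forall>x. f (x + 1) = f x) \<and> integral {0..1} (\<lambda>x. (f x)\<^sup>2) \<le> A\<^sup>2"
| "sob_ball (Suc n) A f \<longleftrightarrow> (continuous_on UNIV f \<and> (\<forall>x. f (x + 1) = f x) \<and> integral {0..1} (\<lambda>x. (f x)\<^sup>2) \<le> A\<^sup>2) \<and>
     (\<exists>f'. (\<forall>x. (f has_real_derivative f' x) (at x)) \<and> sob_ball n A f')"

lemma sob_ball_Suc:
  "sob_ball (Suc n) A f \<longleftrightarrow> sob_ball 0 A f \<and> (\<exists>f'. (\<forall>x. (f has_real_derivative f' x) (at x)) \<and> sob_ball n A f')"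
  by simp

lemma sob_ball_zero: "sob_ball n A f \<Longrightarrow> sob_ball 0 A f"
  by (cases n) auto

lemma sob_ball_continuous: "sob_ball n A f \<Longrightarrow> continuous_on S f"
  using sob_ball_zero[of n A f] continuous_on_subset by fastforce

lemma sob_ball_periodic: "sob_ball n A f \<Longrightarrow> f (x + 1) = f x"
  using sob_ball_zero[of n A f] by simp

lemma sob_ball_integral: "sob_ball n A f \<Longrightarrow> integral {0..1} (\<lambda>x. (f x)\<^sup>2) \<le> A\<^sup>2"
  using sob_ball_zero[of n A f] by simp

lemma sob_ball_mono:
  assumes "sob_ball n A f" "0 \<le> A" "A \<le> B"
  shows "sob_ball n B f"
  using assms(1)
proof (induction n arbitrary: f)
  have AB: "A\<^sup>2 \<le> B\<^sup>2" using assms(2,3) by (intro power_mono)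
  {
    case 0
    thus ?case unfolding sob_ball.simps using AB by (meson order.trans)
  next
    case (Suc n)
    thus ?case unfolding sob_ball.simps using AB by (meson order.trans)
  }
qed

lemma sob_ball_Suc_imp: "sob_ball (Suc n) A f \<Longrightarrow> sob_ball n A f"
  by (induction n arbitrary: f) auto

lemma sob_ball_const: "sob_ball n \<bar>c\<bar> (\<lambda>x. c)"
proof -
  have 0: "sob_ball n \<bar>c\<bar> (\<lambda>x. 0)" for n
    by (induction n) (auto intro!: exI[of _ "\<lambda>x. 0"])
  show ?thesis using 0 by (cases n) (auto intro!: exI[of _ "\<lambda>x. 0"])
qed

lemma sob_ball_add:
  assumes "sob_ball n A f" "sob_ball n B g" and AB: "0 \<le> A" "0 \<le> B"
  shows "sob_ball n (2 * (A + B)) (\<lambda>x. f x + g x)"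
  using assms(1,2)
proof (induction n arbitrary: f g)
  case 0
  note c = sob_ball_continuous[OF 0(1)] sob_ball_continuous[OF 0(2)]
  have "integral {0..1} (\<lambda>x. (f x + g x)\<^sup>2) \<le> integral {0..1} (\<lambda>x. 2 * (f x)\<^sup>2 + 2 * (g x)\<^sup>2)"
  proof (rule integral_le)
    fix x show "(f x + g x)\<^sup>2 \<le> 2 * (f x)\<^sup>2 + 2 * (g x)\<^sup>2"
      using norm_add_power2_le[of "f x" "g x"] by simp
  qed (intro integrable_continuous_real continuous_intros c)+
  also have "\<dots> = 2 * integral {0..1} (\<lambda>x. (f x)\<^sup>2) + 2 * integral {0..1} (\<lambda>x. (g x)\<^sup>2)"
    by (subst integral_add) (auto intro!: integrable_continuous_real continuous_intros c)
  also have "\<dots> \<le> 2 * A\<^sup>2 + 2 * B\<^sup>2"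
    using sob_ball_integral[OF 0(1)] sob_ball_integral[OF 0(2)] by simp
  also have "\<dots> \<le> (2 * (A + B))\<^sup>2"
  proof -
    have "0 \<le> A * B" using AB by simp
    moreover have "0 \<le> A\<^sup>2" "0 \<le> B\<^sup>2" by auto
    ultimately show ?thesis unfolding power2_eq_square by (simp add: algebra_simps)
  qed
  finally show ?case using 0 by (auto intro!: continuous_intros)
next
  case (Suc n)
  then obtain f' g' where f': "\<And>x. (f has_real_derivative f' x) (at x)" "sob_ball n A f'"
    and g': "\<And>x. (g has_real_derivative g' x) (at x)" "sob_ball n B g'" by auto
  have "sob_ball 0 (2 * (A + B)) (\<lambda>x. f x + g x)"
    using Suc.IH[of f g] Suc.prems sob_ball_Suc_imp sob_ball_zero by blast
  moreover have "sob_ball n (2 * (A + B)) (\<lambda>x. f' x + g' x)" by (rule Suc.IH[OF f'(2) g'(2)])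
  ultimately show ?case using f' g' unfolding sob_ball_Suc
    by (intro conjI exI[of _ "\<lambda>x. f' x + g' x"]) (auto intro!: DERIV_add)
qed

lemma sob_ball_uminus: "sob_ball n A f \<Longrightarrow> sob_ball n A (\<lambda>x. - f x)"
proof (induction n arbitrary: f)
  case 0
  thus ?case by (auto intro!: continuous_intros)
next
  case (Suc n)
  then obtain f' where f': "\<And>x. (f has_real_derivative f' x) (at x)" "sob_ball n A f'" by auto
  show ?case using f' Suc.prems Suc.IH[OF f'(2)]
    by (auto intro!: continuous_intros exI[of _ "\<lambda>x. - f' x"] DERIV_minus)
qed

lemma periodic_bound_of_unit:
  fixes f :: "real \<Rightarrow> real"
  assumes "\<And>x. f (x + 1) = f x" "\<And>x. x \<in> {0..1} \<Longrightarrow> \<bar>f x\<bar> \<le> C"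
  shows "\<bar>f x\<bar> \<le> C"
  using assms(2)[OF frac_in_unit[of x]] periodic_frac[of f, OF assms(1), of x] by simp

text \<open>
  Some value of \<open>\<bar>f\<bar>\<close> is at most the \<open>L\<^sup>2\<close> norm of \<open>f\<close>, and \<open>f\<close> oscillates by at most the \<open>L\<^sup>1\<close> norm of \<open>f'\<close>.
\<close>

lemma sob_ball_sup:
  assumes "sob_ball (Suc n) A f" "0 \<le> A"
  shows "\<bar>f x\<bar> \<le> 2 * A"
proof -
  obtain f' where f': "\<And>x. (f has_real_derivative f' x) (at x)" "sob_ball 0 A f'"
    using assms(1) unfolding sob_ball_Suc using sob_ball_zero by blast
  note cf = sob_ball_continuous[OF assms(1)] and cf' = sob_ball_continuous[OF f'(2)]
  obtain y where y: "y \<in> {0..1}" "\<And>z. z \<in> {0..1} \<Longrightarrow> (f y)\<^sup>2 \<le> (f z)\<^sup>2"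
  proof -
    have "continuous_on {0..1} (\<lambda>z. (f z)\<^sup>2)" by (intro continuous_intros cf)
    from continuous_attains_inf[OF _ _ this] show ?thesis using that by auto
  qed
  have "integral {0..1::real} (\<lambda>z. (f y)\<^sup>2) \<le> integral {0..1} (\<lambda>z. (f z)\<^sup>2)"
    by (rule integral_le) (auto intro!: integrable_continuous_real continuous_intros cf y(2))
  hence fy: "\<bar>f y\<bar> \<le> A"
    using sob_ball_integral[OF assms(1)] assms(2) abs_le_square_iff[of "f y" A] by simp
  have var: "\<bar>f b - f a\<bar> \<le> A" if ab: "a \<in> {0..1}" "b \<in> {0..1}" "a \<le> b" for a b
  proof (rule field_le_epsilon)
    fix e :: real assume "e > 0"
    \<comment> \<open>a positive weight for \<open>\<bar>f'\<bar> \<le> (A' + f'\<^sup>2 / A') / 2\<close>, whose integral is at most \<open>A'\<close>\<close>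
    define A' where "A' = A + e"
    have A': "A' > 0" "A \<le> A'" using \<open>e > 0\<close> assms(2) by (auto simp: A'_def)
    have "(f' has_integral (f b - f a)) {a..b}"
      by (rule fundamental_theorem_real[OF ab(3) f'(1)])
    hence "\<bar>f b - f a\<bar> = \<bar>integral {a..b} f'\<bar>" by (simp add: integral_unique)
    also have "\<dots> \<le> integral {a..b} (\<lambda>z. (A' + (f' z)\<^sup>2 / A') / 2)"
      unfolding real_norm_def[symmetric]
    proof (rule integral_norm_bound_integral)
      fix z
      have "0 \<le> (\<bar>f' z\<bar> - A')\<^sup>2" by simp
      hence "2 * \<bar>f' z\<bar> * A' \<le> A' * A' + (f' z)\<^sup>2" by (simp add: power2_eq_square algebra_simps)
      thus "norm (f' z) \<le> (A' + (f' z)\<^sup>2 / A') / 2" using A' by (simp add: field_simps)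
    qed (use A' in \<open>auto intro!: integrable_continuous_real continuous_intros cf'\<close>)
    also have "\<dots> \<le> integral {0..1} (\<lambda>z. (A' + (f' z)\<^sup>2 / A') / 2)"
      by (rule integral_subset_le) (use A' ab in \<open>auto intro!: integrable_continuous_real continuous_intros cf'\<close>)
    also have "\<dots> = (A' + integral {0..1} (\<lambda>z. (f' z)\<^sup>2) / A') / 2"
      by (simp, subst integral_add) (use A' in \<open>auto intro!: integrable_continuous_real continuous_intros cf'\<close>)
    also have "\<dots> \<le> (A' + A'\<^sup>2 / A') / 2"
      using A' sob_ball_integral[OF f'(2)] power_mono[OF A'(2) assms(2), of 2]
      by (intro divide_right_mono add_left_mono) auto
    also have "\<dots> = A + e" using A' by (simp add: power2_eq_square A'_def[symmetric])
    finally show "\<bar>f b - f a\<bar> \<le> A + e" .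
  qed
  show ?thesis
  proof (rule periodic_bound_of_unit[of f])
    fix z :: real assume z: "z \<in> {0..1}"
    show "\<bar>f z\<bar> \<le> 2 * A"
      using var[of y z] var[of z y] z y(1) fy by (cases "y \<le> z") auto
  qed (rule sob_ball_periodic[OF assms(1)])
qed

lemma sob_ball_mult_zero:
  assumes f: "sob_ball 0 A f" and g: "continuous_on UNIV g" "\<And>x. g (x + 1) = g x" "\<And>x. \<bar>g x\<bar> \<le> B" and "0 \<le> B"
  shows "sob_ball 0 (B * A) (\<lambda>x. g x * f x)"
proof -
  have cg: "continuous_on S g" for S using g(1) continuous_on_subset by blast
  have "integral {0..1} (\<lambda>x. (g x * f x)\<^sup>2) \<le> integral {0..1} (\<lambda>x. B\<^sup>2 * (f x)\<^sup>2)"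
  proof (rule integral_le)
    fix x
    have "(g x)\<^sup>2 \<le> B\<^sup>2" using g(3)[of x] by (metis abs_ge_zero power2_abs power_mono)
    thus "(g x * f x)\<^sup>2 \<le> B\<^sup>2 * (f x)\<^sup>2" by (simp add: power_mult_distrib mult_right_mono)
  qed (intro integrable_continuous_real continuous_intros sob_ball_continuous[OF f] cg)+
  also have "\<dots> \<le> (B * A)\<^sup>2"
    using sob_ball_integral[OF f] by (simp add: power_mult_distrib mult_left_mono)
  finally show ?thesis using f g by (auto intro!: continuous_intros)
qed

text \<open>
  Each application of the product rule lowers the order of one factor only. It suffices that at the end
  one factor still has a derivative to spare, hence is bounded, while the other is in \<open>L\<^sup>2\<close>. In particular
  the factor of lower order may have exactly the order of the product.
\<close>

lemma sob_ball_mult: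
  assumes "0 \<le> A" "0 \<le> B"
  shows "c \<le> a \<Longrightarrow> c \<le> b \<Longrightarrow> 1 \<le> max a b \<Longrightarrow> sob_ball a A f \<Longrightarrow> sob_ball b B g
    \<Longrightarrow> sob_ball c (2 * 4 ^ c * A * B) (\<lambda>x. f x * g x)"
proof (induction c arbitrary: a b f g)
  have base: "sob_ball 0 (2 * A * B) (\<lambda>x. f x * g x)"
    if m: "1 \<le> max a b" and f: "sob_ball a A f" and g: "sob_ball b B g" for a b f g
  proof (cases "a \<ge> 1")
    case True
    then obtain n where "a = Suc n" by (cases a) auto
    hence "\<bar>f x\<bar> \<le> 2 * A" for x using sob_ball_sup[of n A f] f assms by simp
    from sob_ball_mult_zero[OF sob_ball_zero[OF g] sob_ball_continuous[OF f] sob_ball_periodic[OF f] this]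
    show ?thesis using assms by simp
  next
    case False
    then obtain n where "b = Suc n" using m by (cases b) auto
    hence "\<bar>g x\<bar> \<le> 2 * B" for x using sob_ball_sup[of n B g] g assms by simp
    from sob_ball_mult_zero[OF sob_ball_zero[OF f] sob_ball_continuous[OF g] sob_ball_periodic[OF g] this]
    show ?thesis using assms by (simp add: mult_ac)
  qed
  {
    case 0
    thus ?case using base by simp
  next
    case (Suc c)
    then obtain a' b' where ab: "a = Suc a'" "b = Suc b'" by (cases a; cases b) auto
    obtain f' g' where f': "\<And>x. (f has_real_derivative f' x) (at x)" "sob_ball a' A f'"
      and g': "\<And>x. (g has_real_derivative g' x) (at x)" "sob_ball b' B g'"
      using Suc.prems(4,5) unfolding ab by auto
    have K: "0 \<le> 2 * 4 ^ c * A * B" using assms by simp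
    have 1: "sob_ball c (2 * 4 ^ c * A * B) (\<lambda>x. f' x * g x)"
      by (rule Suc.IH[OF _ _ _ f'(2) Suc.prems(5)]) (use Suc.prems ab in auto)
    have 2: "sob_ball c (2 * 4 ^ c * A * B) (\<lambda>x. f x * g' x)"
      by (rule Suc.IH[OF _ _ _ Suc.prems(4) g'(2)]) (use Suc.prems ab in auto)
    have "sob_ball c (2 * 4 ^ Suc c * A * B) (\<lambda>x. f' x * g x + f x * g' x)"
      using sob_ball_add[OF 1 2 K K] by (simp add: mult_ac)
    moreover have "sob_ball 0 (2 * 4 ^ Suc c * A * B) (\<lambda>x. f x * g x)"
    proof (rule sob_ball_mono[OF base[OF Suc.prems(3-5)]])
      have "1 * (2 * A * B) \<le> 4 ^ Suc c * (2 * A * B)"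
        using assms by (intro mult_right_mono one_le_power) auto
      thus "2 * A * B \<le> 2 * 4 ^ Suc c * A * B" by (simp add: mult_ac)
    qed (use assms in auto)
    moreover have "((\<lambda>x. f x * g x) has_real_derivative f' x * g x + f x * g' x) (at x)" for x
      using DERIV_mult[OF f'(1) g'(1)] by (simp add: mult.commute)
    ultimately show ?case unfolding sob_ball_Suc
      by (intro conjI exI[of _ "\<lambda>x. f' x * g x + f x * g' x"] allI)
  }
qed

text \<open>
  Induction on the order through \<open>(exp (- p))' = - exp (- p) p'\<close>. It starts at order one, where
  \<open>p\<close> is already bounded.
\<close>

lemma sob_ball_exp:
  assumes "0 \<le> A"
  shows "\<exists>C\<ge>0. \<forall>p. sob_ball (Suc m) A p \<longrightarrow> sob_ball (Suc m) C (\<lambda>x. exp (- p x))"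
proof (induction m)
  have bd: "exp (- p x) \<le> exp (2 * A)" if "sob_ball (Suc n) A p" for n p x
    using sob_ball_sup[OF that assms, of x] by simp
  have zero: "sob_ball 0 (exp (2 * A)) (\<lambda>x. exp (- p x))" if p: "sob_ball (Suc n) A p" for n p
  proof -
    have "sob_ball 0 (exp (2 * A) * \<bar>1\<bar>) (\<lambda>x. exp (- p x) * 1)"
      by (rule sob_ball_mult_zero[OF sob_ball_const])
         (use bd[OF p] sob_ball_periodic[OF p] in \<open>auto intro!: continuous_intros sob_ball_continuous[OF p]\<close>)
    thus ?thesis by (simp only: abs_one mult_1_right)
  qed
  have D: "((\<lambda>x. exp (- p x)) has_real_derivative - (exp (- p x) * p' x)) (at x)"
    if "\<And>x. (p has_real_derivative p' x) (at x)" for p p' x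
    using DERIV_chain2[OF DERIV_exp DERIV_minus[OF that]] by simp
  {
    case 0
    show ?case
    proof (intro exI[of _ "exp (2 * A) * (1 + A)"] conjI allI impI)
      fix p assume p: "sob_ball (Suc 0) A p"
      then obtain p' where p': "\<And>x. (p has_real_derivative p' x) (at x)" "sob_ball 0 A p'" by auto
      have "sob_ball 0 (exp (2 * A) * (1 + A)) (\<lambda>x. exp (- p x))"
        by (rule sob_ball_mono[OF zero[OF p]]) (use assms in auto)
      moreover have 3: "sob_ball 0 (exp (2 * A) * A) (\<lambda>x. exp (- p x) * p' x)"
        by (rule sob_ball_mult_zero[OF p'(2)])
           (use bd[OF p] sob_ball_periodic[OF p] in \<open>auto intro!: continuous_intros sob_ball_continuous[OF p]\<close>)
      have "sob_ball 0 (exp (2 * A) * (1 + A)) (\<lambda>x. - (exp (- p x) * p' x))"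
        by (rule sob_ball_mono[OF sob_ball_uminus[OF 3]]) (use assms in auto)
      ultimately show "sob_ball (Suc 0) (exp (2 * A) * (1 + A)) (\<lambda>x. exp (- p x))"
        unfolding sob_ball_Suc using D[OF p'(1)]
        by (intro conjI exI[of _ "\<lambda>x. - (exp (- p x) * p' x)"] allI)
    qed (use assms in auto)
  next
    case (Suc m)
    then obtain C where C: "C \<ge> 0" "\<And>p. sob_ball (Suc m) A p \<Longrightarrow> sob_ball (Suc m) C (\<lambda>x. exp (- p x))"
      by blast
    let ?C' = "exp (2 * A) + 2 * 4 ^ Suc m * C * A"
    show ?case
    proof (intro exI[of _ ?C'] conjI allI impI)
      fix p assume p: "sob_ball (Suc (Suc m)) A p"
      then obtain p' where p': "\<And>x. (p has_real_derivative p' x) (at x)" "sob_ball (Suc m) A p'" by auto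
      have "sob_ball 0 ?C' (\<lambda>x. exp (- p x))"
        by (rule sob_ball_mono[OF zero[OF p]]) (use assms C in auto)
      moreover have 3: "sob_ball (Suc m) (2 * 4 ^ Suc m * C * A) (\<lambda>x. exp (- p x) * p' x)"
        by (rule sob_ball_mult[OF C(1) assms _ _ _ C(2)[OF sob_ball_Suc_imp[OF p]] p'(2)]) auto
      have "sob_ball (Suc m) ?C' (\<lambda>x. - (exp (- p x) * p' x))"
        by (rule sob_ball_mono[OF sob_ball_uminus[OF 3]]) (use assms C in auto)
      ultimately show "sob_ball (Suc (Suc m)) ?C' (\<lambda>x. exp (- p x))"
        unfolding sob_ball_Suc[of "Suc m"] using D[OF p'(1)]
        by (intro conjI exI[of _ "\<lambda>x. - (exp (- p x) * p' x)"] allI)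
    qed (use assms C in auto)
  }
qed

text \<open>
  Each step applies \<open>G \<mapsto> exp (- p) G'\<close>. At step \<open>j\<close> it multiplies a function of order \<open>n - j \<le> m\<close> by
  \<open>exp (- p)\<close>, which has order \<open>m\<close>; this is why order \<open>m\<close> of \<open>p\<close> yields order \<open>m + 1\<close> of the result.
\<close>

lemma pull_coeff_derivatives_bound:
  assumes m: "m \<ge> 1" and C: "sob_ball m C (\<lambda>x. exp (- p x))" "C \<ge> 0"
    and \<phi>: "circle_map \<phi> (\<lambda>x. exp (p x))" and E: "\<And>x. exp (p x) \<le> E" and K: "finite K"
  shows "n \<le> Suc m \<Longrightarrow> sob_ball n R G \<Longrightarrow> R \<ge> 0 \<Longrightarrow>
    (\<Sum>k\<in>K. (freq k) ^ (2 * n) * (cmod (pull_coeff \<phi> (\<lambda>x. exp (p x)) G k))\<^sup>2)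
      \<le> E * ((2 * 4 ^ m * C) ^ n * R)\<^sup>2"
proof (induction n arbitrary: G R)
  case 0
  have cJ: "continuous_on S (\<lambda>x. exp (p x))" for S by (rule circle_map_continuous_deriv[OF \<phi>])
  note cG = sob_ball_continuous[OF 0(2)]
  have "(\<Sum>k\<in>K. (cmod (pull_coeff \<phi> (\<lambda>x. exp (p x)) G k))\<^sup>2) \<le> integral {0..1} (\<lambda>x. (G x)\<^sup>2 * exp (p x))"
    by (rule bessel_pull[OF \<phi> cG K])
  also have "\<dots> \<le> integral {0..1} (\<lambda>x. (G x)\<^sup>2 * E)"
    by (rule integral_le) (auto intro!: integrable_continuous_real continuous_intros cG cJ mult_left_mono E)
  also have "\<dots> \<le> R\<^sup>2 * E"
    using sob_ball_integral[OF 0(2)] order.trans[OF less_imp_le[OF exp_gt_zero] E] by (simp add: mult_right_mono)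
  finally show ?case by (simp add: mult.commute)
next
  case (Suc n)
  then obtain G' where G': "\<And>x. (G has_real_derivative G' x) (at x)" "sob_ball n R G'" by auto
  let ?H = "\<lambda>x. exp (- p x) * G' x"
  let ?T = "pull_coeff \<phi> (\<lambda>x. exp (p x))"
  have "sob_ball n (2 * 4 ^ n * C * R) ?H"
    by (rule sob_ball_mult[OF C(2) Suc.prems(3) _ _ _ C(1) G'(2)]) (use Suc.prems m in auto)
  hence H: "sob_ball n (2 * 4 ^ m * C * R) ?H"
  proof (rule sob_ball_mono)
    have "(4::real) ^ n * (2 * C * R) \<le> 4 ^ m * (2 * C * R)"
      using Suc.prems C by (intro mult_right_mono power_increasing) auto
    thus "2 * 4 ^ n * C * R \<le> 2 * 4 ^ m * C * R" by (simp add: mult_ac)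
  qed (use C Suc.prems in auto)
  have T: "?T ?H k = complex_of_real (freq k) * \<i> * ?T G k" for k
    by (rule pull_coeff_derivative[OF \<phi> G'(1) sob_ball_continuous[OF G'(2)] sob_ball_periodic[OF Suc.prems(2)]])
       (simp add: mult_ac exp_minus)
  have "(\<Sum>k\<in>K. (freq k) ^ (2 * Suc n) * (cmod (?T G k))\<^sup>2)
      = (\<Sum>k\<in>K. (freq k) ^ (2 * n) * (cmod (?T ?H k))\<^sup>2)"
  proof (rule sum.cong[OF refl])
    fix k
    have "(cmod (?T ?H k))\<^sup>2 = (freq k)\<^sup>2 * (cmod (?T G k))\<^sup>2"
      unfolding T by (simp add: norm_mult power_mult_distrib)
    thus "(freq k) ^ (2 * Suc n) * (cmod (?T G k))\<^sup>2 = (freq k) ^ (2 * n) * (cmod (?T ?H k))\<^sup>2"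
      by (simp add: power2_eq_square)
  qed
  also have "\<dots> \<le> E * ((2 * 4 ^ m * C) ^ n * (2 * 4 ^ m * C * R))\<^sup>2"
    by (rule Suc.IH[OF _ H]) (use Suc.prems C in auto)
  finally show ?case by (simp add: mult_ac)
qed

lemma le_freq_weight_power_mult: "0 \<le> x \<Longrightarrow> x \<le> freq_weight k ^ n * x"
  using mult_right_mono[OF one_le_power[OF freq_weight_ge_1], of x k n] by simp

text \<open>
  The real part is at most the modulus of the complex sum, whose norm is given by Parseval's identity.
\<close>

lemma trig_sum_sob_ball:
  assumes "finite K"
  shows "(\<Sum>k\<in>K. freq_weight k ^ n * (cmod (c k))\<^sup>2) \<le> A\<^sup>2 \<Longrightarrow> sob_ball n A (trig_sum K c)"
proof (induction n arbitrary: c)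
  have cont: "continuous_on S (\<lambda>x. \<Sum>k\<in>K. c k * cis (freq k * x))" for S and c :: "int \<Rightarrow> complex"
    by (intro continuous_intros)
  have base: "sob_ball 0 A (trig_sum K c)" if "(\<Sum>k\<in>K. (cmod (c k))\<^sup>2) \<le> A\<^sup>2" for c
  proof -
    have "integral {0..1} (\<lambda>x. (trig_sum K c x)\<^sup>2) \<le> integral {0..1} (\<lambda>x. 1 * (cmod (\<Sum>k\<in>K. c k * cis (freq k * x)))\<^sup>2)"
    proof (rule integral_le)
      fix x
      have "trig_sum K c x = Re (\<Sum>k\<in>K. c k * cis (freq k * x))" by (simp only: trig_sum_def Re_sum)
      hence "\<bar>trig_sum K c x\<bar> \<le> cmod (\<Sum>k\<in>K. c k * cis (freq k * x))"
        by (simp only: abs_Re_le_cmod)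
      thus "(trig_sum K c x)\<^sup>2 \<le> 1 * (cmod (\<Sum>k\<in>K. c k * cis (freq k * x)))\<^sup>2"
        by (simp add: abs_le_square_iff[symmetric])
    qed (intro integrable_continuous_real continuous_intros trig_sum_continuous)+
    also have "\<dots> = (\<Sum>k\<in>K. (cmod (c k))\<^sup>2)"
      by (rule circle_map_parseval[OF circle_map_id assms])
    finally show ?thesis using that by (simp add: trig_sum_continuous trig_sum_periodic)
  qed
  {
    case 0
    thus ?case using base by simp
  next
    case (Suc n)
    let ?d = "\<lambda>k. complex_of_real (freq k) * \<i> * c k"
    have "(\<Sum>k\<in>K. freq_weight k ^ n * (cmod (?d k))\<^sup>2) \<le> (\<Sum>k\<in>K. freq_weight k ^ Suc n * (cmod (c k))\<^sup>2)"
    proof (rule sum_mono)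
      fix k
      have "freq_weight k ^ n * (cmod (?d k))\<^sup>2 = (freq_weight k ^ n * (cmod (c k))\<^sup>2) * (freq k)\<^sup>2"
        by (simp add: norm_mult power_mult_distrib mult_ac)
      also have "\<dots> \<le> (freq_weight k ^ n * (cmod (c k))\<^sup>2) * freq_weight k"
        by (intro mult_left_mono) (auto simp: freq_weight_def)
      finally show "freq_weight k ^ n * (cmod (?d k))\<^sup>2 \<le> freq_weight k ^ Suc n * (cmod (c k))\<^sup>2"
        by (simp add: mult_ac)
    qed
    hence d: "sob_ball n A (trig_sum K ?d)" using Suc by (intro Suc.IH) linarith
    have "(\<Sum>k\<in>K. (cmod (c k))\<^sup>2) \<le> (\<Sum>k\<in>K. freq_weight k ^ Suc n * (cmod (c k))\<^sup>2)"
      by (intro sum_mono le_freq_weight_power_mult) simp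
    hence "sob_ball 0 A (trig_sum K c)" using Suc.prems by (intro base) linarith
    thus ?case unfolding sob_ball_Suc using d trig_sum_derivative[of K c] by blast
  }
qed

text \<open>
  The two estimates between which the fractional one is interpolated: order \<open>0\<close> and order \<open>m + 1\<close>, with a
  constant that depends on \<open>\<phi>\<close> only through a bound for \<open>ln \<phi>'\<close> in \<open>H\<^sup>m\<close>.
\<close>

lemma pull_coeff_endpoint_bounds:
  assumes m: "m \<ge> 1" and A: "A \<ge> 0"
  obtains D where "D \<ge> 0"
    and "\<And>p \<phi> L c K. \<lbrakk>sob_ball m A p; circle_map \<phi> (\<lambda>x. exp (p x)); finite L; finite K\<rbrakk> \<Longrightarrow>
      (\<Sum>k\<in>K. (cmod (pull_coeff \<phi> (\<lambda>x. exp (p x)) (trig_sum L c) k))\<^sup>2) \<le> D * (\<Sum>k\<in>L. (cmod (c k))\<^sup>2)"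
    and "\<And>p \<phi> L c K. \<lbrakk>sob_ball m A p; circle_map \<phi> (\<lambda>x. exp (p x)); finite L; finite K\<rbrakk> \<Longrightarrow>
      (\<Sum>k\<in>K. freq_weight k ^ Suc m * (cmod (pull_coeff \<phi> (\<lambda>x. exp (p x)) (trig_sum L c) k))\<^sup>2)
        \<le> D * (\<Sum>k\<in>L. freq_weight k ^ Suc m * (cmod (c k))\<^sup>2)"
proof -
  obtain m' where m': "m = Suc m'" using m by (cases m) auto
  obtain C where C: "C \<ge> 0" "\<And>p. sob_ball m A p \<Longrightarrow> sob_ball m C (\<lambda>x. exp (- p x))"
    using sob_ball_exp[OF A, of m'] unfolding m' by blast
  define E where "E = exp (2 * A)"
  define D where "D = E * (1 + 2 ^ Suc m * (1 + ((2 * 4 ^ m * C) ^ Suc m)\<^sup>2))"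
  have E0: "E > 0" by (simp add: E_def)
  have D: "D \<ge> 0" "E \<le> D" "2 ^ Suc m * (E + E * ((2 * 4 ^ m * C) ^ Suc m)\<^sup>2) \<le> D"
    using E0 by (auto simp: D_def algebra_simps)
  have E: "exp (p x) \<le> E" if "sob_ball m A p" for p x
    using sob_ball_sup[of m' A p x] that A by (auto simp: E_def m')
  have low: "(\<Sum>k\<in>K. (cmod (pull_coeff \<phi> (\<lambda>x. exp (p x)) (trig_sum L c) k))\<^sup>2) \<le> E * (\<Sum>k\<in>L. (cmod (c k))\<^sup>2)"
    if p: "sob_ball m A p" "circle_map \<phi> (\<lambda>x. exp (p x))" "finite L" "finite K" for p \<phi> L c K
  proof -
    have "sob_ball 0 (sqrt (\<Sum>k\<in>L. (cmod (c k))\<^sup>2)) (trig_sum L c)"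
      by (rule trig_sum_sob_ball[OF p(3)]) (simp add: sum_nonneg)
    from pull_coeff_derivatives_bound[OF m C(2)[OF p(1)] C(1) p(2) E[OF p(1)] p(4) _ this]
    show ?thesis by (simp add: sum_nonneg)
  qed
  have high: "(\<Sum>k\<in>K. freq_weight k ^ Suc m * (cmod (pull_coeff \<phi> (\<lambda>x. exp (p x)) (trig_sum L c) k))\<^sup>2)
        \<le> D * (\<Sum>k\<in>L. freq_weight k ^ Suc m * (cmod (c k))\<^sup>2)"
    if p: "sob_ball m A p" "circle_map \<phi> (\<lambda>x. exp (p x))" "finite L" "finite K" for p \<phi> L c K
  proof -
    let ?T = "\<lambda>k. (cmod (pull_coeff \<phi> (\<lambda>x. exp (p x)) (trig_sum L c) k))\<^sup>2"
    define S where "S = (\<Sum>k\<in>L. freq_weight k ^ Suc m * (cmod (c k))\<^sup>2)"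
    have S0: "S \<ge> 0" unfolding S_def by (intro sum_nonneg) (auto simp: less_imp_le[OF freq_weight_pos])
    have "sob_ball (Suc m) (sqrt S) (trig_sum L c)"
      by (rule trig_sum_sob_ball[OF p(3)]) (use S0 in \<open>simp add: S_def del: power_Suc\<close>)
    from pull_coeff_derivatives_bound[OF m C(2)[OF p(1)] C(1) p(2) E[OF p(1)] p(4) _ this]
    have 1: "(\<Sum>k\<in>K. (freq k) ^ (2 * Suc m) * ?T k) \<le> E * ((2 * 4 ^ m * C) ^ Suc m)\<^sup>2 * S"
      using S0 by (simp add: power_mult_distrib mult_ac del: power_Suc)
    have 2: "(\<Sum>k\<in>K. ?T k) \<le> E * S"
    proof (rule order.trans[OF low[OF p]], rule mult_left_mono)
      show "(\<Sum>k\<in>L. (cmod (c k))\<^sup>2) \<le> S" unfolding S_def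
        by (intro sum_mono le_freq_weight_power_mult) simp
    qed (use E0 in simp)
    have "(\<Sum>k\<in>K. freq_weight k ^ Suc m * ?T k) \<le> (\<Sum>k\<in>K. 2 ^ Suc m * ?T k + 2 ^ Suc m * ((freq k) ^ (2 * Suc m) * ?T k))"
    proof (rule sum_mono)
      fix k
      define y where "y = (freq k)\<^sup>2"
      have y: "y \<ge> 0" by (simp add: y_def)
      have "(1 + y) ^ Suc m \<le> (2 * max 1 y) ^ Suc m" using y by (intro power_mono) auto
      also have "\<dots> \<le> 2 ^ Suc m * (1 + y ^ Suc m)"
        using y by (cases "y \<le> 1") (auto simp: power_mult_distrib max_def simp del: power_Suc)
      finally have "freq_weight k ^ Suc m \<le> 2 ^ Suc m * (1 + (freq k) ^ (2 * Suc m))"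
        unfolding y_def freq_weight_def power_mult[symmetric] .
      from mult_right_mono[OF this, of "?T k"]
      show "freq_weight k ^ Suc m * ?T k \<le> 2 ^ Suc m * ?T k + 2 ^ Suc m * ((freq k) ^ (2 * Suc m) * ?T k)"
        by (simp add: algebra_simps del: power_Suc)
    qed
    also have "\<dots> = 2 ^ Suc m * ((\<Sum>k\<in>K. ?T k) + (\<Sum>k\<in>K. (freq k) ^ (2 * Suc m) * ?T k))"
      by (simp only: sum.distrib sum_distrib_left[symmetric] distrib_left)
    also have "\<dots> \<le> 2 ^ Suc m * (E * S + E * ((2 * 4 ^ m * C) ^ Suc m)\<^sup>2 * S)"
      using 1 2 by (intro mult_left_mono add_mono) auto
    also have "\<dots> = (2 ^ Suc m * (E + E * ((2 * 4 ^ m * C) ^ Suc m)\<^sup>2)) * S"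
      by (simp only: distrib_right mult.assoc)
    also have "\<dots> \<le> D * S" by (rule mult_right_mono[OF D(3) S0])
    finally show ?thesis by (simp only: S_def)
  qed
  show ?thesis
    by (rule that[OF D(1) order.trans[OF low mult_right_mono[OF D(2)]] high]) (auto intro: sum_nonneg)
qed

section \<open>Interpolation between integer orders\<close>

text \<open>
  An increasing geometric sum is comparable to its last term. The set of indices is given by a
  predicate, since it arises as a frequency cut-off.
\<close>

lemma geometric_below:
  fixes x y :: real
  assumes x: "x > 1" and le: "\<And>j. P j \<Longrightarrow> x ^ j \<le> y" and y: "y \<ge> 0"
  shows "(\<Sum>j | j < J \<and> P j. x ^ j) \<le> y * x / (x - 1)"
proof (induction J)
  case 0
  thus ?case using x y by simp
next
  case (Suc J)
  show ?case
  proof (cases "P J")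
    case True
    have "(\<Sum>j | j < Suc J \<and> P j. x ^ j) \<le> (\<Sum>j<Suc J. x ^ j)"
      using x by (intro sum_mono2) auto
    also have "\<dots> = (x ^ Suc J - 1) / (x - 1)" using x by (subst geometric_sum) auto
    also have "\<dots> \<le> (x * x ^ J) / (x - 1)" using x by (intro divide_right_mono) auto
    also have "\<dots> \<le> (x * y) / (x - 1)" using x le[OF True] by (intro divide_right_mono mult_left_mono) auto
    finally show ?thesis by (simp add: mult.commute)
  next
    case False
    hence "{j. j < Suc J \<and> P j} = {j. j < J \<and> P j}" by (auto simp: less_Suc_eq)
    thus ?thesis using Suc by simp
  qed
qed

text \<open>
  A decreasing geometric sum is comparable to its first term. Induction works for the sharper bound
  \<open>max 0 (y - x ^ J)\<close>, which telescopes.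
\<close>

lemma geometric_above:
  fixes x y :: real
  assumes x: "0 < x" "x < 1" and le: "\<And>j. P j \<Longrightarrow> x ^ j \<le> y" and y: "y \<ge> 0"
  shows "(\<Sum>j | j < J \<and> P j. x ^ j) \<le> y / (1 - x)"
proof -
  have "(1 - x) * (\<Sum>j | j < J \<and> P j. x ^ j) \<le> max 0 (y - x ^ J)"
  proof (induction J)
    case (Suc J)
    have d: "x ^ Suc J \<le> x ^ J" using x by (intro power_decreasing) auto
    show ?case
    proof (cases "P J")
      case True
      hence "{j. j < Suc J \<and> P j} = insert J {j. j < J \<and> P j}" by (auto simp: less_Suc_eq)
      hence "(1 - x) * (\<Sum>j | j < Suc J \<and> P j. x ^ j) = x ^ J - x ^ Suc J + (1 - x) * (\<Sum>j | j < J \<and> P j. x ^ j)"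
        by (simp add: algebra_simps)
      thus ?thesis using Suc le[OF True] by simp
    next
      case False
      hence "{j. j < Suc J \<and> P j} = {j. j < J \<and> P j}" by (auto simp: less_Suc_eq)
      thus ?thesis using Suc d by (simp del: power_Suc)
    qed
  qed simp
  also have "\<dots> \<le> y" using x y by simp
  finally show ?thesis using x by (simp add: field_simps)
qed

text \<open>
  The two geometric series of ratios \<open>4 powr (r - n)\<close> and \<open>4 powr (- r)\<close> from \<open>dyadic_interpolation\<close>; the factor in
  front accounts for weights lying between two powers of \<open>4\<close>.
\<close>

definition dyadic_const :: "real \<Rightarrow> nat \<Rightarrow> real" where
  "dyadic_const r n =
     4 powr r * (1 / (1 - 4 powr (r - n)) + 4 powr r / (4 powr r - 1))"

lemma dyadic_const_nonneg: "0 < r \<Longrightarrow> r < real n \<Longrightarrow> dyadic_const r n \<ge> 0"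
  using powr_less_mono[of "r - n" 0 4] powr_mono[of 0 r 4] unfolding dyadic_const_def
  by (intro mult_nonneg_nonneg add_nonneg_nonneg divide_nonneg_nonneg) auto

text \<open>
  Real interpolation between the orders \<open>0\<close> and \<open>n\<close>, for sequences. Think of \<open>\<alpha>\<close> and \<open>\<beta>\<close> as the squared Fourier
  coefficients of the image and of the argument of a linear map. The hypothesis is what boundedness at both
  orders gives when the argument is cut at frequency weight \<open>Q\<close>: the low part is estimated at order \<open>n\<close>, the
  high part at order \<open>0\<close>. Summing over \<open>Q = 4 ^ j\<close> with weight \<open>4 ^ (j r)\<close> leaves for each frequency two geometric
  series, which converge precisely because \<open>0 < r < n\<close>.
\<close>

lemma dyadic_interpolation:
  fixes r :: real and n :: nat and K L :: "int set"
  assumes r: "0 < r" "r < real n" and fin: "finite K" "finite L"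
    and \<alpha>: "\<And>k. \<alpha> k \<ge> 0" and \<beta>: "\<And>k. \<beta> k \<ge> 0" and D: "D \<ge> 0"
    and split: "\<And>Q. Q \<ge> 1 \<Longrightarrow> (\<Sum>k | k \<in> K \<and> Q \<le> freq_weight k. \<alpha> k) \<le>
       D * ((\<Sum>l | l \<in> L \<and> freq_weight l \<le> Q. freq_weight l ^ n * \<beta> l) / Q ^ n
            + (\<Sum>l | l \<in> L \<and> \<not> freq_weight l \<le> Q. \<beta> l))"
  shows "(\<Sum>k\<in>K. freq_weight k powr r * \<alpha> k) \<le> dyadic_const r n * D * (\<Sum>l\<in>L. freq_weight l powr r * \<beta> l)"
proof -
  define x where "x = (4::real) powr r"
  define y where "y = (4::real) powr (r - n)"
  have x: "x > 1" using r by (simp add: x_def)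
  have y: "0 < y" "y < 1" using r powr_less_mono[of "r - n" 0 4] by (simp_all add: y_def)
  have xj: "x ^ j = (4 ^ j) powr r" for j
    unfolding x_def by (simp add: powr_realpow[symmetric] powr_powr mult.commute)
  have yj: "y ^ j = (4 ^ j) powr (r - n)" for j
    unfolding y_def by (simp add: powr_realpow[symmetric] powr_powr mult.commute)
  have xy: "x ^ j / (4 ^ j) ^ n = y ^ j" for j
    unfolding xj yj by (simp add: powr_diff powr_realpow)
  have c_def: "dyadic_const r n = x * (1 / (1 - y) + x / (x - 1))"
    by (simp add: dyadic_const_def x_def y_def)
    let ?w = freq_weight
    obtain J where J: "\<And>k. k \<in> K \<Longrightarrow> ?w k < 4 ^ J"
    proof -
      obtain J where "Max (insert 0 (?w ` K)) < 4 ^ J"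
        using real_arch_pow[of 4 "Max (insert 0 (?w ` K))"] by auto
      moreover have "?w k \<le> Max (insert 0 (?w ` K))" if "k \<in> K" for k
        using fin that by (intro Max_ge) auto
      ultimately show ?thesis using that by (meson le_less_trans)
    qed
    have step1: "?w k powr r \<le> x * (\<Sum>j | j < J \<and> 4 ^ j \<le> ?w k. x ^ j)" if k: "k \<in> K" for k
    proof -
      \<comment> \<open>\<open>4 ^ (i - 1) \<le> w < 4 ^ i\<close>, so the term with index \<open>i - 1\<close> dominates up to the factor \<open>x\<close>\<close>
      define i where "i = (LEAST j. ?w k < 4 ^ j)"
      have i: "?w k < 4 ^ i" unfolding i_def by (rule LeastI[of _ J]) (rule J[OF k])
      have "i \<noteq> 0" using i freq_weight_ge_1[of k] by (intro notI) simp
      then obtain i' where i': "i = Suc i'" by (cases i) auto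
      have le: "4 ^ i' \<le> ?w k" using not_less_Least[of i' "\<lambda>j. ?w k < 4 ^ j"] i' i_def by force
      have "i' < J"
      proof (rule ccontr)
        assume "\<not> i' < J"
        hence "(4::real) ^ J \<le> 4 ^ i'" by (intro power_increasing) auto
        thus False using J[OF k] le by linarith
      qed
      have "?w k powr r \<le> (4 ^ i) powr r" using i r freq_weight_pos[of k] by (intro powr_mono2) auto
      also have "\<dots> = x * x ^ i'" unfolding xj[symmetric] i' by simp
      also have "x ^ i' \<le> (\<Sum>j | j < J \<and> 4 ^ j \<le> ?w k. x ^ j)"
        by (rule member_le_sum) (use \<open>i' < J\<close> le x in auto)
      finally show ?thesis using x by simp
    qed
    have "(\<Sum>k\<in>K. ?w k powr r * \<alpha> k) \<le> (\<Sum>k\<in>K. (x * (\<Sum>j | j < J \<and> 4 ^ j \<le> ?w k. x ^ j)) * \<alpha> k)"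
      by (intro sum_mono mult_right_mono step1 \<alpha>)
    also have "\<dots> = (\<Sum>k\<in>K. \<Sum>j | j < J \<and> 4 ^ j \<le> ?w k. x * (x ^ j * \<alpha> k))"
      by (simp add: sum_distrib_left sum_distrib_right mult_ac)
    also have "\<dots> = (\<Sum>j<J. \<Sum>k | k \<in> K \<and> 4 ^ j \<le> ?w k. x * (x ^ j * \<alpha> k))"
      using sum.swap_restrict[of K "{..<J}" "\<lambda>k j. x * (x ^ j * \<alpha> k)" "\<lambda>k j. 4 ^ j \<le> ?w k"] fin by simp
    also have "\<dots> = (\<Sum>j<J. x * (x ^ j * (\<Sum>k | k \<in> K \<and> 4 ^ j \<le> ?w k. \<alpha> k)))"
      by (simp add: sum_distrib_left)
    also have "\<dots> \<le> (\<Sum>j<J. x * (x ^ j * (D * ((\<Sum>l | l \<in> L \<and> ?w l \<le> 4 ^ j. ?w l ^ n * \<beta> l) / (4 ^ j) ^ n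
              + (\<Sum>l | l \<in> L \<and> \<not> ?w l \<le> 4 ^ j. \<beta> l)))))"
      using x by (intro sum_mono mult_left_mono split) auto
    also have "\<dots> = x * D * ((\<Sum>j<J. x ^ j / (4 ^ j) ^ n * (\<Sum>l | l \<in> L \<and> ?w l \<le> 4 ^ j. ?w l ^ n * \<beta> l))
       + (\<Sum>j<J. x ^ j * (\<Sum>l | l \<in> L \<and> \<not> ?w l \<le> 4 ^ j. \<beta> l)))"
    proof -
      have "(\<Sum>j<J. x * (x ^ j * (D * (a j / (4 ^ j) ^ n + b j)))) =
          x * D * ((\<Sum>j<J. x ^ j / (4 ^ j) ^ n * a j) + (\<Sum>j<J. x ^ j * b j))" for a b :: "nat \<Rightarrow> real"
        unfolding sum_distrib_left sum.distrib[symmetric]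
        by (intro sum.cong refl) (simp add: algebra_simps)
      thus ?thesis .
    qed
    also have "(\<Sum>j<J. x ^ j / (4 ^ j) ^ n * (\<Sum>l | l \<in> L \<and> ?w l \<le> 4 ^ j. ?w l ^ n * \<beta> l))
       = (\<Sum>j<J. \<Sum>l | l \<in> L \<and> ?w l \<le> 4 ^ j. y ^ j * (?w l ^ n * \<beta> l))"
      by (simp only: xy sum_distrib_left)
    also have "\<dots> = (\<Sum>l\<in>L. \<Sum>j | j < J \<and> ?w l \<le> 4 ^ j. y ^ j * (?w l ^ n * \<beta> l))"
      using sum.swap_restrict[of "{..<J}" L "\<lambda>j l. y ^ j * (?w l ^ n * \<beta> l)" "\<lambda>j l. ?w l \<le> 4 ^ j"] fin by simp
    also have "(\<Sum>j<J. x ^ j * (\<Sum>l | l \<in> L \<and> \<not> ?w l \<le> 4 ^ j. \<beta> l))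
       = (\<Sum>j<J. \<Sum>l | l \<in> L \<and> \<not> ?w l \<le> 4 ^ j. x ^ j * \<beta> l)"
      by (simp only: sum_distrib_left)
    also have "\<dots> = (\<Sum>l\<in>L. \<Sum>j | j < J \<and> \<not> ?w l \<le> 4 ^ j. x ^ j * \<beta> l)"
      using sum.swap_restrict[of "{..<J}" L "\<lambda>j l. x ^ j * \<beta> l" "\<lambda>j l. \<not> ?w l \<le> 4 ^ j"] fin by simp
    also have "x * D * ((\<Sum>l\<in>L. \<Sum>j | j < J \<and> ?w l \<le> 4 ^ j. y ^ j * (?w l ^ n * \<beta> l)) + (\<Sum>l\<in>L. \<Sum>j | j < J \<and> \<not> ?w l \<le> 4 ^ j. x ^ j * \<beta> l))
      \<le> x * D * ((\<Sum>l\<in>L. (?w l powr r / (1 - y)) * \<beta> l) + (\<Sum>l\<in>L. (?w l powr r * x / (x - 1)) * \<beta> l))"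
    proof (intro mult_left_mono add_mono sum_mono)
      fix l
      have "(\<Sum>j | j < J \<and> ?w l \<le> 4 ^ j. y ^ j) \<le> ?w l powr (r - n) / (1 - y)"
        by (rule geometric_above) (use y r freq_weight_pos[of l] in \<open>auto simp: yj intro!: powr_mono2'\<close>)
      hence "(\<Sum>j | j < J \<and> ?w l \<le> 4 ^ j. y ^ j) * ?w l ^ n \<le> ?w l powr (r - n) / (1 - y) * ?w l ^ n"
        using freq_weight_pos[of l] by (intro mult_right_mono) auto
      also have "\<dots> = ?w l powr r / (1 - y)"
        using freq_weight_pos[of l] by (simp add: powr_diff powr_realpow)
      finally have "(\<Sum>j | j < J \<and> ?w l \<le> 4 ^ j. y ^ j) * ?w l ^ n * \<beta> l \<le> ?w l powr r / (1 - y) * \<beta> l"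
        by (rule mult_right_mono) (rule \<beta>)
      thus "(\<Sum>j | j < J \<and> ?w l \<le> 4 ^ j. y ^ j * (?w l ^ n * \<beta> l)) \<le> (?w l powr r / (1 - y)) * \<beta> l"
        by (simp only: sum_distrib_right mult.assoc)
      have "(\<Sum>j | j < J \<and> \<not> ?w l \<le> 4 ^ j. x ^ j) \<le> ?w l powr r * x / (x - 1)"
        by (rule geometric_below) (use x r in \<open>auto simp: xj intro!: powr_mono2\<close>)
      hence "(\<Sum>j | j < J \<and> \<not> ?w l \<le> 4 ^ j. x ^ j) * \<beta> l \<le> (?w l powr r * x / (x - 1)) * \<beta> l"
        by (rule mult_right_mono) (rule \<beta>)
      thus "(\<Sum>j | j < J \<and> \<not> ?w l \<le> 4 ^ j. x ^ j * \<beta> l) \<le> (?w l powr r * x / (x - 1)) * \<beta> l"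
        by (simp only: sum_distrib_right)
    qed (use x D in auto)
    also have "\<dots> = dyadic_const r n * D * (\<Sum>l\<in>L. ?w l powr r * \<beta> l)"
    proof -
      have "(\<Sum>l\<in>L. (?w l powr r / (1 - y)) * \<beta> l) = 1 / (1 - y) * (\<Sum>l\<in>L. ?w l powr r * \<beta> l)"
        by (simp add: sum_divide_distrib)
      moreover have "(\<Sum>l\<in>L. (?w l powr r * x / (x - 1)) * \<beta> l) = x / (x - 1) * (\<Sum>l\<in>L. ?w l powr r * \<beta> l)"
        unfolding sum_distrib_left by (intro sum.cong refl) simp
      moreover have "x * D * (a * S + b * S) = x * (a + b) * D * S" for a b S :: real
        by (simp add: algebra_simps)
      ultimately show ?thesis by (simp only: c_def)
    qed
    finally show ?thesis .
qed

lemma trig_sum_split: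
  assumes "finite L"
  shows "trig_sum L c = (\<lambda>x. trig_sum {l \<in> L. P l} c x + trig_sum {l \<in> L. \<not> P l} c x)"
proof
  fix x
  have "L = {l \<in> L. P l} \<union> {l \<in> L. \<not> P l}" by auto
  thus "trig_sum L c x = trig_sum {l \<in> L. P l} c x + trig_sum {l \<in> L. \<not> P l} c x"
    unfolding trig_sum_def using assms by (subst sum.union_disjoint[symmetric]) auto
qed

text \<open>
  Cutting the trigonometric sum at weight \<open>Q\<close> and using each endpoint bound on its part verifies the
  hypothesis of \<open>dyadic_interpolation\<close>. For the low part, the weight \<open>Q\<close> of the frequencies considered in the
  image supplies the factor \<open>1 / Q ^ (m + 1)\<close>.
\<close>

lemma pull_coeff_trig_sum_bound:
  fixes r :: real
  assumes m: "m \<ge> 1" and r: "0 < r" "r < real (Suc m)" and A: "A \<ge> 0"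
  obtains C where "C \<ge> 0"
    "\<And>p \<phi> L c K. \<lbrakk>sob_ball m A p; circle_map \<phi> (\<lambda>x. exp (p x)); finite L; finite K\<rbrakk> \<Longrightarrow>
      (\<Sum>k\<in>K. freq_weight k powr r * (cmod (pull_coeff \<phi> (\<lambda>x. exp (p x)) (trig_sum L c) k))\<^sup>2)
        \<le> C * (\<Sum>k\<in>L. freq_weight k powr r * (cmod (c k))\<^sup>2)"
proof -
  obtain D where D: "D \<ge> 0"
    and low: "\<And>p \<phi> L c K. \<lbrakk>sob_ball m A p; circle_map \<phi> (\<lambda>x. exp (p x)); finite L; finite K\<rbrakk> \<Longrightarrow>
      (\<Sum>k\<in>K. (cmod (pull_coeff \<phi> (\<lambda>x. exp (p x)) (trig_sum L c) k))\<^sup>2) \<le> D * (\<Sum>k\<in>L. (cmod (c k))\<^sup>2)"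
    and high: "\<And>p \<phi> L c K. \<lbrakk>sob_ball m A p; circle_map \<phi> (\<lambda>x. exp (p x)); finite L; finite K\<rbrakk> \<Longrightarrow>
      (\<Sum>k\<in>K. freq_weight k ^ Suc m * (cmod (pull_coeff \<phi> (\<lambda>x. exp (p x)) (trig_sum L c) k))\<^sup>2)
        \<le> D * (\<Sum>k\<in>L. freq_weight k ^ Suc m * (cmod (c k))\<^sup>2)"
  proof -
    show ?thesis by (rule pull_coeff_endpoint_bounds[OF m A]) (rule that)
  qed
  show ?thesis
  proof (rule that[of "dyadic_const r (Suc m) * (2 * D)"])
    fix p \<phi> :: "real \<Rightarrow> real" and L K :: "int set" and c
    assume p: "sob_ball m A p" "circle_map \<phi> (\<lambda>x. exp (p x))" and fin: "finite L" "finite (K :: int set)"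
    let ?T = "\<lambda>L k. pull_coeff \<phi> (\<lambda>x. exp (p x)) (trig_sum L c) k"
    show "(\<Sum>k\<in>K. freq_weight k powr r * (cmod (?T L k))\<^sup>2) \<le> dyadic_const r (Suc m) * (2 * D) * (\<Sum>k\<in>L. freq_weight k powr r * (cmod (c k))\<^sup>2)"
    proof (rule dyadic_interpolation[OF r fin(2,1)])
      fix Q :: real assume Q: "Q \<ge> 1"
      let ?K = "{k. k \<in> K \<and> Q \<le> freq_weight k}"
      let ?L1 = "{l \<in> L. freq_weight l \<le> Q}" and ?L2 = "{l \<in> L. \<not> freq_weight l \<le> Q}"
      have T: "?T L k = ?T ?L1 k + ?T ?L2 k" for k
        unfolding trig_sum_split[OF fin(1), of c "\<lambda>l. freq_weight l \<le> Q"]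
        by (rule pull_coeff_add[OF p(2)]) (rule trig_sum_continuous)+
      have sq: "(cmod (?T L k))\<^sup>2 \<le> 2 * (cmod (?T ?L1 k))\<^sup>2 + 2 * (cmod (?T ?L2 k))\<^sup>2" for k
        unfolding T by (rule norm_add_power2_le)
      have 1: "(\<Sum>k\<in>?K. (cmod (?T ?L1 k))\<^sup>2) \<le> D * (\<Sum>l\<in>?L1. freq_weight l ^ Suc m * (cmod (c l))\<^sup>2) / Q ^ Suc m"
      proof -
        have "(\<Sum>k\<in>?K. (cmod (?T ?L1 k))\<^sup>2) * Q ^ Suc m \<le> (\<Sum>k\<in>?K. freq_weight k ^ Suc m * (cmod (?T ?L1 k))\<^sup>2)"
          unfolding sum_distrib_right
        proof (rule sum_mono)
          fix k assume "k \<in> ?K"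
          hence "Q ^ Suc m \<le> freq_weight k ^ Suc m" using Q by (intro power_mono) auto
          from mult_right_mono[OF this, of "(cmod (?T ?L1 k))\<^sup>2"]
          show "(cmod (?T ?L1 k))\<^sup>2 * Q ^ Suc m \<le> freq_weight k ^ Suc m * (cmod (?T ?L1 k))\<^sup>2"
            by (simp add: mult.commute)
        qed
        also have "\<dots> \<le> D * (\<Sum>l\<in>?L1. freq_weight l ^ Suc m * (cmod (c l))\<^sup>2)"
          by (rule high[OF p]) (use fin in auto)
        finally show ?thesis using Q by (simp add: pos_le_divide_eq del: power_Suc)
      qed
      have 2: "(\<Sum>k\<in>?K. (cmod (?T ?L2 k))\<^sup>2) \<le> D * (\<Sum>l\<in>?L2. (cmod (c l))\<^sup>2)"
        by (rule low[OF p]) (use fin in auto)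
      have "(\<Sum>k\<in>?K. (cmod (?T L k))\<^sup>2) \<le> (\<Sum>k\<in>?K. 2 * (cmod (?T ?L1 k))\<^sup>2 + 2 * (cmod (?T ?L2 k))\<^sup>2)"
        by (rule sum_mono) (rule sq)
      also have "\<dots> = 2 * (\<Sum>k\<in>?K. (cmod (?T ?L1 k))\<^sup>2) + 2 * (\<Sum>k\<in>?K. (cmod (?T ?L2 k))\<^sup>2)"
        by (simp only: sum.distrib sum_distrib_left)
      also have "\<dots> \<le> 2 * (D * (\<Sum>l\<in>?L1. freq_weight l ^ Suc m * (cmod (c l))\<^sup>2) / Q ^ Suc m) + 2 * (D * (\<Sum>l\<in>?L2. (cmod (c l))\<^sup>2))"
        using 1 2 by simp
      also have "\<dots> = 2 * D * ((\<Sum>l\<in>?L1. freq_weight l ^ Suc m * (cmod (c l))\<^sup>2) / Q ^ Suc m + (\<Sum>l\<in>?L2. (cmod (c l))\<^sup>2))"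
        by (simp only: distrib_left mult.assoc times_divide_eq_right)
      finally show "(\<Sum>k\<in>?K. (cmod (?T L k))\<^sup>2) \<le> \<dots>" .
    qed (use D in auto)
  qed (use dyadic_const_nonneg[OF r] D in simp)
qed

section \<open>Composition with a circle map in fractional Sobolev spaces\<close>

lemma x_antideriv_0: "x_antideriv f 0 = 0"
  by (simp add: x_antideriv_def)

lemma x_antideriv_derivative:
  assumes "continuous_on UNIV f"
  shows "(x_antideriv f has_real_derivative f x) (at x)"
proof -
  define a where "a = min 0 x - 1"
  define b where "b = max 0 x + 1"
  have "((\<lambda>u. LBINT y=ereal 0..ereal u. f y) has_vector_derivative f x) (at x within {a..b})"
    by (rule interval_integral_FTC2) (auto simp: a_def b_def intro: continuous_on_subset[OF assms])
  hence "((\<lambda>u. LBINT y=ereal 0..ereal u. f y) has_vector_derivative f x) (at x)"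
    by (subst (asm) at_within_interior) (auto simp: a_def b_def)
  thus ?thesis
    by (simp add: x_antideriv_def[abs_def] has_real_derivative_iff_has_vector_derivative)
qed

lemma x_antideriv_period:
  assumes cont: "continuous_on UNIV f" and per: "\<And>x. f (x + 1) = f x"
  shows "x_antideriv f (x + 1) = x_antideriv f x + integral {0..1} f"
proof -
  have "\<forall>x. ((\<lambda>x. x_antideriv f (x + 1) - x_antideriv f x) has_real_derivative 0) (at x)"
  proof
    fix x
    have "((\<lambda>x. x_antideriv f (x + 1)) has_real_derivative f x) (at x)"
      using DERIV_shift[of "x_antideriv f" "f x" x 1] x_antideriv_derivative[OF cont, of "x + 1"] per by simp
    from DERIV_diff[OF this x_antideriv_derivative[OF cont]]
    show "((\<lambda>x. x_antideriv f (x + 1) - x_antideriv f x) has_real_derivative 0) (at x)" by simp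
  qed
  from DERIV_isconst_all[OF this, of x 0]
  have "x_antideriv f (x + 1) - x_antideriv f x = x_antideriv f 1" by (simp add: x_antideriv_0)
  moreover have "(f has_integral (x_antideriv f 1 - x_antideriv f 0)) {0..1}"
    by (rule fundamental_theorem_real) (auto intro: x_antideriv_derivative[OF cont])
  ultimately show ?thesis by (simp add: x_antideriv_0 integral_unique)
qed

lemma circle_map_substitution:
  assumes \<phi>: "circle_map \<phi> J" and cont: "continuous_on UNIV f" and per: "\<And>x. f (x + 1) = f x"
  shows "integral {0..1} (\<lambda>x. f (\<phi> x) * J x) = integral {0..1} f"
proof -
  have d\<phi>: "(\<phi> has_real_derivative J x) (at x)" for x using \<phi> by (simp add: circle_map_def)
  have "((\<lambda>x. f (\<phi> x) * J x) has_integral (x_antideriv f (\<phi> 1) - x_antideriv f (\<phi> 0))) {0..1}"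
    by (rule fundamental_theorem_real[where F = "\<lambda>x. x_antideriv f (\<phi> x)"])
       (auto intro: DERIV_chain2[OF x_antideriv_derivative[OF cont] d\<phi>])
  thus ?thesis by (simp add: circle_map_one[OF \<phi>] x_antideriv_period[OF cont per] integral_unique)
qed

text \<open>
  Substitution is applied to real integrands, so real and imaginary parts are treated separately
  through an arbitrary real-linear functional \<open>h\<close>.
\<close>

lemma pull_coeff_compose:
  assumes \<phi>: "circle_map \<phi> J" and cont: "continuous_on UNIV f" and per: "\<And>x. f (x + 1) = f x"
    and g: "\<And>x. g x = f (\<phi> x)"
  shows "pull_coeff \<phi> J g k = fourier_coeff f k"
proof -
  let ?e = "\<lambda>y. cis (- (freq k * y))"
  note cf = continuous_on_subset[OF cont subset_UNIV]
  have cg: "continuous_on UNIV g"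
    unfolding g by (rule continuous_on_compose2[OF cont circle_map_continuous[OF \<phi>]]) auto
  have e: "?e (y + 1) = ?e y" for y using cis_2pi_periodic[of "- k" y] by simp
  have "h (pull_coeff \<phi> J g k) = h (fourier_coeff f k)" if h: "bounded_linear h" for h :: "complex \<Rightarrow> real"
  proof -
    have ch: "continuous_on UNIV (\<lambda>y. h (complex_of_real (f y) * ?e y))"
      by (intro bounded_linear.continuous_on[OF h] continuous_intros cf)
    have "h (pull_coeff \<phi> J g k) = integral {0..1} (\<lambda>x. h (complex_of_real (g x * J x) * ?e (\<phi> x)))"
      unfolding pull_coeff_def
      by (rule integral_linear[unfolded o_def, OF pull_coeff_integrable[OF \<phi> cg] h, symmetric])
    also have "(\<lambda>x. h (complex_of_real (g x * J x) * ?e (\<phi> x))) = (\<lambda>x. h (complex_of_real (f (\<phi> x)) * ?e (\<phi> x)) * J x)"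
    proof
      fix x
      have "complex_of_real (g x * J x) * ?e (\<phi> x) = J x *\<^sub>R (complex_of_real (f (\<phi> x)) * ?e (\<phi> x))"
        by (simp add: g scaleR_conv_of_real mult_ac)
      thus "h (complex_of_real (g x * J x) * ?e (\<phi> x)) = h (complex_of_real (f (\<phi> x)) * ?e (\<phi> x)) * J x"
        by (simp only: linear_simps(5)[OF h]) simp
    qed
    also have "integral {0..1} \<dots> = integral {0..1} (\<lambda>y. h (complex_of_real (f y) * ?e y))"
      by (rule circle_map_substitution[OF \<phi> ch]) (simp only: per e)
    also have "\<dots> = h (pull_coeff (\<lambda>x. x) (\<lambda>_. 1) f k)"
      unfolding pull_coeff_def
      by (subst integral_linear[unfolded o_def, OF _ h, symmetric])
         (use pull_coeff_integrable[OF circle_map_id cont, of k] in simp_all)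
    finally show ?thesis by (simp add: fourier_coeff_eq_pull[OF cont])
  qed
  from this[OF bounded_linear_Re] this[OF bounded_linear_Im] show ?thesis
    by (simp add: complex_eq_iff)
qed

lemma uniform_limit_antiderivative:
  fixes F :: "nat \<Rightarrow> real \<Rightarrow> real"
  assumes J: "uniform_limit {0..1} Jn J sequentially"
    and F: "\<And>n x. (F n has_real_derivative Jn n x) (at x)" "\<And>x. (G has_real_derivative J x) (at x)"
    and 0: "\<And>n. F n 0 = G 0"
  shows "uniform_limit {0..1} F G sequentially"
proof (rule uniform_limitI)
  fix e :: real assume e: "e > 0"
  hence "e / 2 > 0" by simp
  from uniform_limitD[OF J this]
  show "\<forall>\<^sub>F n in sequentially. \<forall>x\<in>{0..1}. dist (F n x) (G x) < e"
  proof eventually_elim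
    case (elim n)
    show ?case
    proof
      fix x :: real assume x: "x \<in> {0..1}"
      have "norm ((\<lambda>x. F n x - G x) x - (\<lambda>x. F n x - G x) 0) \<le> e / 2 * norm (x - 0)"
      proof (rule field_differentiable_bound)
        fix z :: real assume "z \<in> {0..1}"
        show "((\<lambda>x. F n x - G x) has_field_derivative (Jn n z - J z)) (at z within {0..1})"
          by (rule has_field_derivative_at_within[OF DERIV_diff[OF F(1) F(2)]])
        show "norm (Jn n z - J z) \<le> e / 2"
          using bspec[OF elim \<open>z \<in> {0..1}\<close>] by (simp add: dist_norm)
      qed (use x in auto)
      also have "\<dots> \<le> e / 2 * 1" using x e by (intro mult_left_mono) auto
      finally show "dist (F n x) (G x) < e" using e 0[of n] by (simp add: dist_norm)
    qed
  qed
qed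

lemma uniform_limit_exp_bounded:
  fixes p :: "nat \<Rightarrow> real \<Rightarrow> real"
  assumes "uniform_limit A p q sequentially" "\<And>n x. x \<in> A \<Longrightarrow> \<bar>p n x\<bar> \<le> B"
  shows "uniform_limit A (\<lambda>n x. exp (p n x)) (\<lambda>x. exp (q x)) sequentially"
proof (rule uniform_limit_compose_uniformly_continuous_on[OF assms(1)])
  show "uniformly_continuous_on {-B..B} (exp :: real \<Rightarrow> real)"
    by (intro compact_uniformly_continuous continuous_intros) auto
  show "\<forall>\<^sub>F n in sequentially. \<forall>y\<in>A. p n y \<in> {- B..B}"
    using assms(2) by (auto intro!: always_eventually simp: abs_le_iff minus_le_iff)
qed auto

lemma trig_sum_csobolev_sob_ball:
  assumes p: "p \<in> csobolev r" "real m \<le> r" "sobolev_norm r p \<le> M" and K: "finite K"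
  shows "sob_ball m M (trig_sum K (fourier_coeff p))"
proof (rule trig_sum_sob_ball[OF K])
  have "(\<Sum>k\<in>K. freq_weight k ^ m * (cmod (fourier_coeff p k))\<^sup>2) \<le> (\<Sum>k\<in>K. sobolev_term r p k)"
  proof (rule sum_mono)
    fix k
    have "freq_weight k ^ m = freq_weight k powr real m"
      using freq_weight_pos[of k] by (simp add: powr_realpow)
    also have "\<dots> \<le> freq_weight k powr r"
      using p(2) freq_weight_ge_1 by (intro powr_mono)
    finally show "freq_weight k ^ m * (cmod (fourier_coeff p k))\<^sup>2 \<le> sobolev_term r p k"
      unfolding sobolev_term_eq by (intro mult_right_mono) auto
  qed
  also have "\<dots> \<le> (sobolev_norm r p)\<^sup>2" by (rule sobolev_sum_le_norm[OF p(1) K])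
  also have "\<dots> \<le> M\<^sup>2" using p(3) sobolev_norm_nonneg by (intro power_mono)
  finally show "(\<Sum>k\<in>K. freq_weight k ^ m * (cmod (fourier_coeff p k))\<^sup>2) \<le> M\<^sup>2" .
qed

text \<open>
  A circle map with \<open>ln \<phi>' = p\<close> in \<open>H\<^sup>r\<close> is a limit of maps with smooth logarithmic derivative, with uniform
  control in \<open>H\<^sup>m\<close>. This circumvents weak derivatives: \<open>p\<close> itself need not have \<open>m\<close> classical derivatives,
  whereas the truncations of its Fourier series have derivatives of every order.
\<close>

lemma smooth_circle_approximation:
  assumes p: "p \<in> csobolev r" "r \<ge> 1" "real m \<le> r" "m \<ge> 1" "sobolev_norm r p \<le> M"
    and \<phi>: "circle_map \<phi> (\<lambda>x. exp (p x))"
  obtains q \<psi> where "\<And>n. sob_ball m (6 * M) (q n)" "\<And>n. circle_map (\<psi> n) (\<lambda>x. exp (q n x))"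
    "uniform_limit {0..1} (\<lambda>n x. exp (q n x)) (\<lambda>x. exp (p x)) sequentially"
    "uniform_limit {0..1} \<psi> \<phi> sequentially"
proof -
  have M: "M \<ge> 0" using p(5) sobolev_norm_nonneg[of r p] by linarith
  define P where "P = (\<lambda>n. trig_sum {- int n..int n} (fourier_coeff p))"
  define Z where "Z = (\<lambda>n. integral {0..1} (\<lambda>x. exp (P n x)))"
  \<comment> \<open>normalised to mean one of \<open>exp q\<close>; as \<open>\<bar>ln Z\<bar> \<le> 2 M\<close>, \<open>sob_ball_add\<close> gives the radius \<open>2 (M + 2 M) = 6 M\<close>\<close>
  define q where "q = (\<lambda>n x. P n x + (- ln (Z n)))"
  define \<psi> where "\<psi> = (\<lambda>n x. \<phi> 0 + x_antideriv (\<lambda>x. exp (q n x)) x)"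
  obtain m' where m': "m = Suc m'" using p(4) by (cases m) auto
  have Pb: "sob_ball m M (P n)" for n
    unfolding P_def by (rule trig_sum_csobolev_sob_ball[OF p(1,3,5)]) simp
  have Ps: "\<bar>P n x\<bar> \<le> 2 * M" for n x using sob_ball_sup[of m' M "P n"] Pb M unfolding m' by simp
  have cP: "continuous_on S (P n)" for S n by (rule sob_ball_continuous[OF Pb])
  have Z1: "exp (- (2 * M)) \<le> Z n" "Z n \<le> exp (2 * M)" for n
  proof -
    have P: "- (2 * M) \<le> P n x" "P n x \<le> 2 * M" for x using Ps[of n x] by linarith+
    have "integral {0..1::real} (\<lambda>x. exp (- (2 * M))) \<le> Z n"
      unfolding Z_def by (rule integral_le) (auto intro!: integrable_continuous_real continuous_intros cP P)
    moreover have "Z n \<le> integral {0..1::real} (\<lambda>x. exp (2 * M))"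
      unfolding Z_def by (rule integral_le) (auto intro!: integrable_continuous_real continuous_intros cP P)
    ultimately show "exp (- (2 * M)) \<le> Z n" "Z n \<le> exp (2 * M)" by auto
  qed
  have Z0: "Z n > 0" for n using Z1(1)[of n] exp_gt_zero[of "- (2 * M)"] by linarith
  have lnZ: "\<bar>ln (Z n)\<bar> \<le> 2 * M" for n
  proof -
    have "ln (exp (- (2 * M))) \<le> ln (Z n)" using Z1[of n] Z0[of n] by (subst ln_le_cancel_iff) auto
    moreover have "ln (Z n) \<le> ln (exp (2 * M))" using Z1[of n] Z0[of n] by (subst ln_le_cancel_iff) auto
    ultimately show ?thesis by simp
  qed
  have qb: "sob_ball m (6 * M) (q n)" for n
    unfolding q_def
    by (rule sob_ball_mono[OF sob_ball_add[OF Pb sob_ball_const]]) (use M lnZ[of n] in auto)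
  have cq: "continuous_on S (\<lambda>x. exp (q n x))" for S n
    by (intro continuous_intros sob_ball_continuous[OF qb])
  have qper: "exp (q n (x + 1)) = exp (q n x)" for n x by (simp only: sob_ball_periodic[OF qb])
  have qint: "integral {0..1} (\<lambda>x. exp (q n x)) = 1" for n
  proof -
    have "integral {0..1} (\<lambda>x. exp (q n x)) = integral {0..1} (\<lambda>x. exp (P n x) / Z n)"
      using Z0[of n] by (simp add: q_def exp_diff)
    also have "\<dots> = 1" using Z0[of n] by (simp add: Z_def)
    finally show ?thesis .
  qed
  have \<psi>: "circle_map (\<psi> n) (\<lambda>x. exp (q n x))" for n
    unfolding circle_map_def \<psi>_def
    by (auto intro!: derivative_eq_intros x_antideriv_derivative cq
        simp: x_antideriv_period[OF cq qper] qint)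
  have u1: "uniform_limit {0..1} P p sequentially"
    unfolding P_def by (rule fourier_partial_sums_uniform_limit[OF p(1,2)])
  have u2: "uniform_limit {0..1} (\<lambda>n x. exp (P n x)) (\<lambda>x. exp (p x)) sequentially"
    by (rule uniform_limit_exp_bounded[OF u1]) (rule Ps)
  have "Z \<longlonglongrightarrow> integral {0..1} (\<lambda>x. exp (p x))"
  proof -
    obtain I L where "\<And>n. ((\<lambda>x. exp (P n x)) has_integral I n) {0..1}"
     "((\<lambda>x. exp (p x)) has_integral L) {0..1}" "I \<longlonglongrightarrow> L"
      by (rule uniform_limit_integral[OF u2]) (intro continuous_intros cP, auto)
    thus ?thesis unfolding Z_def by (metis (mono_tags, lifting) integral_unique tendsto_cong always_eventually)
  qed
  moreover have "integral {0..1} (\<lambda>x. exp (p x)) = 1"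
    using circle_map_substitution[OF \<phi>, of "\<lambda>_. 1"] by simp
  ultimately have "(\<lambda>n. - ln (Z n)) \<longlonglongrightarrow> - ln 1"
    by (intro tendsto_minus tendsto_ln) auto
  hence "uniform_limit {0..1} (\<lambda>n x. - ln (Z n)) (\<lambda>x. - ln 1) sequentially"
    using tendstoD by (intro uniform_limitI) force
  hence u3: "uniform_limit {0..1} q p sequentially"
    unfolding q_def using uniform_limit_add[OF u1] by fastforce
  have u4: "uniform_limit {0..1} (\<lambda>n x. exp (q n x)) (\<lambda>x. exp (p x)) sequentially"
  proof (rule uniform_limit_exp_bounded[OF u3, of "4 * M"])
    fix n x show "\<bar>q n x\<bar> \<le> 4 * M" using Ps[of n x] lnZ[of n] by (simp add: q_def)
  qed
  have u5: "uniform_limit {0..1} \<psi> \<phi> sequentially"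
    by (rule uniform_limit_antiderivative[OF u4])
       (use \<psi> \<phi> in \<open>auto simp: circle_map_def\<close>, simp add: \<psi>_def x_antideriv_0)
  show ?thesis by (rule that[OF qb \<psi> u4 u5])
qed

text \<open>
  Composition with a circle map is bounded on \<open>H\<^sup>r\<close>, in the direction from \<open>f \<circ> \<phi>\<close> to \<open>f\<close>. For the partial sums
  of \<open>g\<close> and the smoothed maps this is the interpolated estimate. It survives the limit because it is a bound
  for finite sums of coefficients, each of which converges.
\<close>

theorem csobolev_compose_bound:
  assumes r: "r \<ge> 1" and M: "M \<ge> 0"
  obtains C where "C \<ge> 0"
    "\<And>p g f \<phi>. \<lbrakk>p \<in> csobolev r; g \<in> csobolev r; sobolev_norm r p \<le> M; sobolev_norm r g \<le> M;
       circle_map \<phi> (\<lambda>x. exp (p x)); continuous_on UNIV f; \<forall>x. f (x + 1) = f x; \<forall>x. f (\<phi> x) = g x\<rbrakk>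
      \<Longrightarrow> f \<in> csobolev r \<and> (sobolev_norm r f)\<^sup>2 \<le> C"
proof -
  define m where "m = nat \<lfloor>r\<rfloor>"
  have m: "m \<ge> 1" "real m \<le> r" "r < real (Suc m)" "0 < r" using r by (auto simp: m_def le_nat_iff le_floor_iff) linarith+
  obtain D where D: "D \<ge> 0" and bound:
    "\<And>p \<phi> L c K. \<lbrakk>sob_ball m (6 * M) p; circle_map \<phi> (\<lambda>x. exp (p x)); finite L; finite K\<rbrakk> \<Longrightarrow>
      (\<Sum>k\<in>K. freq_weight k powr r * (cmod (pull_coeff \<phi> (\<lambda>x. exp (p x)) (trig_sum L c) k))\<^sup>2)
        \<le> D * (\<Sum>k\<in>L. freq_weight k powr r * (cmod (c k))\<^sup>2)"
  proof -
    have "6 * M \<ge> 0" using M by simp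
    thus ?thesis by (rule pull_coeff_trig_sum_bound[OF m(1) m(4) m(3)]) (rule that)
  qed
  show ?thesis
  proof (rule that[of "D * M\<^sup>2"])
    fix p g f \<phi>
    assume p: "p \<in> csobolev r" "sobolev_norm r p \<le> M" and g: "g \<in> csobolev r" "sobolev_norm r g \<le> M"
      and \<phi>: "circle_map \<phi> (\<lambda>x. exp (p x))"
      and f': "continuous_on UNIV f" "\<forall>x. f (x + 1) = f x" "\<forall>x. f (\<phi> x) = g x"
    have f: "continuous_on UNIV f" "\<And>x. f (x + 1) = f x" "\<And>x. f (\<phi> x) = g x" using f' by auto
    obtain q \<psi> where q: "\<And>n. sob_ball m (6 * M) (q n)" and \<psi>: "\<And>n. circle_map (\<psi> n) (\<lambda>x. exp (q n x))"
      and uq: "uniform_limit {0..1} (\<lambda>n x. exp (q n x)) (\<lambda>x. exp (p x)) sequentially"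
      and u\<psi>: "uniform_limit {0..1} \<psi> \<phi> sequentially"
    proof -
      show ?thesis by (rule smooth_circle_approximation[OF p(1) r m(2,1) p(2) \<phi>]) (rule that)
    qed
    define G where "G = (\<lambda>n. trig_sum {- int n..int n} (fourier_coeff g))"
    have ug: "uniform_limit {0..1} G g sequentially"
      unfolding G_def by (rule fourier_partial_sums_uniform_limit[OF g(1) r])
    have lim: "(\<lambda>n. pull_coeff (\<psi> n) (\<lambda>x. exp (q n x)) (G n) k) \<longlonglongrightarrow> fourier_coeff f k" for k
    proof -
      have "(\<lambda>n. pull_coeff (\<psi> n) (\<lambda>x. exp (q n x)) (G n) k) \<longlonglongrightarrow> pull_coeff \<phi> (\<lambda>x. exp (p x)) g k"
        by (rule pull_coeff_limit[OF ug uq u\<psi>])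
           (auto simp: G_def trig_sum_continuous intro: circle_map_continuous[OF \<psi>] circle_map_continuous_deriv[OF \<psi>])
      thus ?thesis using pull_coeff_compose[OF \<phi> f(1,2), of g k] f(3) by simp
    qed
    have "(\<Sum>k\<in>K. sobolev_term r f k) \<le> D * M\<^sup>2" if K: "finite K" for K
    proof (rule LIMSEQ_le_const2)
      show "(\<lambda>n. \<Sum>k\<in>K. freq_weight k powr r * (cmod (pull_coeff (\<psi> n) (\<lambda>x. exp (q n x)) (G n) k))\<^sup>2)
         \<longlonglongrightarrow> (\<Sum>k\<in>K. sobolev_term r f k)"
        unfolding sobolev_term_eq by (intro tendsto_intros lim)
      have "(\<Sum>k\<in>K. freq_weight k powr r * (cmod (pull_coeff (\<psi> n) (\<lambda>x. exp (q n x)) (G n) k))\<^sup>2) \<le> D * M\<^sup>2" for n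
      proof -
        have "(\<Sum>k\<in>K. freq_weight k powr r * (cmod (pull_coeff (\<psi> n) (\<lambda>x. exp (q n x)) (G n) k))\<^sup>2)
          \<le> D * (\<Sum>k\<in>{- int n..int n}. sobolev_term r g k)"
          unfolding G_def sobolev_term_eq by (rule bound[OF q \<psi> _ K]) simp
        also have "\<dots> \<le> D * (sobolev_norm r g)\<^sup>2"
          by (intro mult_left_mono sobolev_sum_le_norm g D) simp
        also have "\<dots> \<le> D * M\<^sup>2"
          by (intro mult_left_mono power_mono g D sobolev_norm_nonneg)
        finally show ?thesis .
      qed
      thus "\<exists>N. \<forall>n\<ge>N. (\<Sum>k\<in>K. freq_weight k powr r * (cmod (pull_coeff (\<psi> n) (\<lambda>x. exp (q n x)) (G n) k))\<^sup>2) \<le> D * M\<^sup>2"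
        by blast
    qed
    from csobolevI[OF f(1,2) this]
    show "f \<in> csobolev r \<and> (sobolev_norm r f)\<^sup>2 \<le> D * M\<^sup>2" by blast
  qed (use D in auto)
qed

section \<open>Squares in fractional Sobolev spaces\<close>

lemma freq_weight_peetre: "freq_weight k \<le> 2 * (freq_weight l + freq_weight (k - l))"
proof -
  have "(freq k)\<^sup>2 \<le> 2 * ((freq l)\<^sup>2 + (freq (k - l))\<^sup>2)"
    using sum_squares_bound[of "freq l" "freq (k - l)"]
    by (simp add: power2_eq_square algebra_simps)
  thus ?thesis by (simp add: freq_weight_def)
qed

text \<open>
  A frequency \<open>k = l + (k - l)\<close> of a product is comparable to the larger of the two frequencies that
  produce it, so derivatives of a product fall on one factor.
\<close>

lemma freq_weight_powr_peetre:
  assumes "r \<ge> 0"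
  shows "freq_weight k powr (r / 2) \<le> 4 powr (r / 2) * (freq_weight l powr (r / 2) + freq_weight (k - l) powr (r / 2))"
proof -
  let ?w = "max (freq_weight l) (freq_weight (k - l))"
  have "freq_weight k powr (r / 2) \<le> (4 * ?w) powr (r / 2)"
    using freq_weight_peetre[of k l] freq_weight_pos[of k] assms by (intro powr_mono2) auto
  also have "\<dots> = 4 powr (r / 2) * ?w powr (r / 2)"
    by (rule powr_mult)
  also have "?w powr (r / 2) \<le> freq_weight l powr (r / 2) + freq_weight (k - l) powr (r / 2)"
    by (simp add: max_def)
  finally show ?thesis by simp
qed

text \<open>
  Young's inequality for the convolution of a summable with a square-summable sequence, stated for
  finite sums and with either of the two sequences shifted.
\<close>

lemma young_weighted:
  fixes a b :: "int \<Rightarrow> real"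
  assumes fin: "finite K" "finite L" and pos: "\<And>k. a k \<ge> 0"
    and a: "\<And>K. finite K \<Longrightarrow> sum a K \<le> S" and b: "\<And>K. finite K \<Longrightarrow> (\<Sum>k\<in>K. (b k)\<^sup>2) \<le> B"
    and S: "S \<ge> 0"
  shows "(\<Sum>k\<in>K. (\<Sum>l\<in>L. a l * b (k - l))\<^sup>2) \<le> S\<^sup>2 * B"
    and "(\<Sum>k\<in>K. (\<Sum>l\<in>L. b l * a (k - l))\<^sup>2) \<le> S\<^sup>2 * B"
proof -
  have CS: "(\<Sum>l\<in>L. x l * y l)\<^sup>2 \<le> (\<Sum>l\<in>L. x l) * (\<Sum>l\<in>L. x l * (y l)\<^sup>2)" if "\<And>l. x l \<ge> 0" for x y :: "int \<Rightarrow> real"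
  proof -
    have "(\<Sum>l\<in>L. x l * y l) = (\<Sum>l\<in>L. sqrt (x l) * (sqrt (x l) * y l))"
      using that by (simp add: mult.assoc[symmetric])
    hence "(\<Sum>l\<in>L. x l * y l)\<^sup>2 \<le> (\<Sum>l\<in>L. (sqrt (x l))\<^sup>2) * (\<Sum>l\<in>L. (sqrt (x l) * y l)\<^sup>2)"
      by (simp only: Cauchy_Schwarz_ineq_sum)
    thus ?thesis using that by (simp add: power_mult_distrib)
  qed
  have shift1: "(\<Sum>k\<in>K. (b (k - l))\<^sup>2) \<le> B" for l
  proof -
    have "(\<Sum>k\<in>K. (b (k - l))\<^sup>2) = (\<Sum>k\<in>(\<lambda>k. k - l) ` K. (b k)\<^sup>2)"
      by (subst sum.reindex) (auto simp: inj_on_def)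
    thus ?thesis using b[of "(\<lambda>k. k - l) ` K"] fin by simp
  qed
  have shift2: "(\<Sum>k\<in>K. a (k - l)) \<le> S" for l
  proof -
    have "(\<Sum>k\<in>K. a (k - l)) = (\<Sum>k\<in>(\<lambda>k. k - l) ` K. a k)"
      by (subst sum.reindex) (auto simp: inj_on_def)
    thus ?thesis using a[of "(\<lambda>k. k - l) ` K"] fin by simp
  qed
  have shift3: "(\<Sum>l\<in>L. a (k - l)) \<le> S" for k
  proof -
    have "(\<Sum>l\<in>L. a (k - l)) = (\<Sum>l\<in>(\<lambda>l. k - l) ` L. a l)"
      by (subst sum.reindex) (auto simp: inj_on_def)
    thus ?thesis using a[of "(\<lambda>l. k - l) ` L"] fin by simp
  qed
  have B: "B \<ge> 0" using b[of "{}"] by simp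
  have "(\<Sum>k\<in>K. (\<Sum>l\<in>L. a l * b (k - l))\<^sup>2) \<le> (\<Sum>k\<in>K. S * (\<Sum>l\<in>L. a l * (b (k - l))\<^sup>2))"
    by (rule sum_mono, rule order.trans[OF CS mult_right_mono[OF a]]) (auto simp: pos fin intro!: sum_nonneg)
  also have "\<dots> = S * (\<Sum>l\<in>L. a l * (\<Sum>k\<in>K. (b (k - l))\<^sup>2))"
    unfolding sum_distrib_left by (rule sum.swap)
  also have "\<dots> \<le> S * (\<Sum>l\<in>L. a l * B)"
    by (intro mult_left_mono sum_mono shift1 pos S)
  also have "\<dots> \<le> S * (S * B)"
    unfolding sum_distrib_right[symmetric] by (intro mult_left_mono mult_right_mono a fin S B)
  finally show "(\<Sum>k\<in>K. (\<Sum>l\<in>L. a l * b (k - l))\<^sup>2) \<le> S\<^sup>2 * B" by (simp add: power2_eq_square mult.assoc)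
  have "(\<Sum>k\<in>K. (\<Sum>l\<in>L. b l * a (k - l))\<^sup>2) = (\<Sum>k\<in>K. (\<Sum>l\<in>L. a (k - l) * b l)\<^sup>2)"
    by (simp add: mult.commute)
  also have "\<dots> \<le> (\<Sum>k\<in>K. S * (\<Sum>l\<in>L. a (k - l) * (b l)\<^sup>2))"
    by (rule sum_mono, rule order.trans[OF CS mult_right_mono[OF shift3]]) (auto simp: pos fin intro!: sum_nonneg)
  also have "\<dots> = S * (\<Sum>l\<in>L. (\<Sum>k\<in>K. a (k - l)) * (b l)\<^sup>2)"
    unfolding sum_distrib_left sum_distrib_right by (rule sum.swap)
  also have "\<dots> \<le> S * (\<Sum>l\<in>L. S * (b l)\<^sup>2)"
    by (intro mult_left_mono mult_right_mono sum_mono shift2 S) auto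
  also have "\<dots> \<le> S * (S * B)"
    unfolding sum_distrib_left[symmetric] by (intro mult_left_mono b fin S)
  finally show "(\<Sum>k\<in>K. (\<Sum>l\<in>L. b l * a (k - l))\<^sup>2) \<le> S\<^sup>2 * B" by (simp add: power2_eq_square mult.assoc)
qed

text \<open>
  The coefficients of \<open>f\<^sup>2\<close> are a convolution. By \<open>freq_weight_powr_peetre\<close> the weight goes to one of the two
  factors, and Young's inequality applies since the other one is absolutely summable. Only one factor is
  truncated, which keeps the convolution sums finite.
\<close>

lemma csobolev_square:
  assumes f: "f \<in> csobolev r" and r: "r \<ge> 1"
  shows "(\<lambda>x. (f x)\<^sup>2) \<in> csobolev r"
proof -
  note cf = csobolev_continuous[OF f]
  define a where "a = (\<lambda>k. cmod (fourier_coeff f k))"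
  define b where "b = (\<lambda>k. freq_weight k powr (r / 2) * a k)"
  define S where "S = sobolev_const * sobolev_norm r f"
  define B where "B = (sobolev_norm r f)\<^sup>2"
  define H where "H = (4::real) powr (r / 2)"
  have S: "S \<ge> 0" by (simp add: S_def sobolev_const_nonneg sobolev_norm_nonneg)
  have ww: "(freq_weight k powr (r / 2))\<^sup>2 = freq_weight k powr r" for k
    using freq_weight_pos[of k] by (simp add: power2_eq_square powr_add[symmetric])
  have a: "sum a K \<le> S" if "finite K" for K
    unfolding a_def S_def by (rule sum_fourier_coeff_le[OF f r that])
  have b: "(\<Sum>k\<in>K. (b k)\<^sup>2) \<le> B" if "finite K" for K
    using sobolev_sum_le_norm[OF f that] unfolding B_def b_def a_def
    by (simp add: power_mult_distrib ww sobolev_term_eq)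
  have a0: "a k \<ge> 0" for k by (simp add: a_def)
  have a_even: "a (- k) = a k" for k by (simp add: a_def fourier_coeff_cnj[OF cf])
  define F where "F = (\<lambda>N x. trig_sum {- int N..int N} (fourier_coeff f) x * f x)"
  have cF: "continuous_on A (F N)" for A N unfolding F_def by (intro continuous_intros cf trig_sum_continuous)
  have bound: "(\<Sum>k\<in>K. sobolev_term r (F N) k) \<le> 4 * H\<^sup>2 * (S\<^sup>2 * B)" if K: "finite K" for K N
  proof -
    let ?L = "{- int N..int N}"
    have coeff: "cmod (fourier_coeff (F N) k) \<le> (\<Sum>l\<in>?L. a l * a (k - l))" for k
    proof -
      have "cmod (fourier_coeff (F N) k) \<le> (\<Sum>l\<in>?L. (a l * a (k - l) + a l * a (k + l)) / 2)"
        unfolding F_def fourier_coeff_trig_sum_mult[OF cf finite_atLeastAtMost_int]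
      proof (rule sum_norm_le)
        fix l
        show "cmod ((fourier_coeff f l * fourier_coeff f (k - l) + cnj (fourier_coeff f l) * fourier_coeff f (k + l)) / 2)
            \<le> (a l * a (k - l) + a l * a (k + l)) / 2"
          using norm_triangle_ineq[of "fourier_coeff f l * fourier_coeff f (k - l)" "cnj (fourier_coeff f l) * fourier_coeff f (k + l)"]
          by (simp add: a_def norm_mult norm_divide)
      qed
      also have "\<dots> = ((\<Sum>l\<in>?L. a l * a (k - l)) + (\<Sum>l\<in>?L. a l * a (k + l))) / 2"
        by (simp add: sum.distrib sum_divide_distrib add_divide_distrib)
      also have "(\<Sum>l\<in>?L. a l * a (k + l)) = (\<Sum>l\<in>?L. a l * a (k - l))"
        by (rule sum.reindex_bij_witness[of _ uminus uminus]) (auto simp: a_even)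
      finally show ?thesis by simp
    qed
    have "sobolev_term r (F N) k \<le> 2 * H\<^sup>2 * ((\<Sum>l\<in>?L. b l * a (k - l))\<^sup>2 + (\<Sum>l\<in>?L. a l * b (k - l))\<^sup>2)" for k
    proof -
      have "freq_weight k powr (r / 2) * cmod (fourier_coeff (F N) k) \<le> freq_weight k powr (r / 2) * (\<Sum>l\<in>?L. a l * a (k - l))"
        by (intro mult_left_mono coeff) simp
      also have "\<dots> = (\<Sum>l\<in>?L. freq_weight k powr (r / 2) * (a l * a (k - l)))" by (rule sum_distrib_left)
      also have "\<dots> \<le> (\<Sum>l\<in>?L. (H * (freq_weight l powr (r / 2) + freq_weight (k - l) powr (r / 2))) * (a l * a (k - l)))"
        unfolding H_def using r by (intro sum_mono mult_right_mono freq_weight_powr_peetre mult_nonneg_nonneg a0) auto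
      also have "\<dots> = H * ((\<Sum>l\<in>?L. b l * a (k - l)) + (\<Sum>l\<in>?L. a l * b (k - l)))"
        unfolding sum.distrib[symmetric] sum_distrib_left b_def
        by (intro sum.cong refl) (simp add: algebra_simps)
      finally have "(freq_weight k powr (r / 2) * cmod (fourier_coeff (F N) k))\<^sup>2 \<le>
          (H * ((\<Sum>l\<in>?L. b l * a (k - l)) + (\<Sum>l\<in>?L. a l * b (k - l))))\<^sup>2"
        by (intro power_mono) auto
      also have "\<dots> \<le> H\<^sup>2 * (2 * ((\<Sum>l\<in>?L. b l * a (k - l))\<^sup>2 + (\<Sum>l\<in>?L. a l * b (k - l))\<^sup>2))"
        unfolding power_mult_distrib
        using sum_squares_bound[of "\<Sum>l\<in>?L. b l * a (k - l)" "\<Sum>l\<in>?L. a l * b (k - l)"]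
        by (intro mult_left_mono) (auto simp: power2_sum)
      finally show ?thesis by (simp only: power_mult_distrib ww sobolev_term_eq mult_ac)
    qed
    hence "(\<Sum>k\<in>K. sobolev_term r (F N) k) \<le>
        (\<Sum>k\<in>K. 2 * H\<^sup>2 * ((\<Sum>l\<in>?L. b l * a (k - l))\<^sup>2 + (\<Sum>l\<in>?L. a l * b (k - l))\<^sup>2))"
      by (rule sum_mono)
    also have "\<dots> = 2 * H\<^sup>2 * ((\<Sum>k\<in>K. (\<Sum>l\<in>?L. b l * a (k - l))\<^sup>2) + (\<Sum>k\<in>K. (\<Sum>l\<in>?L. a l * b (k - l))\<^sup>2))"
      by (simp only: sum.distrib[symmetric] sum_distrib_left)
    also have "\<dots> \<le> 2 * H\<^sup>2 * (S\<^sup>2 * B + S\<^sup>2 * B)"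
      by (intro mult_left_mono add_mono young_weighted[OF K _ a0 a b S]) auto
    finally show ?thesis by (simp add: mult_ac)
  qed
  have uF: "uniform_limit {0..1} F (\<lambda>x. (f x)\<^sup>2) sequentially"
  proof -
    have "uniform_limit {0..1} F (\<lambda>x. f x * f x) sequentially"
      unfolding F_def
      by (intro uniform_lim_mult fourier_partial_sums_uniform_limit[OF f r] uniform_limit_const compact_imp_bounded compact_continuous_image cf) auto
    thus ?thesis by (simp add: power2_eq_square)
  qed
  have cf2: "continuous_on UNIV (\<lambda>x. (f x)\<^sup>2)" by (intro continuous_intros cf)
  have lim: "(\<lambda>N. fourier_coeff (F N) k) \<longlonglongrightarrow> fourier_coeff (\<lambda>x. (f x)\<^sup>2) k" for k
    unfolding fourier_coeff_eq_pull[OF cF] fourier_coeff_eq_pull[OF cf2]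
    by (rule pull_coeff_limit[OF uF]) (auto intro: cF uniform_limit_const continuous_intros)
  have "(\<Sum>k\<in>K. sobolev_term r (\<lambda>x. (f x)\<^sup>2) k) \<le> 4 * H\<^sup>2 * (S\<^sup>2 * B)" if K: "finite K" for K
  proof (rule LIMSEQ_le_const2)
    show "(\<lambda>N. \<Sum>k\<in>K. sobolev_term r (F N) k) \<longlonglongrightarrow> (\<Sum>k\<in>K. sobolev_term r (\<lambda>x. (f x)\<^sup>2) k)"
      unfolding sobolev_term_eq by (intro tendsto_intros lim)
  qed (use bound[OF K] in blast)
  from csobolevI(1)[OF cf2 _ this] show ?thesis by (simp add: csobolev_periodic[OF f])
qed

section \<open>Auxiliary bounds on the circle\<close>

text \<open>
  The derivative controls all coefficients but the mean.
\<close>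

lemma sobolev_norm_le_deriv:
  assumes f: "f \<in> csobolev r" and r: "r \<ge> 2"
  shows "(sobolev_norm r f)\<^sup>2 \<le> (cmod (fourier_coeff f 0))\<^sup>2 + 2 * (sobolev_norm (r - 1) (deriv f))\<^sup>2"
proof (rule csobolevI(2)[of f])
  fix K :: "int set" assume K: "finite K"
  have "sobolev_term r f k \<le> (if k = 0 then (cmod (fourier_coeff f 0))\<^sup>2 else 0) + 2 * sobolev_term (r - 1) (deriv f) k" for k
  proof (cases "k = 0")
    case True
    thus ?thesis using sobolev_term_nonneg[of "r - 1" "deriv f" 0] by (simp add: sobolev_term_def)
  next
    case False
    have "1 \<le> \<bar>real_of_int k\<bar>" using False by linarith
    hence "1 * 1 \<le> 2 * pi * \<bar>real_of_int k\<bar>" using pi_gt3 by (intro mult_mono) auto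
    hence "1\<^sup>2 \<le> (2 * pi * \<bar>real_of_int k\<bar>)\<^sup>2" by (intro power_mono) auto
    hence w: "freq_weight k \<le> 2 * (freq k)\<^sup>2"
      by (simp add: freq_weight_def power_mult_distrib)
    have "sobolev_term r f k = freq_weight k powr ((r - 1) + 1) * (cmod (fourier_coeff f k))\<^sup>2"
      by (simp add: sobolev_term_eq)
    also have "\<dots> = freq_weight k powr (r - 1) * (cmod (fourier_coeff f k))\<^sup>2 * freq_weight k"
      using freq_weight_pos[of k] by (subst powr_add) simp
    also have "\<dots> \<le> freq_weight k powr (r - 1) * (cmod (fourier_coeff f k))\<^sup>2 * (2 * (freq k)\<^sup>2)"
      by (intro mult_left_mono w) simp
    also have "\<dots> = 2 * sobolev_term (r - 1) (deriv f) k"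
      by (simp add: sobolev_term_eq fourier_coeff_deriv[OF f r] norm_mult power_mult_distrib)
    finally show ?thesis using False by simp
  qed
  hence "(\<Sum>k\<in>K. sobolev_term r f k) \<le> (\<Sum>k\<in>K. (if k = 0 then (cmod (fourier_coeff f 0))\<^sup>2 else 0) + 2 * sobolev_term (r - 1) (deriv f) k)"
    by (rule sum_mono)
  also have "\<dots> = (\<Sum>k\<in>K. if k = 0 then (cmod (fourier_coeff f 0))\<^sup>2 else 0) + 2 * (\<Sum>k\<in>K. sobolev_term (r - 1) (deriv f) k)"
    by (simp only: sum.distrib sum_distrib_left)
  also have "\<dots> \<le> (cmod (fourier_coeff f 0))\<^sup>2 + 2 * (sobolev_norm (r - 1) (deriv f))\<^sup>2"
    using K by (intro add_mono mult_left_mono sobolev_sum_le_norm csobolev_deriv_mem[OF f r]) auto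
  finally show "(\<Sum>k\<in>K. sobolev_term r f k) \<le> (cmod (fourier_coeff f 0))\<^sup>2 + 2 * (sobolev_norm (r - 1) (deriv f))\<^sup>2" .
qed (use csobolev_continuous[OF f] csobolev_periodic[OF f] in auto)

lemma csobolev_linear_combination:
  assumes f: "f \<in> csobolev r" and g: "g \<in> csobolev r"
    and b: "\<bar>c\<bar> \<le> c'" "\<bar>d\<bar> \<le> d'" "\<bar>e\<bar> \<le> e'"
  shows "(\<lambda>x. c * f x + d * g x + e) \<in> csobolev r"
    and "(sobolev_norm r (\<lambda>x. c * f x + d * g x + e))\<^sup>2
      \<le> 4 * c'\<^sup>2 * (sobolev_norm r f)\<^sup>2 + 4 * d'\<^sup>2 * (sobolev_norm r g)\<^sup>2 + 2 * e'\<^sup>2"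
proof -
  note 1 = csobolev_cmult[OF f, of c] and 2 = csobolev_cmult[OF g, of d]
  note 3 = csobolev_add[OF 1(1) 2(1)]
  note 4 = csobolev_add[OF 3(1) csobolev_const(1)[of e]]
  show "(\<lambda>x. c * f x + d * g x + e) \<in> csobolev r" by (rule 4(1))
  have sq: "x\<^sup>2 \<le> y\<^sup>2" if "\<bar>x\<bar> \<le> y" for x y :: real
    using that by (metis abs_ge_zero power2_abs power_mono)
  have "c\<^sup>2 * (sobolev_norm r f)\<^sup>2 \<le> c'\<^sup>2 * (sobolev_norm r f)\<^sup>2"
    "d\<^sup>2 * (sobolev_norm r g)\<^sup>2 \<le> d'\<^sup>2 * (sobolev_norm r g)\<^sup>2" "e\<^sup>2 \<le> e'\<^sup>2"
    using b by (auto intro!: mult_right_mono sq)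
  thus "(sobolev_norm r (\<lambda>x. c * f x + d * g x + e))\<^sup>2
      \<le> 4 * c'\<^sup>2 * (sobolev_norm r f)\<^sup>2 + 4 * d'\<^sup>2 * (sobolev_norm r g)\<^sup>2 + 2 * e'\<^sup>2"
    using 1(2) 2(2) 3(2) 4(2) csobolev_const(2)[of r e] by linarith
qed

lemma circle_map_integral_1: "circle_map \<phi> J \<Longrightarrow> integral {0..1} J = 1"
  using circle_map_substitution[of \<phi> J "\<lambda>_. 1"] by simp

text \<open>
  Since \<open>\<phi>' = exp (q + B)\<close> has mean one, \<open>exp B\<close> is the reciprocal of a mean of values \<open>exp (q x)\<close>.
\<close>

lemma normalisation_bound:
  assumes \<phi>: "circle_map \<phi> (\<lambda>x. exp (q x + B))" and q: "\<And>x. \<bar>q x\<bar> \<le> Q"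
  shows "\<bar>B\<bar> \<le> Q"
proof -
  note c = circle_map_continuous_deriv[OF \<phi>, of "{0..1}"]
  have q': "- Q \<le> q x" "q x \<le> Q" for x using q[of x] by linarith+
  have "integral {0..1::real} (\<lambda>x. exp (B - Q)) \<le> integral {0..1} (\<lambda>x. exp (q x + B))"
    by (rule integral_le) (use q' in \<open>auto intro!: integrable_continuous_real c\<close>)
  moreover have "integral {0..1} (\<lambda>x. exp (q x + B)) \<le> integral {0..1::real} (\<lambda>x. exp (B + Q))"
    by (rule integral_le) (use q' in \<open>auto intro!: integrable_continuous_real c\<close>)
  ultimately have "exp (B - Q) \<le> 1" "1 \<le> exp (B + Q)"
    by (simp_all add: circle_map_integral_1[OF \<phi>])
  thus ?thesis by (simp add: abs_le_iff)
qed

text \<open>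
  Transported by \<open>\<phi>\<close>, the mean of \<open>f\<close> is a weighted mean of \<open>k + A\<close> with total weight one; so \<open>- A\<close> is a mean
  of values of \<open>k\<close>.
\<close>

lemma mean_zero_constant_bound:
  fixes f k :: "real \<Rightarrow> real"
  assumes \<phi>: "circle_map \<phi> J" and f: "continuous_on UNIV f" "\<And>x. f (x + 1) = f x" "integral {0..1} f = 0"
    and k: "\<And>x. f (\<phi> x) = k x + A" "\<And>x. \<bar>k x\<bar> \<le> Q"
  shows "\<bar>A\<bar> \<le> Q"
proof -
  note cJ = circle_map_continuous_deriv[OF \<phi>, of "{0..1}"]
  have cf: "continuous_on {0..1} (\<lambda>x. f (\<phi> x) * J x)"
    by (intro continuous_intros continuous_on_compose2[OF f(1) circle_map_continuous[OF \<phi>]] cJ) auto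
  have k': "- Q \<le> k x" "k x \<le> Q" for x using k(2)[of x] by linarith+
  have J: "J x \<ge> 0" for x using \<phi> by (simp add: circle_map_def)
  have 0: "integral {0..1} (\<lambda>x. f (\<phi> x) * J x) = 0"
    using circle_map_substitution[OF \<phi> f(1,2)] f(3) by simp
  have le: "(A - Q) * J x \<le> f (\<phi> x) * J x" "f (\<phi> x) * J x \<le> (A + Q) * J x" for x
    using k'[of x] J[of x] unfolding k(1) by (auto intro!: mult_right_mono)
  have I: "(\<lambda>x. c * J x) integrable_on {0..1}" "(\<lambda>x. f (\<phi> x) * J x) integrable_on {0..1}" for c
    by (intro integrable_continuous_real continuous_intros cJ, rule integrable_continuous_real[OF cf])
  have "integral {0..1} (\<lambda>x. (A - Q) * J x) \<le> integral {0..1} (\<lambda>x. f (\<phi> x) * J x)"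
    by (intro integral_le I le)
  moreover have "integral {0..1} (\<lambda>x. f (\<phi> x) * J x) \<le> integral {0..1} (\<lambda>x. (A + Q) * J x)"
    by (intro integral_le I le)
  ultimately show ?thesis using 0 by (simp add: circle_map_integral_1[OF \<phi>] abs_le_iff)
qed

section \<open>Sobolev-valued functions of time\<close>

lemma sobolev_C0_csobolev: "sobolev_C0 r T w \<Longrightarrow> t \<in> {0..<T} \<Longrightarrow> w t \<in> csobolev r"
  by (simp add: sobolev_C0_def csobolev_def)

lemma deriv_diff_csobolev:
  assumes "f \<in> csobolev r" "g \<in> csobolev r" "r \<ge> 2"
  shows "deriv (\<lambda>x. f x - g x) = (\<lambda>x. deriv f x - deriv g x)"
  by (rule ext, rule DERIV_imp_deriv) (intro DERIV_diff csobolev_has_deriv[OF assms(1,3)] csobolev_has_deriv[OF assms(2,3)])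

lemma sobolev_norm_tendsto_uniform_limit:
  assumes r: "r \<ge> 1" and mem: "\<forall>\<^sub>F \<tau> in F. (\<lambda>x. g \<tau> x - l x) \<in> csobolev r"
    and lim: "((\<lambda>\<tau>. sobolev_norm r (\<lambda>x. g \<tau> x - l x)) \<longlongrightarrow> 0) F"
  shows "uniform_limit UNIV g l F"
proof (rule uniform_limitI)
  fix e :: real assume e: "e > 0"
  have "((\<lambda>\<tau>. sobolev_const * sobolev_norm r (\<lambda>x. g \<tau> x - l x)) \<longlongrightarrow> sobolev_const * 0) F"
    by (intro tendsto_intros lim)
  hence "\<forall>\<^sub>F \<tau> in F. sobolev_const * sobolev_norm r (\<lambda>x. g \<tau> x - l x) < e"
    using e by (intro order_tendstoD(2)) auto
  with mem show "\<forall>\<^sub>F \<tau> in F. \<forall>x\<in>UNIV. dist (g \<tau> x) (l x) < e"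
  proof eventually_elim
    case (elim \<tau>)
    show ?case
    proof
      fix x
      show "dist (g \<tau> x) (l x) < e"
        using csobolev_sup_bound[OF elim(1) r, of x] elim(2) by (simp add: dist_norm)
    qed
  qed
qed

lemma sobolev_C0_uniform_limit:
  assumes w: "sobolev_C0 r T w" and r: "r \<ge> 1" and t: "t \<in> {0..<T}"
  shows "uniform_limit UNIV w (w t) (at t within {0..<T})"
proof (rule sobolev_norm_tendsto_uniform_limit[OF r])
  show "\<forall>\<^sub>F \<tau> in at t within {0..<T}. (\<lambda>x. w \<tau> x - w t x) \<in> csobolev r"
    unfolding eventually_at_filter
    by (auto intro!: always_eventually csobolev_diff sobolev_C0_csobolev[OF w] t)
qed (use w t in \<open>auto simp: sobolev_C0_def\<close>)

lemma sobolev_C0_deriv: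
  assumes w: "sobolev_C0 r T w" and r: "r \<ge> 2"
  shows "sobolev_C0 (r - 1) T (\<lambda>t. deriv (w t))"
  unfolding sobolev_C0_def
proof (intro conjI ballI)
  fix t assume t: "t \<in> {0..<T}"
  note wt = sobolev_C0_csobolev[OF w]
  show "deriv (w t) \<in> sobolev (r - 1)" "continuous_on UNIV (deriv (w t))"
    using csobolev_deriv_mem[OF wt[OF t] r] by (auto simp: csobolev_def)
  have lim: "((\<lambda>\<tau>. sobolev_norm r (\<lambda>x. w \<tau> x - w t x)) \<longlongrightarrow> 0) (at t within {0..<T})"
    using w t by (simp add: sobolev_C0_def)
  show "((\<lambda>\<tau>. sobolev_norm (r - 1) (\<lambda>x. deriv (w \<tau>) x - deriv (w t) x)) \<longlongrightarrow> 0) (at t within {0..<T})"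
  proof (rule tendsto_sandwich[OF _ _ tendsto_const lim])
    show "\<forall>\<^sub>F \<tau> in at t within {0..<T}. sobolev_norm (r - 1) (\<lambda>x. deriv (w \<tau>) x - deriv (w t) x) \<le> sobolev_norm r (\<lambda>x. w \<tau> x - w t x)"
      unfolding eventually_at_filter
      using csobolev_deriv_norm[OF csobolev_diff[OF wt wt[OF t]] r]
      by (auto intro!: always_eventually simp: deriv_diff_csobolev[OF wt wt[OF t] r])
  qed (simp add: sobolev_norm_nonneg)
qed

lemma csobolev_difference_quotient:
  assumes "f \<in> csobolev r" "g \<in> csobolev r" "d \<in> csobolev r"
  shows "(\<lambda>x. (f x - g x) / c - d x) \<in> csobolev r"
  using csobolev_diff[OF csobolev_cmult(1)[OF csobolev_diff[OF assms(1,2)], of "1 / c"] assms(3)] by simp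

lemma sobolev_C1_uniform_limit:
  assumes w: "sobolev_C1 r T w w'" and r: "r \<ge> 1" and t: "t \<in> {0..<T}"
  shows "uniform_limit UNIV (\<lambda>\<tau> x. (w \<tau> x - w t x) / (\<tau> - t)) (w' t) (at t within {0..<T})"
proof (rule sobolev_norm_tendsto_uniform_limit[OF r])
  have C: "sobolev_C0 r T w" "sobolev_C0 r T w'" using w by (auto simp: sobolev_C1_def)
  show "\<forall>\<^sub>F \<tau> in at t within {0..<T}. (\<lambda>x. (w \<tau> x - w t x) / (\<tau> - t) - w' t x) \<in> csobolev r"
    unfolding eventually_at_filter
    by (auto intro!: always_eventually csobolev_difference_quotient sobolev_C0_csobolev[OF C(1)] sobolev_C0_csobolev[OF C(2)] t)
qed (use w t in \<open>auto simp: sobolev_C1_def\<close>)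

lemma sobolev_C1_deriv:
  assumes w: "sobolev_C1 r T w w'" and r: "r \<ge> 2"
  shows "sobolev_C1 (r - 1) T (\<lambda>t. deriv (w t)) (\<lambda>t. deriv (w' t))"
  unfolding sobolev_C1_def
proof (intro conjI ballI)
  have C: "sobolev_C0 r T w" "sobolev_C0 r T w'" using w by (auto simp: sobolev_C1_def)
  note wt = sobolev_C0_csobolev[OF C(1)] and wt' = sobolev_C0_csobolev[OF C(2)]
  show "sobolev_C0 (r - 1) T (\<lambda>t. deriv (w t))" "sobolev_C0 (r - 1) T (\<lambda>t. deriv (w' t))"
    using sobolev_C0_deriv C r by auto
  fix t assume t: "t \<in> {0..<T}"
  have lim: "((\<lambda>\<tau>. sobolev_norm r (\<lambda>x. (w \<tau> x - w t x) / (\<tau> - t) - w' t x)) \<longlongrightarrow> 0) (at t within {0..<T})"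
    using w t by (simp add: sobolev_C1_def)
  show "((\<lambda>\<tau>. sobolev_norm (r - 1) (\<lambda>x. (deriv (w \<tau>) x - deriv (w t) x) / (\<tau> - t) - deriv (w' t) x)) \<longlongrightarrow> 0) (at t within {0..<T})"
  proof (rule tendsto_sandwich[OF _ _ tendsto_const lim])
    have "sobolev_norm (r - 1) (\<lambda>x. (deriv (w \<tau>) x - deriv (w t) x) / (\<tau> - t) - deriv (w' t) x)
        \<le> sobolev_norm r (\<lambda>x. (w \<tau> x - w t x) / (\<tau> - t) - w' t x)" if \<tau>: "\<tau> \<in> {0..<T}" for \<tau>
    proof -
      have "deriv (\<lambda>x. (w \<tau> x - w t x) / (\<tau> - t) - w' t x) = (\<lambda>x. (deriv (w \<tau>) x - deriv (w t) x) / (\<tau> - t) - deriv (w' t) x)"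
        by (rule ext, rule DERIV_imp_deriv)
           (intro DERIV_diff DERIV_cdivide csobolev_has_deriv[OF wt[OF \<tau>] r] csobolev_has_deriv[OF wt[OF t] r] csobolev_has_deriv[OF wt'[OF t] r])
      thus ?thesis
        using csobolev_deriv_norm[OF csobolev_difference_quotient[OF wt[OF \<tau>] wt[OF t] wt'[OF t]] r] by metis
    qed
    thus "\<forall>\<^sub>F \<tau> in at t within {0..<T}. sobolev_norm (r - 1) (\<lambda>x. (deriv (w \<tau>) x - deriv (w t) x) / (\<tau> - t) - deriv (w' t) x)
        \<le> sobolev_norm r (\<lambda>x. (w \<tau> x - w t x) / (\<tau> - t) - w' t x)"
      unfolding eventually_at_filter by (auto intro!: always_eventually)
  qed (simp add: sobolev_norm_nonneg)
qed

lemma sobolev_C0_jointly_continuous: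
  assumes w: "sobolev_C0 r T w" and r: "r \<ge> 1"
  shows "continuous_on ({0..<T} \<times> UNIV) (\<lambda>(t, x). w t x)"
  unfolding continuous_on_iff
proof clarify
  fix t x e :: real assume t: "t \<in> {0..<T}" and e: "e > 0"
  have e2: "e / 2 > 0" using e by simp
  obtain d1 where d1: "d1 > 0" "\<And>\<tau> y. \<tau> \<in> {0..<T} \<Longrightarrow> dist \<tau> t < d1 \<Longrightarrow> dist (w \<tau> y) (w t y) < e / 2"
  proof -
    from uniform_limitD[OF sobolev_C0_uniform_limit[OF w r t] e2]
    obtain d where d: "d > 0" "\<And>\<tau>. \<tau> \<in> {0..<T} \<Longrightarrow> \<tau> \<noteq> t \<Longrightarrow> dist \<tau> t < d \<Longrightarrow> \<forall>y\<in>UNIV. dist (w \<tau> y) (w t y) < e / 2"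
      unfolding eventually_at by blast
    show ?thesis
    proof (rule that[OF d(1)])
      fix \<tau> y assume "\<tau> \<in> {0..<T}" "dist \<tau> t < d"
      thus "dist (w \<tau> y) (w t y) < e / 2" using d(2)[of \<tau>] e by (cases "\<tau> = t") auto
    qed
  qed
  obtain d2 where d2: "d2 > 0" "\<And>y. dist y x < d2 \<Longrightarrow> dist (w t y) (w t x) < e / 2"
    using csobolev_continuous[OF sobolev_C0_csobolev[OF w t], of UNIV] e2 unfolding continuous_on_iff by blast
  show "\<exists>d>0. \<forall>x'\<in>{0..<T} \<times> UNIV. dist x' (t, x) < d \<longrightarrow> dist (case x' of (t, x) \<Rightarrow> w t x) (w t x) < e"
  proof (intro exI[of _ "min d1 d2"] conjI ballI impI)
    fix p assume p: "p \<in> {0..<T} \<times> UNIV" "dist p (t, x) < min d1 d2"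
    obtain \<tau> y where py: "p = (\<tau>, y)" by (cases p)
    have "dist \<tau> t < d1" "dist y x < d2"
      using p(2) dist_fst_le[of p "(t, x)"] dist_snd_le[of p "(t, x)"] by (auto simp: py)
    hence "dist (w \<tau> y) (w t y) < e / 2" "dist (w t y) (w t x) < e / 2"
      using d1(2) d2(2) p(1) by (auto simp: py)
    hence "dist (w \<tau> y) (w t x) < e" using dist_triangle_half_l[of "w \<tau> y" "w t y" e "w t x"] dist_commute by metis
    thus "dist (case p of (t, x) \<Rightarrow> w t x) (w t x) < e" by (simp add: py)
  qed (use d1 d2 in auto)
qed

lemma sobolev_C0_continuous_compose:
  assumes w: "sobolev_C0 r T w" and r: "r \<ge> 1" and y: "continuous_on S y" and S: "S \<subseteq> {0..<T}"
  shows "continuous_on S (\<lambda>t. w t (y t))"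
proof -
  have "continuous_on S (\<lambda>t. (\<lambda>(t, x). w t x) (t, y t))"
    by (rule continuous_on_compose2[OF sobolev_C0_jointly_continuous[OF w r]])
       (use S in \<open>auto intro!: continuous_intros y\<close>)
  thus ?thesis by simp
qed

lemma sobolev_C0_bounded:
  assumes w: "sobolev_C0 r T w" and r: "r \<ge> 1" and a: "a < T"
  obtains B where "B > 0" "\<And>t x. t \<in> {0..a} \<Longrightarrow> \<bar>w t x\<bar> \<le> B"
proof -
  have "continuous_on ({0..a} \<times> {0..1}) (\<lambda>(t, x). w t x)"
    by (rule continuous_on_subset[OF sobolev_C0_jointly_continuous[OF w r]]) (use a in auto)
  hence "bounded ((\<lambda>(t, x). w t x) ` ({0..a} \<times> {0..1}))"
    by (intro compact_imp_bounded compact_continuous_image compact_Times compact_Icc)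
  then obtain B where B0: "B > 0" "\<forall>v\<in>(\<lambda>(t, x). w t x) ` ({0..a} \<times> {0..1}). norm v \<le> B"
    unfolding bounded_pos by blast
  have B: "\<bar>w t x\<bar> \<le> B" if "t \<in> {0..a}" "x \<in> {0..1}" for t x
  proof -
    have "(\<lambda>(t, x). w t x) (t, x) \<in> (\<lambda>(t, x). w t x) ` ({0..a} \<times> {0..1})"
      by (rule imageI) (use that in blast)
    from bspec[OF B0(2) this] show ?thesis by simp
  qed
  show ?thesis
  proof (rule that[OF B0(1)])
    fix t x assume t: "t \<in> {0..a}"
    hence "w t \<in> csobolev r" using a by (intro sobolev_C0_csobolev[OF w]) auto
    from csobolev_periodic[OF this] show "\<bar>w t x\<bar> \<le> B"
      by (rule periodic_bound_of_unit[of "w t"]) (rule B[OF t])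
  qed
qed

text \<open>
  The time difference quotients of \<open>w\<close> are evaluated at the moving point \<open>y \<tau>\<close>. They converge uniformly
  in space, which replaces continuity of the time derivative in both variables.
\<close>

lemma sobolev_C1_chain:
  assumes w: "sobolev_C1 r T w w'" and r: "r \<ge> 1" and t: "0 < t" "t < T"
    and wx: "(w t has_real_derivative wx) (at (y t))" and y: "(y has_real_derivative y') (at t)"
  shows "((\<lambda>\<tau>. w \<tau> (y \<tau>)) has_real_derivative w' t (y t) + wx * y') (at t)"
proof -
  have tI: "t \<in> {0..<T}" and at: "at t within {0..<T} = at t"
    using t by (auto intro!: at_within_interior simp: interior_atLeastLessThan)
  let ?Q = "\<lambda>\<tau> x. (w \<tau> x - w t x) / (\<tau> - t)"
  have u: "uniform_limit UNIV ?Q (w' t) (at t)"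
    using sobolev_C1_uniform_limit[OF w r tI] by (simp add: at)
  have yt: "(y \<longlongrightarrow> y t) (at t)" using DERIV_isCont[OF y] by (simp add: isCont_def)
  have C: "sobolev_C0 r T w'" using w by (simp add: sobolev_C1_def)
  have "isCont (w' t) (y t)"
    using csobolev_continuous[OF sobolev_C0_csobolev[OF C tI], of UNIV] by (simp add: continuous_on_eq_continuous_at)
  hence 1: "((\<lambda>\<tau>. w' t (y \<tau>)) \<longlongrightarrow> w' t (y t)) (at t)" by (rule isCont_tendsto_compose[OF _ yt])
  have 2: "((\<lambda>\<tau>. ?Q \<tau> (y \<tau>) - w' t (y \<tau>)) \<longlongrightarrow> 0) (at t)"
  proof (rule tendstoI)
    fix e :: real assume "e > 0"
    from uniform_limitD[OF u this] show "\<forall>\<^sub>F \<tau> in at t. dist (?Q \<tau> (y \<tau>) - w' t (y \<tau>)) 0 < e"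
      by eventually_elim (auto simp: dist_norm)
  qed
  have 3: "((\<lambda>\<tau>. (w t (y \<tau>) - w t (y t)) / (\<tau> - t)) \<longlongrightarrow> wx * y') (at t)"
    using DERIV_chain2[OF wx y] by (simp add: has_field_derivative_iff)
  have "((\<lambda>\<tau>. (?Q \<tau> (y \<tau>) - w' t (y \<tau>)) + w' t (y \<tau>) + (w t (y \<tau>) - w t (y t)) / (\<tau> - t)) \<longlongrightarrow> 0 + w' t (y t) + wx * y') (at t)"
    by (intro tendsto_add 1 2 3)
  moreover have "(?Q \<tau> (y \<tau>) - w' t (y \<tau>)) + w' t (y \<tau>) + (w t (y \<tau>) - w t (y t)) / (\<tau> - t)
     = (w \<tau> (y \<tau>) - w t (y t)) / (\<tau> - t)" for \<tau>
    by (simp add: add_divide_distrib[symmetric])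
  ultimately show ?thesis by (simp add: has_field_derivative_iff)
qed

section \<open>Ordinary differential equations\<close>

text \<open>
  The function \<open>(d t)\<^sup>2 exp (- 2 L t)\<close> is nonincreasing; the square avoids differentiating \<open>\<bar>d\<bar>\<close>.
\<close>

lemma gronwall_abs:
  fixes d :: "real \<Rightarrow> real"
  assumes cont: "continuous_on {0..a} d" and deriv: "\<And>t. t \<in> {0<..<a} \<Longrightarrow> (d has_real_derivative d' t) (at t)"
    and le: "\<And>t. t \<in> {0<..<a} \<Longrightarrow> \<bar>d' t\<bar> \<le> L * \<bar>d t\<bar>" and t: "t \<in> {0..a}"
  shows "\<bar>d t\<bar> \<le> exp (L * t) * \<bar>d 0\<bar>"
proof -
  have "(d t)\<^sup>2 * exp (- 2 * L * t) \<le> (d 0)\<^sup>2 * exp (- 2 * L * 0)"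
  proof (rule DERIV_nonpos_imp_decreasing_open[where f = "\<lambda>t. (d t)\<^sup>2 * exp (- 2 * L * t)" and a = 0 and b = t])
    fix x assume x: "0 < x" "x < t"
    hence xa: "x \<in> {0<..<a}" using t by auto
    have "((\<lambda>t. (d t)\<^sup>2 * exp (- 2 * L * t)) has_real_derivative
        2 * (d x * d' x - L * (d x)\<^sup>2) * exp (- 2 * L * x)) (at x)"
      by (auto intro!: derivative_eq_intros deriv[OF xa] simp: power2_eq_square algebra_simps)
    moreover have "d x * d' x \<le> L * (d x)\<^sup>2"
    proof -
      have "d x * d' x \<le> \<bar>d x\<bar> * \<bar>d' x\<bar>" by (simp add: abs_mult[symmetric])
      also have "\<dots> \<le> \<bar>d x\<bar> * (L * \<bar>d x\<bar>)" by (intro mult_left_mono le[OF xa]) auto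
      finally show ?thesis by (simp add: power2_eq_square mult_ac)
    qed
    ultimately show "\<exists>y. ((\<lambda>t. (d t)\<^sup>2 * exp (- 2 * L * t)) has_real_derivative y) (at x) \<and> y \<le> 0"
      by (intro exI conjI) (auto simp: mult_le_0_iff)
  next
    show "continuous_on {0..t} (\<lambda>t. (d t)\<^sup>2 * exp (- 2 * L * t))"
      using t by (intro continuous_intros continuous_on_subset[OF cont]) auto
  qed (use t in auto)
  hence "(d t)\<^sup>2 \<le> (d 0)\<^sup>2 * exp (2 * L * t)" by (simp add: exp_minus field_simps)
  also have "\<dots> = (exp (L * t) * \<bar>d 0\<bar>)\<^sup>2"
    by (simp add: power_mult_distrib exp_double[symmetric] mult_ac)
  finally have "\<bar>d t\<bar>\<^sup>2 \<le> (exp (L * t) * \<bar>d 0\<bar>)\<^sup>2" by simp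
  thus ?thesis by (rule power2_le_imp_le) simp
qed

text \<open>
  The contraction principle in the supremum norm with weight \<open>exp (- 2 L t)\<close>, for which the integral
  operator contracts by \<open>1/2\<close> on an interval of any length.
\<close>

theorem picard_lindelof_global:
  fixes F :: "real \<Rightarrow> real \<Rightarrow> real"
  assumes a: "a > 0" and cont: "\<And>y. continuous_on {0..a} y \<Longrightarrow> continuous_on {0..a} (\<lambda>t. F t (y t))"
    and lip: "\<And>t x y. t \<in> {0..a} \<Longrightarrow> \<bar>F t x - F t y\<bar> \<le> L * \<bar>x - y\<bar>" and L: "L > 0"
  obtains y where "y 0 = \<xi>" "continuous_on {0..a} y" "\<And>t. t \<in> {0<..<a} \<Longrightarrow> (y has_real_derivative F t (y t)) (at t)"
proof -
  \<comment> \<open>clamping makes paths on \<open>[0,a]\<close> into bounded continuous functions on \<open>\<real>\<close>, which form a Banach space\<close>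
  define cl where "cl = (\<lambda>t::real. max 0 (min t a))"
  have cl: "cl t \<in> {0..a}" for t using a by (auto simp: cl_def)
  have cl_id: "cl t = t" if "t \<in> {0..a}" for t using that by (auto simp: cl_def)
  have ccl: "continuous_on UNIV cl" unfolding cl_def by (intro continuous_intros)
  \<comment> \<open>the unknown is \<open>z t = exp (- 2 L t) y t\<close>, so that its supremum norm is the weighted norm of \<open>y\<close>\<close>
  define \<Psi> where "\<Psi> = (\<lambda>(z :: real \<Rightarrow>\<^sub>C real) t. exp (- 2 * L * t) * (\<xi> + integral {0..t} (\<lambda>s. F s (exp (2 * L * s) * z s))))"
  have cz: "continuous_on {0..a} (\<lambda>s. F s (exp (2 * L * s) * apply_bcontfun z s))" for z
    by (intro cont continuous_intros) (metis continuous_on_apply_bcontfun continuous_on_subset subset_UNIV continuous_on_id)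
  have c\<Psi>: "continuous_on {0..a} (\<Psi> z)" for z
    unfolding \<Psi>_def
    by (intro continuous_intros indefinite_integral_continuous_1 integrable_continuous_real cz)
  have mem: "(\<lambda>t. \<Psi> z (cl t)) \<in> bcontfun" for z
  proof -
    have "bounded (\<Psi> z ` {0..a})" by (intro compact_imp_bounded compact_continuous_image c\<Psi>) auto
    then obtain B where B: "\<And>t. t \<in> {0..a} \<Longrightarrow> norm (\<Psi> z t) \<le> B" unfolding bounded_iff by blast
    show ?thesis
      by (rule bcontfun_normI[OF continuous_on_compose2[OF c\<Psi> ccl] B[OF cl]]) (use cl in auto)
  qed
  define \<Phi> where "\<Phi> = (\<lambda>z. Bcontfun (\<lambda>t. \<Psi> z (cl t)))"
  have \<Phi>: "apply_bcontfun (\<Phi> z) t = \<Psi> z (cl t)" for z t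
    unfolding \<Phi>_def by (simp add: Bcontfun_inverse[OF mem])
  have "\<exists>!z. \<Phi> z = z"
  proof (rule banach_fix_type)
    show "\<forall>z w. dist (\<Phi> z) (\<Phi> w) \<le> 1 / 2 * dist z w"
    proof (intro allI dist_bound)
      fix z w :: "real \<Rightarrow>\<^sub>C real" and t
      define \<theta> where "\<theta> = cl t"
      have \<theta>: "\<theta> \<in> {0..a}" "{0..\<theta>} \<subseteq> {0..a}" using cl[of t] by (auto simp: \<theta>_def)
      define D where "D = dist z w"
      let ?f = "\<lambda>z s. F s (exp (2 * L * s) * apply_bcontfun z s)"
      have i: "?f z integrable_on {0..\<theta>}" for z
        by (intro integrable_continuous_real continuous_on_subset[OF cz \<theta>(2)])
      have hi: "((\<lambda>s. L * exp (2 * L * s) * D) has_integral (exp (2 * L * \<theta>) * D / 2 - exp (2 * L * 0) * D / 2)) {0..\<theta>}"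
        by (rule fundamental_theorem_real[where F = "\<lambda>s. exp (2 * L * s) * D / 2"])
           (use \<theta> in \<open>auto intro!: derivative_eq_intros\<close>)
      have "\<bar>integral {0..\<theta>} (?f z) - integral {0..\<theta>} (?f w)\<bar> = norm (integral {0..\<theta>} (\<lambda>s. ?f z s - ?f w s))"
        by (simp add: integral_diff[OF i i])
      also have "\<dots> \<le> integral {0..\<theta>} (\<lambda>s. L * exp (2 * L * s) * D)"
      proof (rule integral_norm_bound_integral)
        fix s assume s: "s \<in> {0..\<theta>}"
        have "norm (?f z s - ?f w s) \<le> L * \<bar>exp (2 * L * s) * z s - exp (2 * L * s) * w s\<bar>"
          using lip[of s] s \<theta> by auto
        also have "\<dots> = L * exp (2 * L * s) * dist (z s) (w s)"
          by (simp add: dist_real_def abs_mult right_diff_distrib[symmetric])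
        also have "\<dots> \<le> L * exp (2 * L * s) * D"
          unfolding D_def using L by (intro mult_left_mono dist_bounded) auto
        finally show "norm (?f z s - ?f w s) \<le> L * exp (2 * L * s) * D" .
      qed (use hi i in \<open>auto intro!: integrable_diff\<close>)
      also have "\<dots> = (exp (2 * L * \<theta>) - 1) * D / 2"
        unfolding integral_unique[OF hi] by (simp add: left_diff_distrib diff_divide_distrib)
      also have "\<dots> \<le> exp (2 * L * \<theta>) * D / 2" by (simp add: D_def mult_right_mono)
      finally have *: "\<bar>integral {0..\<theta>} (?f z) - integral {0..\<theta>} (?f w)\<bar> \<le> exp (2 * L * \<theta>) * D / 2" .
      have "dist (\<Phi> z t) (\<Phi> w t) = exp (- 2 * L * \<theta>) * \<bar>integral {0..\<theta>} (?f z) - integral {0..\<theta>} (?f w)\<bar>"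
        unfolding \<Phi> \<Psi>_def \<theta>_def[symmetric] dist_real_def right_diff_distrib[symmetric] by (simp add: abs_mult)
      also have "\<dots> \<le> exp (- 2 * L * \<theta>) * (exp (2 * L * \<theta>) * D / 2)" by (intro mult_left_mono *) auto
      also have "\<dots> = 1 / 2 * D" by (simp add: exp_minus)
      finally show "dist (\<Phi> z t) (\<Phi> w t) \<le> 1 / 2 * dist z w" by (simp add: D_def)
    qed
  qed auto
  then obtain z where z: "\<Phi> z = z" by blast
  define y where "y = (\<lambda>t. exp (2 * L * t) * z t)"
  have y: "y t = \<xi> + integral {0..t} (\<lambda>s. F s (y s))" if "t \<in> {0..a}" for t
  proof -
    have "z t = \<Psi> z t" using \<Phi>[of z t] z cl_id[OF that] by simp
    thus ?thesis unfolding y_def \<Psi>_def by (simp add: exp_minus)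
  qed
  have cy: "continuous_on {0..a} y"
    unfolding y_def by (intro continuous_intros) (metis continuous_on_apply_bcontfun continuous_on_subset subset_UNIV continuous_on_id)
  show ?thesis
  proof (rule that[OF _ cy])
    show "y 0 = \<xi>" using y[of 0] a by simp
    fix t assume t: "t \<in> {0<..<a}"
    have "((\<lambda>t. integral {0..t} (\<lambda>s. F s (y s))) has_real_derivative F t (y t)) (at t within {0..a})"
      by (rule integral_has_real_derivative[OF cont[OF cy]]) (use t in auto)
    hence "((\<lambda>t. integral {0..t} (\<lambda>s. F s (y s))) has_real_derivative F t (y t)) (at t)"
      by (subst (asm) at_within_interior) (use t in auto)
    hence "((\<lambda>t. \<xi> + integral {0..t} (\<lambda>s. F s (y s))) has_real_derivative F t (y t)) (at t)"
      by (auto intro!: derivative_eq_intros)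
    moreover have "\<forall>\<^sub>F s in nhds t. s \<in> {0<..<a}" using t by (intro eventually_nhds_in_open) auto
    hence "\<forall>\<^sub>F s in nhds t. \<xi> + integral {0..s} (\<lambda>s. F s (y s)) = y s"
      by eventually_elim (use y in force)
    ultimately show "(y has_real_derivative F t (y t)) (at t)"
      by (subst (asm) DERIV_cong_ev) auto
  qed
qed

lemma quadratic_error_imp_derivative:
  fixes f :: "real \<Rightarrow> real"
  assumes "\<And>z. \<bar>f z - f x - D * (z - x)\<bar> \<le> C * (z - x)\<^sup>2"
  shows "(f has_real_derivative D) (at x)"
proof -
  have "((\<lambda>z. (f z - f x) / (z - x) - D) \<longlongrightarrow> 0) (at x)"
  proof (rule tendsto_rabs_zero_cancel, rule tendsto_sandwich[OF _ _ tendsto_const])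
    show "\<forall>\<^sub>F z in at x. \<bar>(f z - f x) / (z - x) - D\<bar> \<le> C * \<bar>z - x\<bar>"
      unfolding eventually_at_filter
    proof (intro always_eventually allI impI)
      fix z assume z: "z \<noteq> x"
      hence "\<bar>(f z - f x) / (z - x) - D\<bar> = \<bar>f z - f x - D * (z - x)\<bar> / \<bar>z - x\<bar>"
        by (simp add: abs_divide[symmetric] diff_divide_distrib)
      also have "\<dots> \<le> C * (z - x)\<^sup>2 / \<bar>z - x\<bar>" by (intro divide_right_mono assms) simp
      also have "\<dots> = C * \<bar>z - x\<bar>"
        using z by (simp add: power2_eq_square field_simps abs_if)
      finally show "\<bar>(f z - f x) / (z - x) - D\<bar> \<le> C * \<bar>z - x\<bar>" .
    qed
    have "((\<lambda>z. C * \<bar>z - x\<bar>) \<longlongrightarrow> C * \<bar>x - x\<bar>) (at x)" by (intro tendsto_intros)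
    thus "((\<lambda>z. C * \<bar>z - x\<bar>) \<longlongrightarrow> 0) (at x)" by simp
  qed simp
  from tendsto_add[OF this tendsto_const[of D]] show ?thesis by (simp add: has_field_derivative_iff)
qed

lemma lipschitz_of_deriv_bound:
  fixes f :: "real \<Rightarrow> real"
  assumes "\<And>x. (f has_real_derivative f' x) (at x)" "\<And>x. \<bar>f' x\<bar> \<le> L"
  shows "\<bar>f x - f y\<bar> \<le> L * \<bar>x - y\<bar>"
  using field_differentiable_bound[of UNIV f f' L x y] assms by auto

lemma taylor_quadratic_bound:
  fixes f :: "real \<Rightarrow> real"
  assumes f: "\<And>x. (f has_real_derivative f' x) (at x)" and lip: "\<And>x y. \<bar>f' x - f' y\<bar> \<le> K * \<bar>x - y\<bar>"
    and K: "K \<ge> 0"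
  shows "\<bar>f b - f a - f' a * (b - a)\<bar> \<le> K * (b - a)\<^sup>2"
proof -
  have "norm ((\<lambda>x. f x - f' a * x) b - (\<lambda>x. f x - f' a * x) a) \<le> (K * \<bar>b - a\<bar>) * norm (b - a)"
  proof (rule field_differentiable_bound)
    fix z assume z: "z \<in> closed_segment a b"
    show "((\<lambda>x. f x - f' a * x) has_field_derivative (f' z - f' a)) (at z within closed_segment a b)"
      by (rule has_field_derivative_at_within) (auto intro!: derivative_eq_intros f)
    have "\<bar>z - a\<bar> \<le> \<bar>b - a\<bar>" using segment_bound1[OF z] by simp
    hence "K * \<bar>z - a\<bar> \<le> K * \<bar>b - a\<bar>" by (rule mult_left_mono) (rule K)
    with lip[of z a] show "norm (f' z - f' a) \<le> K * \<bar>b - a\<bar>" by simp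
  qed auto
  moreover have "(f b - f' a * b) - (f a - f' a * a) = f b - f a - f' a * (b - a)"
    by (simp add: right_diff_distrib)
  ultimately show ?thesis by (simp add: power2_eq_square mult.assoc)
qed

section \<open>The Hunter--Saxton flow\<close>

text \<open>
  The case \<open>\<alpha> = 0\<close> of the system, with the time derivatives of \<open>u\<close> and \<open>\<rho>\<close> made explicit.
\<close>

locale hs_solution =
  fixes \<kappa> s T :: real and h :: "real \<Rightarrow> real" and u \<rho> ut \<rho>t :: "real \<Rightarrow> real \<Rightarrow> real"
  assumes s: "s \<ge> 3"
    and u_C0: "sobolev_C0 s T u" and \<rho>_C0: "sobolev_C0 (s - 1) T \<rho>"
    and u_C1: "sobolev_C1 (s - 1) T u ut" and \<rho>_C1: "sobolev_C1 (s - 2) T \<rho> \<rho>t"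
    and momentum: "\<And>t x. 0 < t \<Longrightarrow> t < T \<Longrightarrow> ut t x + u t x * deriv (u t) x =
          x_antideriv (\<lambda>y. \<kappa> / 2 * (\<rho> t y)\<^sup>2 + (deriv (u t) y)\<^sup>2 + HS_a 0 \<kappa> (u t) (\<rho> t)) x + h t"
    and transport: "\<And>t x. 0 < t \<Longrightarrow> t < T \<Longrightarrow> \<rho>t t x + u t x * deriv (\<rho> t) x = 0"
begin

definition ux :: "real \<Rightarrow> real \<Rightarrow> real" where "ux t = deriv (u t)"
definition uxx :: "real \<Rightarrow> real \<Rightarrow> real" where "uxx t = deriv (ux t)"

lemma ux_C0: "sobolev_C0 (s - 1) T ux"
  using sobolev_C0_deriv[OF u_C0] s unfolding ux_def[abs_def] by simp

lemma uxx_C0: "sobolev_C0 (s - 2) T uxx"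
  using sobolev_C0_deriv[OF ux_C0] s unfolding uxx_def[abs_def] by simp

lemma ut_C0: "sobolev_C0 (s - 1) T ut"
  using u_C1 by (simp add: sobolev_C1_def)

lemma u_deriv: "t \<in> {0..<T} \<Longrightarrow> (u t has_real_derivative ux t x) (at x)"
  unfolding ux_def using s by (intro csobolev_has_deriv[OF sobolev_C0_csobolev[OF u_C0]]) auto

lemma ux_deriv: "t \<in> {0..<T} \<Longrightarrow> (ux t has_real_derivative uxx t x) (at x)"
  unfolding uxx_def using s by (intro csobolev_has_deriv[OF sobolev_C0_csobolev[OF ux_C0]]) auto

lemma rho_deriv: "t \<in> {0..<T} \<Longrightarrow> (\<rho> t has_real_derivative deriv (\<rho> t) x) (at x)"
  using s by (intro csobolev_has_deriv[OF sobolev_C0_csobolev[OF \<rho>_C0]]) auto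

lemma ut_deriv: "t \<in> {0..<T} \<Longrightarrow> (ut t has_real_derivative deriv (ut t) x) (at x)"
  using s by (intro csobolev_has_deriv[OF sobolev_C0_csobolev[OF ut_C0]]) auto

lemma ux_C1: "sobolev_C1 (s - 2) T ux (\<lambda>t. deriv (ut t))"
  using sobolev_C1_deriv[OF u_C1] s unfolding ux_def[abs_def] by simp

lemma u_periodic: "t \<in> {0..<T} \<Longrightarrow> u t (x + 1) = u t x"
  by (rule csobolev_periodic[OF sobolev_C0_csobolev[OF u_C0]])

text \<open>
  The \<open>x\<close>-derivative of the momentum equation. The term \<open>u\<^sub>x\<^sup>2\<close> from \<open>(u u\<^sub>x)\<^sub>x\<close> cancels the one under the
  antiderivative; this is special to \<open>\<alpha> = 0\<close> and makes the equation for \<open>u\<^sub>x\<close> explicitly solvable.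
\<close>

lemma slope_equation:
  assumes t: "0 < t" "t < T"
  shows "deriv (ut t) x + u t x * uxx t x = \<kappa> / 2 * (\<rho> t x)\<^sup>2 + HS_a 0 \<kappa> (u t) (\<rho> t)"
proof -
  have tI: "t \<in> {0..<T}" using t by simp
  let ?f = "\<lambda>y. \<kappa> / 2 * (\<rho> t y)\<^sup>2 + (ux t y)\<^sup>2 + HS_a 0 \<kappa> (u t) (\<rho> t)"
  have cf: "continuous_on UNIV ?f"
    by (intro continuous_intros csobolev_continuous[OF sobolev_C0_csobolev[OF ux_C0 tI]]
        csobolev_continuous[OF sobolev_C0_csobolev[OF \<rho>_C0 tI]])
  have "((\<lambda>x. ut t x + u t x * ux t x) has_real_derivative (deriv (ut t) x + (ux t x * ux t x + u t x * uxx t x))) (at x)"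
    by (auto intro!: derivative_eq_intros ut_deriv u_deriv ux_deriv tI)
  moreover have "((\<lambda>x. ut t x + u t x * ux t x) has_real_derivative ?f x) (at x)"
    unfolding ux_def momentum[OF t]
    using x_antideriv_derivative[OF cf, of x] unfolding ux_def by (auto intro!: derivative_eq_intros)
  ultimately have "deriv (ut t) x + (ux t x * ux t x + u t x * uxx t x) = ?f x"
    by (rule DERIV_unique)
  thus ?thesis by (simp add: power2_eq_square)
qed

definition characteristic :: "real \<Rightarrow> (real \<Rightarrow> real) \<Rightarrow> bool" where
  "characteristic a y \<longleftrightarrow> continuous_on {0..a} y \<and>
     (\<forall>t\<in>{0<..<a}. (y has_real_derivative u t (y t)) (at t))"

text \<open>
  One constant serves for the slope, for the Lipschitz bound and for the quadratic remainder, which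
  involves \<open>u\<^sub>x\<^sub>x\<close>. It may degenerate as \<open>a\<close> tends to \<open>T\<close>, but enters only qualitative statements about the flow.
\<close>

lemma u_lipschitz:
  assumes "a < T"
  obtains L where "L > 0" "\<And>t x. t \<in> {0..a} \<Longrightarrow> \<bar>ux t x\<bar> \<le> L"
    "\<And>t x y. t \<in> {0..a} \<Longrightarrow> \<bar>u t x - u t y\<bar> \<le> L * \<bar>x - y\<bar>"
    "\<And>t x y. t \<in> {0..a} \<Longrightarrow> \<bar>u t x - u t y - ux t y * (x - y)\<bar> \<le> L * (x - y)\<^sup>2"
proof -
  obtain B1 where B1: "B1 > 0" "\<And>t x. t \<in> {0..a} \<Longrightarrow> \<bar>ux t x\<bar> \<le> B1"
    using sobolev_C0_bounded[OF ux_C0 _ assms] s by auto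
  obtain B2 where B2: "B2 > 0" "\<And>t x. t \<in> {0..a} \<Longrightarrow> \<bar>uxx t x\<bar> \<le> B2"
    using sobolev_C0_bounded[OF uxx_C0 _ assms] s by auto
  define L where "L = max B1 B2"
  have "B1 \<le> L" "B2 \<le> L" by (simp_all add: L_def)
  hence L: "L > 0" "\<And>t x. t \<in> {0..a} \<Longrightarrow> \<bar>ux t x\<bar> \<le> L" "\<And>t x. t \<in> {0..a} \<Longrightarrow> \<bar>uxx t x\<bar> \<le> L"
    using B1 B2 by (meson less_le_trans order.trans)+
  have I: "t \<in> {0..a} \<Longrightarrow> t \<in> {0..<T}" for t using assms by auto
  show ?thesis
  proof (rule that[OF L(1,2)])
    fix t x y assume t: "t \<in> {0..a}"
    show "\<bar>u t x - u t y\<bar> \<le> L * \<bar>x - y\<bar>"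
      by (rule lipschitz_of_deriv_bound[OF u_deriv[OF I[OF t]] L(2)[OF t]])
    show "\<bar>u t x - u t y - ux t y * (x - y)\<bar> \<le> L * (x - y)\<^sup>2"
      by (rule taylor_quadratic_bound[OF u_deriv[OF I[OF t]]
            lipschitz_of_deriv_bound[OF ux_deriv[OF I[OF t]] L(3)[OF t]]]) (use L in simp)
  qed
qed

lemma characteristic_exists:
  assumes a: "0 < a" "a < T"
  obtains y where "y 0 = x" "characteristic a y"
proof -
  obtain L where L: "L > 0" "\<And>t x y. t \<in> {0..a} \<Longrightarrow> \<bar>u t x - u t y\<bar> \<le> L * \<bar>x - y\<bar>"
  proof -
    show ?thesis by (rule u_lipschitz[OF a(2)]) (rule that)
  qed
  have cont: "continuous_on {0..a} (\<lambda>t. u t (y t))" if "continuous_on {0..a} y" for y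
    by (rule sobolev_C0_continuous_compose[OF u_C0 _ that]) (use s a in auto)
  show ?thesis
  proof (rule picard_lindelof_global[OF a(1) _ _ L(1), where F = u and \<xi> = x])
    fix y assume "y 0 = x" "continuous_on {0..a} y" "\<And>t. t \<in> {0<..<a} \<Longrightarrow> (y has_real_derivative u t (y t)) (at t)"
    thus thesis by (intro that[of y]) (auto simp: characteristic_def)
  qed (fact cont, fact L(2))
qed

lemma characteristic_rho:
  assumes a: "0 < a" "a < T" and y: "characteristic a y"
  shows "\<rho> a (y a) = \<rho> 0 (y 0)"
proof (rule DERIV_isconst_end[OF a(1), of "\<lambda>t. \<rho> t (y t)"])
  show "continuous_on {0..a} (\<lambda>t. \<rho> t (y t))"
    by (rule sobolev_C0_continuous_compose[OF \<rho>_C0]) (use s a y in \<open>auto simp: characteristic_def\<close>)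
  fix t assume t: "0 < t" "t < a"
  have "((\<lambda>t. \<rho> t (y t)) has_real_derivative \<rho>t t (y t) + deriv (\<rho> t) (y t) * u t (y t)) (at t)"
    by (rule sobolev_C1_chain[OF \<rho>_C1 _ _ _ rho_deriv]) (use s a t y in \<open>auto simp: characteristic_def\<close>)
  thus "((\<lambda>t. \<rho> t (y t)) has_real_derivative 0) (at t)"
    using transport[of t "y t"] t a by (simp add: mult.commute)
qed

lemma characteristic_subset: "characteristic a y \<Longrightarrow> b \<le> a \<Longrightarrow> characteristic b y"
  by (auto simp: characteristic_def elim: continuous_on_subset)

lemma characteristic_ux_continuous:
  assumes a: "a < T" and y: "characteristic a y"
  shows "continuous_on {0..a} (\<lambda>t. ux t (y t))"
  by (rule sobolev_C0_continuous_compose[OF ux_C0]) (use s a y in \<open>auto simp: characteristic_def\<close>)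

text \<open>
  Along two characteristics the slopes grow by the same nonlocal term \<open>HS_a\<close>, which drops out of their
  difference; what remains is constant in time, since \<open>\<rho>\<close> is constant along characteristics.
\<close>

lemma characteristic_ux_diff:
  assumes a: "0 < a" "a < T" and y: "characteristic a y" and z: "characteristic a z"
  shows "ux a (y a) - ux a (z a) = ux 0 (y 0) - ux 0 (z 0) + \<kappa> / 2 * ((\<rho> 0 (y 0))\<^sup>2 - (\<rho> 0 (z 0))\<^sup>2) * a"
proof -
  let ?c = "\<kappa> / 2 * ((\<rho> 0 (y 0))\<^sup>2 - (\<rho> 0 (z 0))\<^sup>2)"
  have D: "((\<lambda>t. ux t (y t)) has_real_derivative \<kappa> / 2 * (\<rho> 0 (y 0))\<^sup>2 + HS_a 0 \<kappa> (u t) (\<rho> t)) (at t)"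
    if y: "characteristic a y" and t: "0 < t" "t < a" for t y
  proof -
    have "((\<lambda>t. ux t (y t)) has_real_derivative deriv (ut t) (y t) + uxx t (y t) * u t (y t)) (at t)"
      by (rule sobolev_C1_chain[OF ux_C1 _ _ _ ux_deriv]) (use s a t y in \<open>auto simp: characteristic_def\<close>)
    moreover have "\<rho> t (y t) = \<rho> 0 (y 0)"
      by (rule characteristic_rho[OF _ _ characteristic_subset[OF y]]) (use t a in auto)
    ultimately show ?thesis using slope_equation[of t "y t"] t a by (simp add: mult.commute)
  qed
  have "(\<lambda>t. ux t (y t) - ux t (z t) - ?c * t) a = (\<lambda>t. ux t (y t) - ux t (z t) - ?c * t) 0"
  proof (rule DERIV_isconst_end[OF a(1)])
    show "continuous_on {0..a} (\<lambda>t. ux t (y t) - ux t (z t) - ?c * t)"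
      by (intro continuous_intros characteristic_ux_continuous a y z)
    fix t assume t: "0 < t" "t < a"
    show "((\<lambda>t. ux t (y t) - ux t (z t) - ?c * t) has_real_derivative 0) (at t)"
      by (auto intro!: derivative_eq_intros D[OF y t] D[OF z t] simp: algebra_simps)
  qed
  thus ?thesis by simp
qed

lemma characteristic_diff_bound:
  assumes a: "a < T" and y: "characteristic a y" and z: "characteristic a z"
    and lip: "\<And>t x y. t \<in> {0..a} \<Longrightarrow> \<bar>u t x - u t y\<bar> \<le> L * \<bar>x - y\<bar>" and t: "t \<in> {0..a}"
  shows "\<bar>y t - z t\<bar> \<le> exp (L * t) * \<bar>y 0 - z 0\<bar>"
  by (rule gronwall_abs[where d' = "\<lambda>t. u t (y t) - u t (z t)", OF _ _ _ t])
     (use y z lip in \<open>auto simp: characteristic_def intro!: continuous_intros DERIV_diff\<close>)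

text \<open>
  The explicit solution in Lagrangian coordinates. Comparison with the characteristic from the origin
  leaves \<open>A\<close> and \<open>B\<close> undetermined; they absorb the nonlocal term. That the flow is differentiable in the
  initial point, with derivative \<open>exp P\<close>, \<open>P = \<integral> u\<^sub>x\<close> along the characteristic, follows from the quadratic
  remainder of \<open>u\<close>, without linearising the differential equation.
\<close>

lemma flow_structure:
  assumes a: "0 < a" "a < T"
  obtains \<phi> A B where
    "circle_map \<phi> (\<lambda>x. exp (a * ux 0 x + \<kappa> / 4 * a\<^sup>2 * (\<rho> 0 x)\<^sup>2 + B))"
    "\<And>x. ux a (\<phi> x) = ux 0 x + \<kappa> / 2 * a * (\<rho> 0 x)\<^sup>2 + A"
    "\<And>x. \<rho> a (\<phi> x) = \<rho> 0 x"
proof -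
  have aT: "{0..a} \<subseteq> {0..<T}" and T0: "0 \<in> {0..<T}" using a by auto
  obtain L where L: "L > 0" and uxL: "\<And>t x. t \<in> {0..a} \<Longrightarrow> \<bar>ux t x\<bar> \<le> L"
    and lip: "\<And>t x y. t \<in> {0..a} \<Longrightarrow> \<bar>u t x - u t y\<bar> \<le> L * \<bar>x - y\<bar>"
    and taylor: "\<And>t x y. t \<in> {0..a} \<Longrightarrow> \<bar>u t x - u t y - ux t y * (x - y)\<bar> \<le> L * (x - y)\<^sup>2"
  proof -
    show ?thesis by (rule u_lipschitz[OF a(2)]) (rule that)
  qed
  have "\<forall>x. \<exists>y. y 0 = x \<and> characteristic a y"
    using characteristic_exists[OF a] by metis
  then obtain Y where Y0: "\<And>x. Y x 0 = x" and Y: "\<And>x. characteristic a (Y x)" by metis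
  have cY: "continuous_on {0..a} (Y x)" for x using Y by (simp add: characteristic_def)
  have dY: "(Y x has_real_derivative u t (Y x t)) (at t)" if "t \<in> {0<..<a}" for x t
    using Y that by (simp add: characteristic_def)
  define P where "P = (\<lambda>x t. integral {0..t} (\<lambda>r. ux r (Y x r)))"
  have cux: "continuous_on {0..a} (\<lambda>t. ux t (Y x t))" for x by (rule characteristic_ux_continuous[OF a(2) Y])
  have cP: "continuous_on {0..a} (P x)" for x
    unfolding P_def by (intro indefinite_integral_continuous_1 integrable_continuous_real cux)
  have dP: "(P x has_real_derivative ux t (Y x t)) (at t)" if t: "t \<in> {0<..<a}" for x t
  proof -
    have "(P x has_real_derivative ux t (Y x t)) (at t within {0..a})"
      unfolding P_def by (rule integral_has_real_derivative[OF cux]) (use t in auto)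
    thus ?thesis by (subst (asm) at_within_interior) (use t in auto)
  qed
  have P_bound: "\<bar>P x t\<bar> \<le> L * a" if t: "t \<in> {0..a}" for x t
  proof -
    have "norm (P x t) \<le> L * (t - 0)"
      unfolding P_def
      by (rule integral_bound) (use t uxL in \<open>auto intro: continuous_on_subset[OF cux]\<close>)
    also have "\<dots> \<le> L * a" using t L by simp
    finally show ?thesis by simp
  qed
  define \<phi> where "\<phi> = (\<lambda>x. Y x a)"
  have d\<phi>: "(\<phi> has_real_derivative exp (P x a)) (at x)" for x
  proof (rule quadratic_error_imp_derivative)
    fix z
    define E where "E = exp (L * a)"
    \<comment> \<open>constant for the linearised flow; its derivative is quadratically small in \<open>z - x\<close>\<close>
    define e where "e = (\<lambda>t. (Y z t - Y x t) * exp (- P x t))"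
    have d: "\<bar>Y z t - Y x t\<bar> \<le> E * \<bar>z - x\<bar>" if t: "t \<in> {0..a}" for t
    proof -
      have "\<bar>Y z t - Y x t\<bar> \<le> exp (L * t) * \<bar>Y z 0 - Y x 0\<bar>"
        by (rule characteristic_diff_bound[OF a(2) Y Y lip t])
      also have "\<dots> \<le> E * \<bar>z - x\<bar>" using t L by (simp add: Y0 E_def mult_right_mono)
      finally show ?thesis .
    qed
    have de: "(e has_real_derivative (u t (Y z t) - u t (Y x t) - ux t (Y x t) * (Y z t - Y x t)) * exp (- P x t)) (at t)"
      if t: "t \<in> {0<..<a}" for t
      unfolding e_def by (auto intro!: derivative_eq_intros dY[OF t] dP[OF t] simp: algebra_simps)
    have "continuous_on {0..a} e" unfolding e_def by (intro continuous_intros cY cP)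
    from MVT[OF a(1) this] obtain l t where t: "t \<in> {0<..<a}" "(e has_real_derivative l) (at t)" "e a - e 0 = (a - 0) * l"
      using de real_differentiable_def by (metis greaterThanLessThan_iff)
    have tI: "t \<in> {0..a}" using t by auto
    have "\<bar>l\<bar> = \<bar>u t (Y z t) - u t (Y x t) - ux t (Y x t) * (Y z t - Y x t)\<bar> * exp (- P x t)"
      using DERIV_unique[OF t(2) de[OF t(1)]] by (simp add: abs_mult)
    also have "\<dots> \<le> (L * (Y z t - Y x t)\<^sup>2) * E"
      using taylor[OF tI] P_bound[OF tI, of x] L unfolding E_def by (intro mult_mono) auto
    also have "\<dots> \<le> (L * (E * \<bar>z - x\<bar>)\<^sup>2) * E"
      using d[OF tI] L power_mono[OF d[OF tI], of 2] by (intro mult_right_mono mult_left_mono) (auto simp: E_def)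
    finally have l: "\<bar>l\<bar> \<le> L * E ^ 3 * (z - x)\<^sup>2" by (simp add: power_mult_distrib power3_eq_cube power2_eq_square mult_ac)
    have e0: "e 0 = z - x" by (simp add: e_def Y0 P_def)
    have ea: "e a * exp (P x a) = \<phi> z - \<phi> x" by (simp add: e_def \<phi>_def exp_minus)
    have "\<bar>\<phi> z - \<phi> x - exp (P x a) * (z - x)\<bar> = \<bar>(e a - e 0) * exp (P x a)\<bar>"
      unfolding ea[symmetric] e0 by (simp add: algebra_simps)
    also have "\<dots> = a * \<bar>l\<bar> * exp (P x a)" using a by (simp add: t(3) abs_mult)
    also have "\<dots> \<le> a * (L * E ^ 3 * (z - x)\<^sup>2) * E"
      using l a P_bound[of a x] L unfolding E_def by (intro mult_mono) auto
    finally show "\<bar>\<phi> z - \<phi> x - exp (P x a) * (z - x)\<bar> \<le> (a * L * exp (L * a) ^ 4) * (z - x)\<^sup>2"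
      by (simp add: E_def power4_eq_xxxx power3_eq_cube mult_ac)
  qed
  have per: "\<phi> (x + 1) = \<phi> x + 1" for x
  proof -
    have "((\<lambda>t. Y x t + 1) has_real_derivative u t (Y x t + 1)) (at t)" if t: "t \<in> {0<..<a}" for t
    proof -
      have "u t (Y x t + 1) = u t (Y x t)" by (rule u_periodic) (use t a in auto)
      thus ?thesis by (auto intro!: derivative_eq_intros dY[OF t])
    qed
    hence "characteristic a (\<lambda>t. Y x t + 1)"
      unfolding characteristic_def by (auto intro!: continuous_intros cY)
    from characteristic_diff_bound[OF a(2) Y[of "x + 1"] this lip, of a]
    show ?thesis using a by (simp add: Y0 \<phi>_def)
  qed
  have P_formula: "P x a - P 0 a = (ux 0 x - ux 0 0) * a + \<kappa> / 4 * ((\<rho> 0 x)\<^sup>2 - (\<rho> 0 0)\<^sup>2) * a\<^sup>2" for x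
  proof -
    let ?c = "ux 0 x - ux 0 0" and ?d = "(\<rho> 0 x)\<^sup>2 - (\<rho> 0 0)\<^sup>2"
    let ?F = "\<lambda>t. P x t - P 0 t - ?c * t - \<kappa> / 4 * ?d * t\<^sup>2"
    have "?F a = ?F 0"
    proof (rule DERIV_isconst_end[OF a(1)])
      show "continuous_on {0..a} ?F" by (intro continuous_intros cP)
      fix t assume t: "0 < t" "t < a"
      hence tI: "t \<in> {0<..<a}" by simp
      have "ux t (Y x t) - ux t (Y 0 t) = ?c + \<kappa> / 2 * ?d * t"
        using characteristic_ux_diff[OF t(1) _ characteristic_subset[OF Y] characteristic_subset[OF Y], of x 0] t a
        by (simp add: Y0)
      hence eq: "ux t (Y x t) - ux t (Y 0 t) - ?c - \<kappa> / 4 * ?d * (2 * t) = 0" by simp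
      have "(?F has_real_derivative (ux t (Y x t) - ux t (Y 0 t) - ?c - \<kappa> / 4 * ?d * (2 * t))) (at t)"
        by (auto intro!: derivative_eq_intros dP[OF tI])
      thus "(?F has_real_derivative 0) (at t)" unfolding eq .
    qed
    thus ?thesis by (simp add: P_def)
  qed
  define B where "B = P 0 a - a * ux 0 0 - \<kappa> / 4 * a\<^sup>2 * (\<rho> 0 0)\<^sup>2"
  define A where "A = ux a (Y 0 a) - ux 0 0 - \<kappa> / 2 * a * (\<rho> 0 0)\<^sup>2"
  have P_eq: "P x a = a * ux 0 x + \<kappa> / 4 * a\<^sup>2 * (\<rho> 0 x)\<^sup>2 + B" for x
    using P_formula[of x] by (simp add: B_def algebra_simps)
  show ?thesis
  proof (rule that[of \<phi> B A])
    show "circle_map \<phi> (\<lambda>x. exp (a * ux 0 x + \<kappa> / 4 * a\<^sup>2 * (\<rho> 0 x)\<^sup>2 + B))"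
      unfolding circle_map_def P_eq[symmetric]
    proof (intro conjI allI per d\<phi>)
      show "continuous_on UNIV (\<lambda>x. exp (P x a))"
        unfolding P_eq
        by (intro continuous_intros csobolev_continuous[OF sobolev_C0_csobolev[OF ux_C0 T0]]
            csobolev_continuous[OF sobolev_C0_csobolev[OF \<rho>_C0 T0]])
    qed simp
    show "ux a (\<phi> x) = ux 0 x + \<kappa> / 2 * a * (\<rho> 0 x)\<^sup>2 + A" for x
      using characteristic_ux_diff[OF a Y Y, of x 0] by (simp add: Y0 \<phi>_def A_def algebra_simps)
    show "\<rho> a (\<phi> x) = \<rho> 0 x" for x
      using characteristic_rho[OF a Y, of x] by (simp add: Y0 \<phi>_def)
  qed
qed

text \<open>
  At each time, \<open>flow_structure\<close> presents \<open>u\<^sub>x\<close> and \<open>\<rho>\<close> as compositions with a circle map. Its logarithmic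
  derivative, and the functions composed, are linear combinations of the fixed functions \<open>u\<^sub>0'\<close>, \<open>\<rho>\<^sub>0\<close>, \<open>\<rho>\<^sub>0\<^sup>2\<close> and \<open>1\<close>
  with coefficients bounded on \<open>[0,T)\<close>. So a single ball of \<open>H\<^bsup>s-1\<^esup>\<close> works for all times, and one constant
  in \<open>csobolev_compose_bound\<close>.
\<close>

lemma slope_density_bound:
  assumes T: "T > 0"
  obtains C where "C \<ge> 0"
    "\<And>t. 0 < t \<Longrightarrow> t < T \<Longrightarrow> (sobolev_norm (s - 1) (ux t))\<^sup>2 \<le> C"
    "\<And>t. 0 < t \<Longrightarrow> t < T \<Longrightarrow> (sobolev_norm (s - 1) (\<rho> t))\<^sup>2 \<le> C"
proof -
  define r where "r = s - 1"
  have r: "r \<ge> 1" using s by (simp add: r_def)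
  have T0: "0 \<in> {0..<T}" using T by simp
  define R where "R = (\<lambda>x. (\<rho> 0 x)\<^sup>2)"
  have ux0: "ux 0 \<in> csobolev r" unfolding r_def by (rule sobolev_C0_csobolev[OF ux_C0 T0])
  have \<rho>0: "\<rho> 0 \<in> csobolev r" unfolding r_def by (rule sobolev_C0_csobolev[OF \<rho>_C0 T0])
  have R: "R \<in> csobolev r" unfolding R_def by (rule csobolev_square[OF \<rho>0 r])
  define S1 where "S1 = sobolev_const * sobolev_norm r (ux 0)"
  define S2 where "S2 = sobolev_const * sobolev_norm r R"
  have S1: "\<bar>ux 0 x\<bar> \<le> S1" and S2: "\<bar>R x\<bar> \<le> S2" for x
    unfolding S1_def S2_def by (rule csobolev_sup_bound[OF ux0 r], rule csobolev_sup_bound[OF R r])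
  define c2 where "c2 = \<bar>\<kappa>\<bar> / 4 * T\<^sup>2"
  define d2 where "d2 = \<bar>\<kappa>\<bar> / 2 * T"
  define Q where "Q = T * S1 + c2 * S2"
  define Q1 where "Q1 = S1 + d2 * S2"
  define m1 where "m1 = 4 * T\<^sup>2 * (sobolev_norm r (ux 0))\<^sup>2 + 4 * c2\<^sup>2 * (sobolev_norm r R)\<^sup>2 + 2 * Q\<^sup>2"
  define m2 where "m2 = 4 * 1\<^sup>2 * (sobolev_norm r (ux 0))\<^sup>2 + 4 * d2\<^sup>2 * (sobolev_norm r R)\<^sup>2 + 2 * Q1\<^sup>2"
  \<comment> \<open>the squared norms of \<open>ln \<phi>'\<close> and \<open>u\<^sub>x \<circ> \<phi>\<close> are at most \<open>m1\<close> and \<open>m2\<close>, and \<open>\<rho> \<circ> \<phi> = \<rho>\<^sub>0\<close>\<close>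
  define M where "M = sqrt (m1 + m2 + (sobolev_norm r (\<rho> 0))\<^sup>2)"
  have m: "m1 \<ge> 0" "m2 \<ge> 0" by (auto simp: m1_def m2_def)
  have M: "M \<ge> 0" using m by (simp add: M_def)
  obtain C where C: "C \<ge> 0" and compose:
    "\<And>p g f \<phi>. \<lbrakk>p \<in> csobolev r; g \<in> csobolev r; sobolev_norm r p \<le> M; sobolev_norm r g \<le> M;
       circle_map \<phi> (\<lambda>x. exp (p x)); continuous_on UNIV f; \<forall>x. f (x + 1) = f x; \<forall>x. f (\<phi> x) = g x\<rbrakk>
      \<Longrightarrow> f \<in> csobolev r \<and> (sobolev_norm r f)\<^sup>2 \<le> C"
  proof -
    show ?thesis by (rule csobolev_compose_bound[OF r M]) (rule that)
  qed
  have main: "(sobolev_norm r (ux a))\<^sup>2 \<le> C \<and> (sobolev_norm r (\<rho> a))\<^sup>2 \<le> C" if a: "0 < a" "a < T" for a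
  proof -
    have aT: "a \<in> {0..<T}" using a by simp
    obtain \<phi> A B where \<phi>: "circle_map \<phi> (\<lambda>x. exp (a * ux 0 x + \<kappa> / 4 * a\<^sup>2 * (\<rho> 0 x)\<^sup>2 + B))"
      and g: "\<And>x. ux a (\<phi> x) = ux 0 x + \<kappa> / 2 * a * (\<rho> 0 x)\<^sup>2 + A"
      and \<rho>: "\<And>x. \<rho> a (\<phi> x) = \<rho> 0 x"
    proof -
      show ?thesis by (rule flow_structure[OF a]) (rule that)
    qed
    have ca: "\<bar>a\<bar> \<le> T" "\<bar>\<kappa> / 4 * a\<^sup>2\<bar> \<le> c2" "\<bar>\<kappa> / 2 * a\<bar> \<le> d2"
      using a unfolding c2_def d2_def by (auto simp: abs_mult intro!: mult_left_mono power_mono)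
    have bound: "\<bar>c * x + d * y\<bar> \<le> c' * x' + d' * y'"
      if "\<bar>c\<bar> \<le> c'" "\<bar>d\<bar> \<le> d'" "\<bar>x\<bar> \<le> x'" "\<bar>y\<bar> \<le> y'" for c d x y c' d' x' y' :: real
    proof -
      have "\<bar>c * x + d * y\<bar> \<le> \<bar>c\<bar> * \<bar>x\<bar> + \<bar>d\<bar> * \<bar>y\<bar>"
        using abs_triangle_ineq[of "c * x" "d * y"] by (simp add: abs_mult)
      also have "\<dots> \<le> c' * x' + d' * y'" using that by (intro add_mono mult_mono) auto
      finally show ?thesis .
    qed
    have B: "\<bar>B\<bar> \<le> Q"
    proof (rule normalisation_bound[OF \<phi>])
      fix x show "\<bar>a * ux 0 x + \<kappa> / 4 * a\<^sup>2 * (\<rho> 0 x)\<^sup>2\<bar> \<le> Q"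
        unfolding Q_def using bound[OF ca(1,2) S1 S2, of x x] by (simp add: R_def)
    qed
    have uxa: "ux a \<in> csobolev r" unfolding r_def by (rule sobolev_C0_csobolev[OF ux_C0 aT])
    have \<rho>a: "\<rho> a \<in> csobolev r" unfolding r_def by (rule sobolev_C0_csobolev[OF \<rho>_C0 aT])
    have "(ux a has_integral (u a 1 - u a 0)) {0..1}"
      by (rule fundamental_theorem_real) (simp_all add: u_deriv[OF aT])
    hence i0: "integral {0..1} (ux a) = 0" using u_periodic[OF aT, of 0] by (simp add: integral_unique)
    have A: "\<bar>A\<bar> \<le> Q1"
    proof (rule mean_zero_constant_bound[OF \<phi> csobolev_continuous[OF uxa] csobolev_periodic[OF uxa] i0 g])
      fix x show "\<bar>ux 0 x + \<kappa> / 2 * a * (\<rho> 0 x)\<^sup>2\<bar> \<le> Q1"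
        unfolding Q1_def using bound[of 1 1, OF _ ca(3) S1 S2, of x x] by (simp add: R_def)
    qed
    have le_M: "sobolev_norm r f \<le> M" if "(sobolev_norm r f)\<^sup>2 \<le> m1 \<or> (sobolev_norm r f)\<^sup>2 \<le> m2 \<or> f = \<rho> 0" for f
      unfolding M_def by (rule real_le_rsqrt) (use that m in \<open>auto simp: add_increasing add_increasing2\<close>)
    let ?p = "\<lambda>x. a * ux 0 x + \<kappa> / 4 * a\<^sup>2 * (\<rho> 0 x)\<^sup>2 + B"
    let ?g = "\<lambda>x. ux 0 x + \<kappa> / 2 * a * (\<rho> 0 x)\<^sup>2 + A"
    have p1: "?p \<in> csobolev r" "(sobolev_norm r ?p)\<^sup>2 \<le> m1"
      using csobolev_linear_combination[OF ux0 R ca(1,2) B] unfolding m1_def R_def by auto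
    have g1: "?g \<in> csobolev r" "(sobolev_norm r ?g)\<^sup>2 \<le> m2"
      using csobolev_linear_combination[OF ux0 R _ ca(3) A, of 1 1] unfolding m2_def R_def by auto
    have "ux a \<in> csobolev r \<and> (sobolev_norm r (ux a))\<^sup>2 \<le> C"
      by (rule compose[OF p1(1) g1(1) le_M le_M \<phi> csobolev_continuous[OF uxa]])
         (use p1 g1 csobolev_periodic[OF uxa] g in auto)
    moreover have "\<rho> a \<in> csobolev r \<and> (sobolev_norm r (\<rho> a))\<^sup>2 \<le> C"
      by (rule compose[OF p1(1) \<rho>0 le_M le_M \<phi> csobolev_continuous[OF \<rho>a]])
         (use p1 csobolev_periodic[OF \<rho>a] \<rho> in auto)
    ultimately show ?thesis by blast
  qed
  show ?thesis by (rule that[OF C]) (use main in \<open>auto simp: r_def\<close>)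
qed

text \<open>
  At \<open>x = 0\<close> the antiderivative vanishes, and the equation reduces to \<open>u\<^sub>t = h - u u\<^sub>x\<close>, which is linear in \<open>u\<close>
  with the bounded coefficient \<open>u\<^sub>x\<close>.
\<close>

lemma origin_bound:
  assumes T: "T > 0" and h: "continuous_on {0..} h" and Q: "\<And>t x. 0 < t \<Longrightarrow> t < T \<Longrightarrow> \<bar>ux t x\<bar> \<le> Q"
  obtains Y where "Y \<ge> 0" "\<And>t. 0 < t \<Longrightarrow> t < T \<Longrightarrow> \<bar>u t 0\<bar> \<le> Y"
proof -
  have "bounded (h ` {0..T})"
    by (intro compact_imp_bounded compact_continuous_image continuous_on_subset[OF h]) auto
  then obtain H where H: "H > 0" "\<And>t. t \<in> {0..T} \<Longrightarrow> \<bar>h t\<bar> \<le> H"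
    unfolding bounded_pos by auto
  have Q0: "Q \<ge> 0" using Q[of "T / 2" 0] T by simp
  define L where "L = 2 * Q + H"
  have L: "L > 0" using Q0 H by (simp add: L_def)
  define Y where "Y = sqrt (exp (L * T) * ((u 0 0)\<^sup>2 + 1))"
  show ?thesis
  proof (rule that[of Y])
    fix a assume a: "0 < a" "a < T"
    \<comment> \<open>the summand \<open>1\<close> absorbs \<open>h\<close>, since \<open>2 \<bar>u\<bar> \<le> u\<^sup>2 + 1\<close>, and makes the inequality for \<open>w\<close> homogeneous\<close>
    let ?w = "\<lambda>t. (u t 0)\<^sup>2 + 1"
    have D: "(?w has_real_derivative 2 * u t 0 * ut t 0) (at t)" if t: "t \<in> {0<..<a}" for t
    proof -
      have tT: "0 < t" "t < T" "t \<in> {0..<T}" using t a by auto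
      have "((\<lambda>t. u t ((\<lambda>_. 0) t)) has_real_derivative ut t ((\<lambda>_. 0) t) + ux t 0 * 0) (at t)"
        by (rule sobolev_C1_chain[OF u_C1 _ tT(1,2) u_deriv[OF tT(3)]]) (use s in auto)
      thus ?thesis by (auto intro!: derivative_eq_intros)
    qed
    have "\<bar>?w a\<bar> \<le> exp (L * a) * \<bar>?w 0\<bar>"
    proof (rule gronwall_abs[where d' = "\<lambda>t. 2 * u t 0 * ut t 0"])
      show "continuous_on {0..a} ?w"
        by (intro continuous_intros sobolev_C0_continuous_compose[OF u_C0]) (use s a in auto)
      fix t assume t: "t \<in> {0<..<a}"
      show "(?w has_real_derivative 2 * u t 0 * ut t 0) (at t)" by (rule D[OF t])
      have tT: "0 < t" "t < T" using t a by auto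
      have "ut t 0 = h t - u t 0 * ux t 0" using momentum[OF tT, of 0] by (simp add: x_antideriv_0 ux_def)
      hence "\<bar>ut t 0\<bar> \<le> H + \<bar>u t 0\<bar> * Q"
        using H(2)[of t] mult_left_mono[OF Q[OF tT, of 0], of "\<bar>u t 0\<bar>"] tT abs_triangle_ineq4[of "h t" "u t 0 * ux t 0"]
        by (simp add: abs_mult)
      hence "\<bar>2 * u t 0 * ut t 0\<bar> \<le> 2 * \<bar>u t 0\<bar> * (H + \<bar>u t 0\<bar> * Q)"
        by (simp add: abs_mult mult_left_mono)
      also have "\<dots> = 2 * Q * (u t 0)\<^sup>2 + H * (2 * \<bar>u t 0\<bar>)"
        by (simp add: power2_eq_square algebra_simps)
      also have "\<dots> \<le> 2 * Q * ?w t + H * ?w t"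
      proof (intro add_mono mult_left_mono)
        have "0 \<le> (\<bar>u t 0\<bar> - 1)\<^sup>2" by simp
        thus "2 * \<bar>u t 0\<bar> \<le> ?w t" by (simp add: power2_diff)
      qed (use Q0 H in auto)
      also have "\<dots> = L * \<bar>?w t\<bar>" by (simp add: L_def algebra_simps)
      finally show "\<bar>2 * u t 0 * ut t 0\<bar> \<le> L * \<bar>?w t\<bar>" .
    qed (use a in auto)
    also have "\<dots> \<le> exp (L * T) * ?w 0" using a L by (simp add: mult_right_mono)
    finally have "(u a 0)\<^sup>2 \<le> exp (L * T) * ?w 0" by simp
    thus "\<bar>u a 0\<bar> \<le> Y" unfolding Y_def by (intro real_le_rsqrt) simp
  qed (simp add: Y_def)
qed

theorem sobolev_norms_bounded:
  assumes T: "T > 0" and h: "continuous_on {0..} h"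
  obtains C where "\<And>t. 0 < t \<Longrightarrow> t < T \<Longrightarrow> (sobolev_norm s (u t))\<^sup>2 + (sobolev_norm (s - 1) (\<rho> t))\<^sup>2 \<le> C"
proof -
  obtain C where C: "C \<ge> 0" and uxC: "\<And>t. 0 < t \<Longrightarrow> t < T \<Longrightarrow> (sobolev_norm (s - 1) (ux t))\<^sup>2 \<le> C"
    and \<rho>C: "\<And>t. 0 < t \<Longrightarrow> t < T \<Longrightarrow> (sobolev_norm (s - 1) (\<rho> t))\<^sup>2 \<le> C"
    using slope_density_bound[OF T] by blast
  define Q where "Q = sobolev_const * sqrt C"
  have Q: "\<bar>ux t x\<bar> \<le> Q" if t: "0 < t" "t < T" for t x
  proof -
    have "ux t \<in> csobolev (s - 1)" by (rule sobolev_C0_csobolev[OF ux_C0]) (use t in auto)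
    hence "\<bar>ux t x\<bar> \<le> sobolev_const * sobolev_norm (s - 1) (ux t)" by (rule csobolev_sup_bound) (use s in simp)
    also have "\<dots> \<le> Q"
      unfolding Q_def by (intro mult_left_mono real_le_rsqrt uxC t sobolev_const_nonneg)
    finally show ?thesis .
  qed
  obtain Y where Y: "Y \<ge> 0" "\<And>t. 0 < t \<Longrightarrow> t < T \<Longrightarrow> \<bar>u t 0\<bar> \<le> Y"
    using origin_bound[OF T h Q] by blast
  show ?thesis
  proof (rule that[of "(Y + Q)\<^sup>2 + 2 * C + C"])
    fix t assume t: "0 < t" "t < T"
    hence tI: "t \<in> {0..<T}" by simp
    have ut: "u t \<in> csobolev s" by (rule sobolev_C0_csobolev[OF u_C0 tI])
    note cu = csobolev_continuous[OF ut]
    have sup: "(u t x)\<^sup>2 \<le> (Y + Q)\<^sup>2" if x: "x \<in> {0..1}" for x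
    proof -
      have "\<bar>u t x - u t 0\<bar> \<le> Q * \<bar>x - 0\<bar>"
        by (rule lipschitz_of_deriv_bound[OF u_deriv[OF tI] Q[OF t]])
      also have "\<dots> \<le> Q * 1" using x Q[OF t, of 0] by (intro mult_left_mono) auto
      finally have "\<bar>u t x\<bar> \<le> Y + Q" using Y(2)[OF t] by linarith
      thus ?thesis by (metis abs_ge_zero power2_abs power_mono)
    qed
    have "(cmod (fourier_coeff (u t) 0))\<^sup>2 \<le> integral {0..1} (\<lambda>x. (u t x)\<^sup>2 * 1)"
      using bessel_pull[OF circle_map_id cu, of "{0}"] by (simp add: fourier_coeff_eq_pull[OF cu])
    also have "\<dots> \<le> integral {0..1::real} (\<lambda>x. (Y + Q)\<^sup>2)"
      by (rule integral_le) (use sup in \<open>auto intro!: integrable_continuous_real continuous_intros cu\<close>)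
    finally have "(cmod (fourier_coeff (u t) 0))\<^sup>2 \<le> (Y + Q)\<^sup>2" by simp
    thus "(sobolev_norm s (u t))\<^sup>2 + (sobolev_norm (s - 1) (\<rho> t))\<^sup>2 \<le> (Y + Q)\<^sup>2 + 2 * C + C"
      using sobolev_norm_le_deriv[OF ut] s uxC[OF t] \<rho>C[OF t] by (simp add: ux_def)
  qed
qed

end

section \<open>Boundedness of the Sobolev norms\<close>

theorem theorem6p1:
  fixes \<alpha> \<kappa> s T :: real
    and h :: "real \<Rightarrow> real"
    and u0 \<rho>0 :: "real \<Rightarrow> real"
    and u \<rho> :: "real \<Rightarrow> real \<Rightarrow> real"
  assumes "\<alpha> = 0" and "\<kappa> > 0" and "s \<ge> 3" and "T > 0"
    and "continuous_on {0..} h"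
    and "u0 \<in> sobolev s" and "\<rho>0 \<in> sobolev (s - 1)"
    and "(\<forall>x. \<rho>0 x > 0) \<or> (\<forall>x. \<rho>0 x < 0)"
    and "HS_solution \<alpha> \<kappa> h s T u0 \<rho>0 u \<rho>"
  shows "bounded ((\<lambda>t. sobolev_pair_norm s (s - 1) (u t, \<rho> t)) ` {0..<T})"
proof -
  obtain ut \<rho>t where C0: "sobolev_C0 s T u" "sobolev_C0 (s - 1) T \<rho>"
    and C1: "sobolev_C1 (s - 1) T u ut" "sobolev_C1 (s - 2) T \<rho> \<rho>t"
    and eqs: "\<forall>t\<in>{0<..<T}. \<forall>x.
          ut t x + u t x * deriv (u t) x =
            x_antideriv (\<lambda>y. \<kappa> / 2 * (\<rho> t y)\<^sup>2 + (\<alpha> + 2) / 2 * (deriv (u t) y)\<^sup>2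
                              + HS_a \<alpha> \<kappa> (u t) (\<rho> t)) x + h t \<and>
          \<rho>t t x + u t x * deriv (\<rho> t) x = \<alpha> * deriv (u t) x * \<rho> t x"
    using assms(9) unfolding HS_solution_def by blast
  have sol: "hs_solution \<kappa> s T h u \<rho> ut \<rho>t"
  proof
    fix t x assume "0 < t" "t < T"
    hence t: "t \<in> {0<..<T}" by simp
    show "ut t x + u t x * deriv (u t) x =
        x_antideriv (\<lambda>y. \<kappa> / 2 * (\<rho> t y)\<^sup>2 + (deriv (u t) y)\<^sup>2 + HS_a 0 \<kappa> (u t) (\<rho> t)) x + h t"
      "\<rho>t t x + u t x * deriv (\<rho> t) x = 0"
      using bspec[OF eqs t] assms(1) by simp_all
  qed (fact assms(3) C0 C1)+
  interpret hs_solution \<kappa> s T h u \<rho> ut \<rho>t by (rule sol)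
  obtain C where C: "\<And>t. 0 < t \<Longrightarrow> t < T \<Longrightarrow> (sobolev_norm s (u t))\<^sup>2 + (sobolev_norm (s - 1) (\<rho> t))\<^sup>2 \<le> C"
    using sobolev_norms_bounded[OF assms(4,5)] by blast
  define N where "N = (\<lambda>t. sobolev_pair_norm s (s - 1) (u t, \<rho> t))"
  have N: "N t = sqrt ((sobolev_norm s (u t))\<^sup>2 + (sobolev_norm (s - 1) (\<rho> t))\<^sup>2)" for t
    by (simp add: N_def sobolev_pair_norm_def)
  have "norm (N t) \<le> max (N 0) (sqrt C)" if t: "t \<in> {0..<T}" for t
  proof (cases "t = 0")
    case True
    have "N t \<ge> 0" by (simp add: N)
    thus ?thesis using True by simp
  next
    case False
    hence "N t \<le> sqrt C" unfolding N using C[of t] t by (intro real_sqrt_le_mono) auto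
    moreover have "N t \<ge> 0" by (simp add: N)
    ultimately show ?thesis by simp
  qed
  hence "bounded (N ` {0..<T})" unfolding bounded_iff by blast
  thus ?thesis by (simp add: N_def)
qed

end
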